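(* Let $\alpha\in\mathbb R$ and let $(V,\varphi)$, $\varphi=(\beta,\gamma)$, be an $L$-twisted $\mathrm{Sp}(2n,\mathbb R)$-Higgs pair over a compact Riemann surface $X$. For subbundles denoted $V_j\subset V$ put $n_j=\mathrm{rk}\,V_j$ (and $n=\mathrm{rk}\,V$). Inclusions in filtrations $0\subset V_1\subset V_2\subset V$ by holomorphic subbundles are not required to be strict. Consider the condition on such a filtration $$\varphi\in H^0\big(L\otimes((S^2V_2+V_1\otimes_SV)\oplus(S^2V_1^\perp+V_2^\perp\otimes_SV^* ))\big).\qquad(\dagger)$$ (1) $(V,\varphi)$ is $\alpha$-semistable if and only if for any filtration of holomorphic subbundles $0\subset V_1\subset V_2\subset V$ satisfying $(\dagger)$ we have $\deg V-\deg V_2-\deg V_1\ge\alpha(n-n_2-n_1)$. (2) $(V,\varphi)$ is $\alpha$-stable if and only if for any filtration of holomorphic subbundles $0\subset V_1\subset V_2\subset V$ satisfying $(\dagger)$, except the filtration $0=V_1\subset V_2=V$, we have $\deg V-\deg V_2-\deg V_1>\alpha(n-n_2-n_1)$. (3) $(V,\varphi)$ is $\alpha$-polystable if and only if it is $\alpha$-semistable and: for any filtration of holomorphic subbundles $0\subset V_1\subset V_2\subset V$ distinct from $0=V_1\subset V_2=V$, satisfying $(\dagger)$ and $\deg V-\deg V_2-\deg V_1=\alpha(n-n_2-n_1)$, there exists an isomorphism of holomorphic vector bundles $\sigma:V\to V_1\oplus V_2/V_1\oplus V/V_2$ such that (a) $V_1=\sigma^{-1}(V_1)$ and $V_2=\sigma^{-1}(V_1\oplus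 V_2/V_1)$; (b) $\beta\in H^0\big(L\otimes(S^2(\sigma^{-1}(V_2/V_1))\oplus\sigma^{-1}(V_1)\otimes_S\sigma^{-1}(V/V_2))\big)$; (c) $\gamma\in H^0\big(L\otimes(S^2(\sigma^*(V_2/V_1)^* )\oplus\sigma^*(V_1^* )\otimes_S\sigma^*((V/V_2)^* ))\big)$.
   Context: $L$ is a holomorphic line bundle on $X$. An $L$-twisted $\mathrm{Sp}(2n,\mathbb R)$-Higgs pair is a rank $n$ holomorphic vector bundle $V$ with a section $\varphi=(\beta,\gamma)\in H^0(L\otimes S^2V\oplus L\otimes S^2V^* )$. For subbundles $W',W''\subset W$, $W'\otimes_SW''$ denotes the image (as a subbundle, in the sheaf-theoretic sense) of $W'\otimes W''$ under symmetrization $W\otimes W\to S^2W$, and $W'^\perp\subset W^*$ is the kernel of restriction $W^*\to W'^*$. $\sigma^*$ denotes the dual of $\sigma$. A filtration of $V$ of length $k-1$ ($k\ge1$) is $\mathcal V=(0=V_0\subsetneq V_1\subsetneq\dots\subsetneq V_k=V)$ with holomorphic subbundles; let $\lambda=(\lambda_1<\dots<\lambda_k)$ be real numbers. Put $$N(\mathcal V,\lambda)=\sum_{\lambda_i+\lambda_j\le0}L\otimes(V_i\otimes_SV_j)\ \oplus\sum_{\lambda_i+\lambda_j\ge0}L\otimes(V_{i-1}^\perp\otimes_SV_{j-1}^\perp)$$ (sums over $1\le i,j\le k$) and $d(\mathcal V,\lambda,\alpha)=\lambda_k(\deg V_k-\alpha n_k)+\sum_{j=1}^{k-1}(\lambda_j-\lambda_{j+1})(\deg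 V_j-\alpha n_j)$, $n_j=\mathrm{rk}\,V_j$. $(\mathcal V,\lambda)$ is trivial if $k=1$ and $\lambda_1=0$. Definitions. $(V,\varphi)$ is $\alpha$-semistable (resp. $\alpha$-stable) if for every $k\ge1$, every filtration $\mathcal V$ of length $k-1$ and every strictly increasing $\lambda$ with $(\mathcal V,\lambda)$ not trivial and $\varphi\in H^0(N(\mathcal V,\lambda))$ one has $d(\mathcal V,\lambda,\alpha)\ge0$ (resp. $>0$). It is $\alpha$-polystable if it is $\alpha$-semistable and for every such non-trivial $(\mathcal V,\lambda)$ with $\varphi\in H^0(N(\mathcal V,\lambda))$ and $d(\mathcal V,\lambda,\alpha)=0$ there is an isomorphism of holomorphic bundles $\sigma:V\to V_1\oplus V_2/V_1\oplus\dots\oplus V_k/V_{k-1}$ with $V_j=\sigma^{-1}(V_1\oplus\dots\oplus V_j/V_{j-1})$ for all $j$, such that $\beta\in H^0\big(\sum_{\lambda_i+\lambda_j=0}L\otimes\sigma^{-1}(V_i/V_{i-1})\otimes_S\sigma^{-1}(V_j/V_{j-1})\big)$ and $\gamma\in H^0\big(\sum_{\lambda_i+\lambda_j=0}L\otimes\sigma^*((V_i/V_{i-1})^* )\otimes_S\sigma^*((V_j/V_{j-1})^* )\big)$. *)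

theory Defs
  imports
    "HOL-Complex_Analysis.Complex_Analysis"
    "HOL-Algebra.Module"
    "HOL-Algebra.AbelCoset"
begin

section \<open>Complex vector spaces as modules\<close>

text \<open>Fibres of bundles are modules in the sense of HOL-Algebra over the field of complex numbers.
  The ring multiplication and unit that the record of a module inherits play no role and are left
  \<open>undefined\<close> in the constructions below.\<close>

definition CC :: "complex ring" where
  "CC = \<lparr>carrier = UNIV, mult = (*), one = 1, zero = 0, add = (+)\<rparr>"

definition cspan :: "(complex, 'v) module \<Rightarrow> 'v set \<Rightarrow> 'v set" where
  "cspan M S = \<Inter>{N. submodule N CC M \<and> S \<subseteq> N}"

definition is_coords :: "(complex, 'v) module \<Rightarrow> nat \<Rightarrow> (nat \<Rightarrow> 'v) \<Rightarrow> 'v \<Rightarrow> (nat \<Rightarrow> complex) \<Rightarrow> bool" where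
  "is_coords M n e v c \<longleftrightarrow>
     c \<in> {..<n} \<rightarrow>\<^sub>E UNIV \<and> v = (\<Oplus>\<^bsub>M\<^esub>i\<in>{..<n}. c i \<odot>\<^bsub>M\<^esub> e i)"

definition cbasis :: "(complex, 'v) module \<Rightarrow> nat \<Rightarrow> (nat \<Rightarrow> 'v) \<Rightarrow> bool" where
  "cbasis M n e \<longleftrightarrow> (\<forall>i<n. e i \<in> carrier M) \<and> (\<forall>v\<in>carrier M. \<exists>!c. is_coords M n e v c)"

definition coord :: "(complex, 'v) module \<Rightarrow> nat \<Rightarrow> (nat \<Rightarrow> 'v) \<Rightarrow> 'v \<Rightarrow> nat \<Rightarrow> complex" where
  "coord M n e v = (THE c. is_coords M n e v c)"

definition lin_maps :: "(complex, 'v) module \<Rightarrow> (complex, 'w) module \<Rightarrow> ('v \<Rightarrow> 'w) set" where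
  "lin_maps M N = {f \<in> carrier M \<rightarrow>\<^sub>E carrier N.
     (\<forall>u\<in>carrier M. \<forall>v\<in>carrier M. f (u \<oplus>\<^bsub>M\<^esub> v) = f u \<oplus>\<^bsub>N\<^esub> f v) \<and>
     (\<forall>c. \<forall>u\<in>carrier M. f (c \<odot>\<^bsub>M\<^esub> u) = c \<odot>\<^bsub>N\<^esub> f u)}"

definition complex_line :: "(complex, complex) module" where
  "complex_line = \<lparr>carrier = UNIV, mult = (*), one = 1, zero = 0, add = (+), smult = (*)\<rparr>"

definition dual_space :: "(complex, 'v) module \<Rightarrow> (complex, 'v \<Rightarrow> complex) module" where
  "dual_space M = \<lparr>carrier = lin_maps M complex_line, mult = undefined, one = undefined,
     zero = (\<lambda>v\<in>carrier M. 0),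
     add = (\<lambda>\<xi> \<eta>. \<lambda>v\<in>carrier M. \<xi> v + \<eta> v),
     smult = (\<lambda>c \<xi>. \<lambda>v\<in>carrier M. c * \<xi> v)\<rparr>"

definition quot_space :: "(complex, 'v) module \<Rightarrow> 'v set \<Rightarrow> (complex, 'v set) module" where
  "quot_space M W = \<lparr>carrier = a_rcosets\<^bsub>M\<^esub> W, mult = undefined, one = undefined,
     zero = W,
     add = (\<lambda>P Q. P <+>\<^bsub>M\<^esub> Q),
     smult = (\<lambda>c P. \<Union>v\<in>P. W +>\<^bsub>M\<^esub> (c \<odot>\<^bsub>M\<^esub> v))\<rparr>"

definition dsum_space :: "nat set \<Rightarrow> (nat \<Rightarrow> (complex, 'v) module) \<Rightarrow> (complex, nat \<Rightarrow> 'v) module" where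
  "dsum_space I M = \<lparr>carrier = (\<Pi>\<^sub>E i\<in>I. carrier (M i)), mult = undefined, one = undefined,
     zero = (\<lambda>i\<in>I. \<zero>\<^bsub>M i\<^esub>),
     add = (\<lambda>f g. \<lambda>i\<in>I. f i \<oplus>\<^bsub>M i\<^esub> g i),
     smult = (\<lambda>c f. \<lambda>i\<in>I. c \<odot>\<^bsub>M i\<^esub> f i)\<rparr>"

text \<open>For finite-dimensional \<open>M\<close> and \<open>N\<close>, the tensor product of \<open>N\<close> with the second symmetric power of
  the dual of \<open>M\<close> is modelled as the space of \<open>N\<close>-valued symmetric bilinear maps on \<open>M\<close>. The
  tensor product of \<open>N\<close> with the second symmetric power of \<open>M\<close> itself is
  \<open>sym2_dual N (dual_space M)\<close>, a vector of \<open>M\<close> being read as a functional on the dual via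
  \<open>evals\<close> below.\<close>

definition sym2_dual ::
  "(complex, 'l) module \<Rightarrow> (complex, 'v) module \<Rightarrow> (complex, 'v \<Rightarrow> 'v \<Rightarrow> 'l) module" where
  "sym2_dual N M =
     \<lparr>carrier = {b \<in> carrier M \<rightarrow>\<^sub>E lin_maps M N. \<forall>u\<in>carrier M. \<forall>v\<in>carrier M. b u v = b v u},
      mult = undefined, one = undefined,
      zero = (\<lambda>u\<in>carrier M. \<lambda>v\<in>carrier M. \<zero>\<^bsub>N\<^esub>),
      add = (\<lambda>b b'. \<lambda>u\<in>carrier M. \<lambda>v\<in>carrier M. b u v \<oplus>\<^bsub>N\<^esub> b' u v),
      smult = (\<lambda>c b. \<lambda>u\<in>carrier M. \<lambda>v\<in>carrier M. c \<odot>\<^bsub>N\<^esub> b u v)\<rparr>"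

text \<open>The tensor product of \<open>l\<close> with the symmetrization of the tensor product of \<open>\<xi>\<close> and \<open>\<eta>\<close>:\<close>

definition sym_prod ::
  "(complex, 'l) module \<Rightarrow> (complex, 'v) module \<Rightarrow> 'l \<Rightarrow> ('v \<Rightarrow> complex) \<Rightarrow> ('v \<Rightarrow> complex) \<Rightarrow> 'v \<Rightarrow> 'v \<Rightarrow> 'l"
  where
  "sym_prod N M l \<xi> \<eta> =
     (\<lambda>u\<in>carrier M. \<lambda>v\<in>carrier M. ((\<xi> u * \<eta> v + \<xi> v * \<eta> u) / 2) \<odot>\<^bsub>N\<^esub> l)"

definition tensor_S ::
  "(complex, 'l) module \<Rightarrow> (complex, 'v) module \<Rightarrow> ('v \<Rightarrow> complex) set \<Rightarrow> ('v \<Rightarrow> complex) set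
     \<Rightarrow> ('v \<Rightarrow> 'v \<Rightarrow> 'l) set" where
  "tensor_S N M S T =
     cspan (sym2_dual N M) {sym_prod N M l \<xi> \<eta> |l \<xi> \<eta>. l \<in> carrier N \<and> \<xi> \<in> S \<and> \<eta> \<in> T}"

definition evals :: "(complex, 'v) module \<Rightarrow> 'v set \<Rightarrow> (('v \<Rightarrow> complex) \<Rightarrow> complex) set" where
  "evals M W = (\<lambda>v. \<lambda>\<xi>\<in>carrier (dual_space M). \<xi> v) ` W"

definition perp :: "(complex, 'v) module \<Rightarrow> 'v set \<Rightarrow> ('v \<Rightarrow> complex) set" where
  "perp M W = {\<xi> \<in> carrier (dual_space M). \<forall>w\<in>W. \<xi> w = 0}"


section \<open>Riemann surfaces and holomorphic vector bundles\<close>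

type_synonym 'x atlas = "('x set \<times> ('x \<Rightarrow> complex)) set"

text \<open>The surface is the whole type \<open>'x\<close>; second countability is automatic in the compact case.\<close>

definition riemann_surface :: "'x::t2_space atlas \<Rightarrow> bool" where
  "riemann_surface X \<longleftrightarrow>
     connected (UNIV :: 'x set) \<and>
     (\<forall>x. \<exists>(U, z)\<in>X. x \<in> U) \<and>
     (\<forall>(U, z)\<in>X. open U \<and> open (z ` U) \<and> homeomorphism U (z ` U) z (inv_into U z)) \<and>
     (\<forall>(U, z)\<in>X. \<forall>(U', z')\<in>X. (z' \<circ> inv_into U z) holomorphic_on z ` (U \<inter> U'))"

definition compact_riemann_surface :: "'x::t2_space atlas \<Rightarrow> bool" where
  "compact_riemann_surface X \<longleftrightarrow> riemann_surface X \<and> compact (UNIV :: 'x set)"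

definition hol_fun :: "'x::t2_space atlas \<Rightarrow> 'x set \<Rightarrow> ('x \<Rightarrow> complex) \<Rightarrow> bool" where
  "hol_fun X U f \<longleftrightarrow> (\<forall>(W, z)\<in>X. (f \<circ> inv_into W z) holomorphic_on z ` (U \<inter> W))"

text \<open>A bundle is given by its fibres together with its sheaf of holomorphic sections:
  \<open>hsec E U s\<close> says that \<open>s\<close> is a holomorphic section of \<open>E\<close> over the open set \<open>U\<close> (only the
  values of \<open>s\<close> on \<open>U\<close> matter).\<close>

record ('x, 'v) vbundle =
  fibre :: "'x \<Rightarrow> (complex, 'v) module"
  hsec :: "'x set \<Rightarrow> ('x \<Rightarrow> 'v) \<Rightarrow> bool"

definition hol_frame :: "('x::t2_space, 'v) vbundle \<Rightarrow> nat \<Rightarrow> 'x set \<Rightarrow> (nat \<Rightarrow> 'x \<Rightarrow> 'v) \<Rightarrow> bool" where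
  "hol_frame E n U e \<longleftrightarrow>
     open U \<and> (\<forall>x\<in>U. cbasis (fibre E x) n (\<lambda>i. e i x)) \<and> (\<forall>i<n. hsec E U (e i))"

text \<open>Since the members of the trivializing family \<open>T\<close> are themselves holomorphic, the last condition
  makes the transition functions between them holomorphic.\<close>

definition hol_bundle :: "'x::t2_space atlas \<Rightarrow> nat \<Rightarrow> ('x, 'v) vbundle \<Rightarrow> bool" where
  "hol_bundle X n E \<longleftrightarrow>
     (\<forall>x. module CC (fibre E x)) \<and>
     (\<exists>T. (\<forall>x. \<exists>(U, e)\<in>T. x \<in> U) \<and>
          (\<forall>(U, e)\<in>T. hol_frame E n U e) \<and>
          (\<forall>U s. hsec E U s \<longleftrightarrow>
             open U \<and> (\<forall>x\<in>U. s x \<in> carrier (fibre E x)) \<and>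
             (\<forall>(U', e)\<in>T. \<forall>i<n.
                hol_fun X (U \<inter> U') (\<lambda>x. coord (fibre E x) n (\<lambda>j. e j x) (s x) i))))"

definition bundle_rank :: "('x, 'v) vbundle \<Rightarrow> nat" where
  "bundle_rank E = (THE n. \<forall>x. \<exists>e. cbasis (fibre E x) n e)"

definition H0 :: "('x, 'v) vbundle \<Rightarrow> ('x \<Rightarrow> 'v) set" where
  "H0 E = {s. hsec E UNIV s}"

definition zero_sub :: "('x, 'v) vbundle \<Rightarrow> 'x \<Rightarrow> 'v set" where
  "zero_sub E = (\<lambda>x. {\<zero>\<^bsub>fibre E x\<^esub>})"

definition full_sub :: "('x, 'v) vbundle \<Rightarrow> 'x \<Rightarrow> 'v set" where
  "full_sub E = (\<lambda>x. carrier (fibre E x))"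

definition subbundle :: "('x::t2_space, 'v) vbundle \<Rightarrow> ('x \<Rightarrow> 'v set) \<Rightarrow> bool" where
  "subbundle E W \<longleftrightarrow>
     (\<exists>r\<le>bundle_rank E. \<forall>x. \<exists>U e. x \<in> U \<and> hol_frame E (bundle_rank E) U e \<and>
        (\<forall>y\<in>U. W y = cspan (fibre E y) {e i y |i. i < r}))"

definition sub_bundle :: "('x, 'v) vbundle \<Rightarrow> ('x \<Rightarrow> 'v set) \<Rightarrow> ('x, 'v) vbundle" where
  "sub_bundle E W = \<lparr>fibre = (\<lambda>x. (fibre E x)\<lparr>carrier := W x\<rparr>),
     hsec = (\<lambda>U s. hsec E U s \<and> (\<forall>x\<in>U. s x \<in> W x))\<rparr>"

text \<open>Holomorphic sections of a quotient are those that lift locally.\<close>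

definition quot_bundle :: "('x::t2_space, 'v) vbundle \<Rightarrow> ('x \<Rightarrow> 'v set) \<Rightarrow> ('x, 'v set) vbundle" where
  "quot_bundle E W = \<lparr>fibre = (\<lambda>x. quot_space (fibre E x) (W x)),
     hsec = (\<lambda>U q. open U \<and>
        (\<forall>x\<in>U. \<exists>U' s. x \<in> U' \<and> U' \<subseteq> U \<and> hsec E U' s \<and> (\<forall>y\<in>U'. q y = W y +>\<^bsub>fibre E y\<^esub> s y)))\<rparr>"

definition dsum_bundle ::
  "nat set \<Rightarrow> (nat \<Rightarrow> ('x::t2_space, 'v) vbundle) \<Rightarrow> ('x, nat \<Rightarrow> 'v) vbundle" where
  "dsum_bundle I E = \<lparr>fibre = (\<lambda>x. dsum_space I (\<lambda>i. fibre (E i) x)),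
     hsec = (\<lambda>U s. open U \<and> (\<forall>x\<in>U. s x \<in> carrier (dsum_space I (\<lambda>i. fibre (E i) x))) \<and>
        (\<forall>i\<in>I. hsec (E i) U (\<lambda>x. s x i)))\<rparr>"

definition dual_bundle :: "'x::t2_space atlas \<Rightarrow> ('x, 'v) vbundle \<Rightarrow> ('x, 'v \<Rightarrow> complex) vbundle" where
  "dual_bundle X E = \<lparr>fibre = (\<lambda>x. dual_space (fibre E x)),
     hsec = (\<lambda>U \<xi>. open U \<and> (\<forall>x\<in>U. \<xi> x \<in> carrier (dual_space (fibre E x))) \<and>
        (\<forall>U' s. U' \<subseteq> U \<and> hsec E U' s \<longrightarrow> hol_fun X U' (\<lambda>x. \<xi> x (s x))))\<rparr>"

text \<open>The bundle of symmetric bilinear maps on \<open>E\<close> with values in \<open>L\<close>, see \<open>sym2_dual\<close>.\<close>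

definition L_sym2_dual ::
  "('x::t2_space, 'l) vbundle \<Rightarrow> ('x, 'v) vbundle \<Rightarrow> ('x, 'v \<Rightarrow> 'v \<Rightarrow> 'l) vbundle" where
  "L_sym2_dual L E = \<lparr>fibre = (\<lambda>x. sym2_dual (fibre L x) (fibre E x)),
     hsec = (\<lambda>U b. open U \<and> (\<forall>x\<in>U. b x \<in> carrier (sym2_dual (fibre L x) (fibre E x))) \<and>
        (\<forall>U' s t. U' \<subseteq> U \<and> hsec E U' s \<and> hsec E U' t \<longrightarrow> hsec L U' (\<lambda>x. b x (s x) (t x))))\<rparr>"

definition L_sym2 ::
  "'x::t2_space atlas \<Rightarrow> ('x, 'l) vbundle \<Rightarrow> ('x, 'v) vbundle
     \<Rightarrow> ('x, ('v \<Rightarrow> complex) \<Rightarrow> ('v \<Rightarrow> complex) \<Rightarrow> 'l) vbundle" where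
  "L_sym2 X L E = L_sym2_dual L (dual_bundle X E)"

definition bundle_iso :: "('x, 'v) vbundle \<Rightarrow> ('x, 'w) vbundle \<Rightarrow> ('x \<Rightarrow> 'v \<Rightarrow> 'w) \<Rightarrow> bool" where
  "bundle_iso E F \<sigma> \<longleftrightarrow>
     (\<forall>x. \<sigma> x \<in> lin_maps (fibre E x) (fibre F x) \<and>
          bij_betw (\<sigma> x) (carrier (fibre E x)) (carrier (fibre F x))) \<and>
     (\<forall>U s. (\<forall>x\<in>U. s x \<in> carrier (fibre E x)) \<longrightarrow>
        (hsec E U s \<longleftrightarrow> hsec F U (\<lambda>x. \<sigma> x (s x))))"


section \<open>The degree\<close>

text \<open>The degree of \<open>E\<close> is the degree of its determinant line bundle, that is, the number of zeros
  minus the number of poles, with multiplicity, of any nonzero meromorphic section of it. Over a frame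
  \<open>(U, e)\<close> such a section is a function \<open>f U e\<close> times the exterior product of the members of \<open>e\<close>; if
  the frame \<open>e'\<close> is expressed in the frame \<open>e\<close> by the matrix \<open>g\<close>, its exterior product is that of \<open>e\<close>
  times the determinant of \<open>g\<close>. The zero bundle, whose determinant is the trivial line bundle, has
  degree zero; this is stated as a separate case in \<open>bundle_degree\<close>.\<close>

definition frame_det :: "(complex, 'v) module \<Rightarrow> nat \<Rightarrow> (nat \<Rightarrow> 'v) \<Rightarrow> (nat \<Rightarrow> 'v) \<Rightarrow> complex" where
  "frame_det M n e e' =
     (\<Sum>p | p permutes {..<n}. of_int (sign p) * (\<Prod>i<n. coord M n e (e' i) (p i)))"

definition mero_section_det ::
  "'x::t2_space atlas \<Rightarrow> ('x, 'v) vbundle \<Rightarrow> ('x set \<Rightarrow> (nat \<Rightarrow> 'x \<Rightarrow> 'v) \<Rightarrow> 'x \<Rightarrow> complex) \<Rightarrow> bool" where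
  "mero_section_det X E f \<longleftrightarrow>
     (\<forall>U e. hol_frame E (bundle_rank E) U e \<longrightarrow>
        (\<forall>(W, z)\<in>X. (f U e \<circ> inv_into W z) meromorphic_on z ` (U \<inter> W)) \<and>
        (\<forall>U' e'. hol_frame E (bundle_rank E) U' e' \<longrightarrow>
           (\<forall>x\<in>U \<inter> U'. f U e x =
              frame_det (fibre E x) (bundle_rank E) (\<lambda>i. e i x) (\<lambda>i. e' i x) * f U' e' x)))"

definition nonzero_section_det ::
  "'x::t2_space atlas \<Rightarrow> ('x, 'v) vbundle \<Rightarrow> ('x set \<Rightarrow> (nat \<Rightarrow> 'x \<Rightarrow> 'v) \<Rightarrow> 'x \<Rightarrow> complex) \<Rightarrow> bool" where
  "nonzero_section_det X E f \<longleftrightarrow>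
     (\<forall>U e. hol_frame E (bundle_rank E) U e \<longrightarrow>
        (\<forall>(W, z)\<in>X. \<forall>x\<in>U \<inter> W. \<forall>\<^sub>F w in at (z x). (f U e \<circ> inv_into W z) w \<noteq> 0))"

text \<open>The order at \<open>x\<close> does not depend on the frame and the chart used.\<close>

definition ord_det ::
  "'x::t2_space atlas \<Rightarrow> ('x, 'v) vbundle \<Rightarrow> ('x set \<Rightarrow> (nat \<Rightarrow> 'x \<Rightarrow> 'v) \<Rightarrow> 'x \<Rightarrow> complex) \<Rightarrow> 'x \<Rightarrow> int" where
  "ord_det X E f x =
     (THE m. \<forall>U e W z. hol_frame E (bundle_rank E) U e \<and> (W, z) \<in> X \<and> x \<in> U \<inter> W \<longrightarrow>
        m = zorder (f U e \<circ> inv_into W z) (z x))"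

definition bundle_degree :: "'x::t2_space atlas \<Rightarrow> ('x, 'v) vbundle \<Rightarrow> int" where
  "bundle_degree X E =
     (if bundle_rank E = 0 then 0
      else THE d. \<exists>f. mero_section_det X E f \<and> nonzero_section_det X E f \<and>
        d = (\<Sum>x | ord_det X E f x \<noteq> 0. ord_det X E f x))"


section \<open>Twisted symplectic Higgs pairs\<close>

definition higgs_pair ::
  "'x::t2_space atlas \<Rightarrow> ('x, 'l) vbundle \<Rightarrow> nat \<Rightarrow> ('x, 'v) vbundle
     \<Rightarrow> ('x \<Rightarrow> ('v \<Rightarrow> complex) \<Rightarrow> ('v \<Rightarrow> complex) \<Rightarrow> 'l) \<Rightarrow> ('x \<Rightarrow> 'v \<Rightarrow> 'v \<Rightarrow> 'l) \<Rightarrow> bool" where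
  "higgs_pair X L n V \<beta> \<gamma> \<longleftrightarrow>
     hol_bundle X n V \<and> \<beta> \<in> H0 (L_sym2 X L V) \<and> \<gamma> \<in> H0 (L_sym2_dual L V)"

text \<open>Families of subspaces of the fibres of \<open>L_sym2 X L V\<close> and of \<open>L_sym2_dual L V\<close>. They are formed
  fibrewise. All subbundles they are applied to below are members of one flag of subbundles of \<open>V\<close>,
  annihilators of such members, or summands of one decomposition; then they are spanned by
  products of members of an adapted local frame, so the fibrewise images and sums have
  constant rank and agree with the sheaf-theoretic ones.\<close>

definition L_tensor_S ::
  "('x, 'l) vbundle \<Rightarrow> ('x, 'v) vbundle \<Rightarrow> ('x \<Rightarrow> 'v set) \<Rightarrow> ('x \<Rightarrow> 'v set)
     \<Rightarrow> 'x \<Rightarrow> (('v \<Rightarrow> complex) \<Rightarrow> ('v \<Rightarrow> complex) \<Rightarrow> 'l) set" where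
  "L_tensor_S L V W W' = (\<lambda>x. tensor_S (fibre L x) (dual_space (fibre V x))
     (evals (fibre V x) (W x)) (evals (fibre V x) (W' x)))"

definition L_tensor_S_dual ::
  "('x, 'l) vbundle \<Rightarrow> ('x, 'v) vbundle \<Rightarrow> ('x \<Rightarrow> ('v \<Rightarrow> complex) set) \<Rightarrow> ('x \<Rightarrow> ('v \<Rightarrow> complex) set)
     \<Rightarrow> 'x \<Rightarrow> ('v \<Rightarrow> 'v \<Rightarrow> 'l) set" where
  "L_tensor_S_dual L V Z Z' = (\<lambda>x. tensor_S (fibre L x) (fibre V x) (Z x) (Z' x))"

definition sub_sum :: "('x, 'v) vbundle \<Rightarrow> ('x \<Rightarrow> 'v set) set \<Rightarrow> 'x \<Rightarrow> 'v set" where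
  "sub_sum E \<W> = (\<lambda>x. cspan (fibre E x) (\<Union>W\<in>\<W>. W x))"

definition perp_sub :: "('x, 'v) vbundle \<Rightarrow> ('x \<Rightarrow> 'v set) \<Rightarrow> 'x \<Rightarrow> ('v \<Rightarrow> complex) set" where
  "perp_sub V W = (\<lambda>x. perp (fibre V x) (W x))"

definition filtration :: "('x::t2_space, 'v) vbundle \<Rightarrow> nat \<Rightarrow> (nat \<Rightarrow> 'x \<Rightarrow> 'v set) \<Rightarrow> bool" where
  "filtration V k F \<longleftrightarrow>
     k \<ge> 1 \<and> (\<forall>j\<le>k. subbundle V (F j)) \<and> F 0 = zero_sub V \<and> F k = full_sub V \<and>
     (\<forall>j<k. (\<forall>x. F j x \<subseteq> F (Suc j) x) \<and> F j \<noteq> F (Suc j))"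

definition weighted_filtration ::
  "('x::t2_space, 'v) vbundle \<Rightarrow> nat \<Rightarrow> (nat \<Rightarrow> 'x \<Rightarrow> 'v set) \<Rightarrow> (nat \<Rightarrow> real) \<Rightarrow> bool" where
  "weighted_filtration V k F l \<longleftrightarrow> filtration V k F \<and> strict_mono_on {1..k} l"

definition trivial_weighted :: "nat \<Rightarrow> (nat \<Rightarrow> real) \<Rightarrow> bool" where
  "trivial_weighted k l \<longleftrightarrow> k = 1 \<and> l 1 = 0"

definition N_beta ::
  "'x::t2_space atlas \<Rightarrow> ('x, 'l) vbundle \<Rightarrow> ('x, 'v) vbundle \<Rightarrow> nat \<Rightarrow> (nat \<Rightarrow> 'x \<Rightarrow> 'v set) \<Rightarrow> (nat \<Rightarrow> real)
     \<Rightarrow> 'x \<Rightarrow> (('v \<Rightarrow> complex) \<Rightarrow> ('v \<Rightarrow> complex) \<Rightarrow> 'l) set" where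
  "N_beta X L V k F l = sub_sum (L_sym2 X L V)
     {L_tensor_S L V (F i) (F j) |i j. i \<in> {1..k} \<and> j \<in> {1..k} \<and> l i + l j \<le> 0}"

definition N_gamma ::
  "('x::t2_space, 'l) vbundle \<Rightarrow> ('x, 'v) vbundle \<Rightarrow> nat \<Rightarrow> (nat \<Rightarrow> 'x \<Rightarrow> 'v set) \<Rightarrow> (nat \<Rightarrow> real)
     \<Rightarrow> 'x \<Rightarrow> ('v \<Rightarrow> 'v \<Rightarrow> 'l) set" where
  "N_gamma L V k F l = sub_sum (L_sym2_dual L V)
     {L_tensor_S_dual L V (perp_sub V (F (i - 1))) (perp_sub V (F (j - 1))) |i j.
        i \<in> {1..k} \<and> j \<in> {1..k} \<and> l i + l j \<ge> 0}"

definition in_H0_N ::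
  "'x::t2_space atlas \<Rightarrow> ('x, 'l) vbundle \<Rightarrow> ('x, 'v) vbundle
     \<Rightarrow> ('x \<Rightarrow> ('v \<Rightarrow> complex) \<Rightarrow> ('v \<Rightarrow> complex) \<Rightarrow> 'l) \<Rightarrow> ('x \<Rightarrow> 'v \<Rightarrow> 'v \<Rightarrow> 'l)
     \<Rightarrow> nat \<Rightarrow> (nat \<Rightarrow> 'x \<Rightarrow> 'v set) \<Rightarrow> (nat \<Rightarrow> real) \<Rightarrow> bool" where
  "in_H0_N X L V \<beta> \<gamma> k F l \<longleftrightarrow>
     \<beta> \<in> H0 (sub_bundle (L_sym2 X L V) (N_beta X L V k F l)) \<and>
     \<gamma> \<in> H0 (sub_bundle (L_sym2_dual L V) (N_gamma L V k F l))"

definition d_filt ::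
  "'x::t2_space atlas \<Rightarrow> ('x, 'v) vbundle \<Rightarrow> nat \<Rightarrow> (nat \<Rightarrow> 'x \<Rightarrow> 'v set) \<Rightarrow> (nat \<Rightarrow> real) \<Rightarrow> real \<Rightarrow> real" where
  "d_filt X V k F l \<alpha> =
     (let D = (\<lambda>j. of_int (bundle_degree X (sub_bundle V (F j))) - \<alpha> * of_nat (bundle_rank (sub_bundle V (F j))))
      in l k * D k + (\<Sum>j = 1..<k. (l j - l (j + 1)) * D j))"

definition alpha_semistable ::
  "'x::t2_space atlas \<Rightarrow> ('x, 'l) vbundle \<Rightarrow> ('x, 'v) vbundle
     \<Rightarrow> ('x \<Rightarrow> ('v \<Rightarrow> complex) \<Rightarrow> ('v \<Rightarrow> complex) \<Rightarrow> 'l) \<Rightarrow> ('x \<Rightarrow> 'v \<Rightarrow> 'v \<Rightarrow> 'l) \<Rightarrow> real \<Rightarrow> bool" where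
  "alpha_semistable X L V \<beta> \<gamma> \<alpha> \<longleftrightarrow>
     (\<forall>k F l. weighted_filtration V k F l \<and> \<not> trivial_weighted k l \<and> in_H0_N X L V \<beta> \<gamma> k F l
        \<longrightarrow> d_filt X V k F l \<alpha> \<ge> 0)"

definition alpha_stable ::
  "'x::t2_space atlas \<Rightarrow> ('x, 'l) vbundle \<Rightarrow> ('x, 'v) vbundle
     \<Rightarrow> ('x \<Rightarrow> ('v \<Rightarrow> complex) \<Rightarrow> ('v \<Rightarrow> complex) \<Rightarrow> 'l) \<Rightarrow> ('x \<Rightarrow> 'v \<Rightarrow> 'v \<Rightarrow> 'l) \<Rightarrow> real \<Rightarrow> bool" where
  "alpha_stable X L V \<beta> \<gamma> \<alpha> \<longleftrightarrow>
     (\<forall>k F l. weighted_filtration V k F l \<and> \<not> trivial_weighted k l \<and> in_H0_N X L V \<beta> \<gamma> k F l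
        \<longrightarrow> d_filt X V k F l \<alpha> > 0)"

text \<open>The graded pieces \<open>V\<^sub>j / V\<^sub>j\<^sub>-\<^sub>1\<close>. For \<open>j = 1\<close> and \<open>V\<^sub>0 = 0\<close> this is the quotient by zero, which
  stands for \<open>V\<^sub>1\<close> so that all summands have elements of the same type.\<close>

definition gr_piece ::
  "('x::t2_space, 'v) vbundle \<Rightarrow> (nat \<Rightarrow> 'x \<Rightarrow> 'v set) \<Rightarrow> nat \<Rightarrow> ('x, 'v set) vbundle" where
  "gr_piece V F j = quot_bundle (sub_bundle V (F j)) (F (j - 1))"

definition gr_bundle ::
  "('x::t2_space, 'v) vbundle \<Rightarrow> nat \<Rightarrow> (nat \<Rightarrow> 'x \<Rightarrow> 'v set) \<Rightarrow> ('x, nat \<Rightarrow> 'v set) vbundle" where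
  "gr_bundle V k F = dsum_bundle {1..k} (gr_piece V F)"

text \<open>The preimage under \<open>\<sigma>\<close> of the sum of the graded pieces with index in \<open>J\<close>:\<close>

definition pre_gr ::
  "('x::t2_space, 'v) vbundle \<Rightarrow> nat \<Rightarrow> (nat \<Rightarrow> 'x \<Rightarrow> 'v set) \<Rightarrow> ('x \<Rightarrow> 'v \<Rightarrow> nat \<Rightarrow> 'v set)
     \<Rightarrow> nat set \<Rightarrow> 'x \<Rightarrow> 'v set" where
  "pre_gr V k F \<sigma> J =
     (\<lambda>x. {v \<in> carrier (fibre V x). \<forall>i\<in>{1..k} - J. \<sigma> x v i = \<zero>\<^bsub>fibre (gr_piece V F i) x\<^esub>})"

text \<open>The image under the dual of \<open>\<sigma>\<close> of the dual of the \<open>i\<close>-th graded piece:\<close>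

definition dual_gr ::
  "('x::t2_space, 'v) vbundle \<Rightarrow> (nat \<Rightarrow> 'x \<Rightarrow> 'v set) \<Rightarrow> ('x \<Rightarrow> 'v \<Rightarrow> nat \<Rightarrow> 'v set)
     \<Rightarrow> nat \<Rightarrow> 'x \<Rightarrow> ('v \<Rightarrow> complex) set" where
  "dual_gr V F \<sigma> i =
     (\<lambda>x. (\<lambda>\<xi>. \<lambda>v\<in>carrier (fibre V x). \<xi> (\<sigma> x v i)) ` carrier (dual_space (fibre (gr_piece V F i) x)))"

definition alpha_polystable ::
  "'x::t2_space atlas \<Rightarrow> ('x, 'l) vbundle \<Rightarrow> ('x, 'v) vbundle
     \<Rightarrow> ('x \<Rightarrow> ('v \<Rightarrow> complex) \<Rightarrow> ('v \<Rightarrow> complex) \<Rightarrow> 'l) \<Rightarrow> ('x \<Rightarrow> 'v \<Rightarrow> 'v \<Rightarrow> 'l) \<Rightarrow> real \<Rightarrow> bool" where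
  "alpha_polystable X L V \<beta> \<gamma> \<alpha> \<longleftrightarrow>
     alpha_semistable X L V \<beta> \<gamma> \<alpha> \<and>
     (\<forall>k F l. weighted_filtration V k F l \<and> \<not> trivial_weighted k l \<and> in_H0_N X L V \<beta> \<gamma> k F l \<and>
        d_filt X V k F l \<alpha> = 0 \<longrightarrow>
        (\<exists>\<sigma>. bundle_iso V (gr_bundle V k F) \<sigma> \<and>
           (\<forall>j\<in>{1..k}. F j = pre_gr V k F \<sigma> {1..j}) \<and>
           \<beta> \<in> H0 (sub_bundle (L_sym2 X L V) (sub_sum (L_sym2 X L V)
             {L_tensor_S L V (pre_gr V k F \<sigma> {i}) (pre_gr V k F \<sigma> {j}) |i j.
                i \<in> {1..k} \<and> j \<in> {1..k} \<and> l i + l j = 0})) \<and>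
           \<gamma> \<in> H0 (sub_bundle (L_sym2_dual L V) (sub_sum (L_sym2_dual L V)
             {L_tensor_S_dual L V (dual_gr V F \<sigma> i) (dual_gr V F \<sigma> j) |i j.
                i \<in> {1..k} \<and> j \<in> {1..k} \<and> l i + l j = 0}))))"


section \<open>Two-step filtrations\<close>

definition two_step :: "('x::t2_space, 'v) vbundle \<Rightarrow> ('x \<Rightarrow> 'v set) \<Rightarrow> ('x \<Rightarrow> 'v set) \<Rightarrow> bool" where
  "two_step V V1 V2 \<longleftrightarrow> subbundle V V1 \<and> subbundle V V2 \<and> (\<forall>x. V1 x \<subseteq> V2 x)"

definition two_step_filt ::
  "('x, 'v) vbundle \<Rightarrow> ('x \<Rightarrow> 'v set) \<Rightarrow> ('x \<Rightarrow> 'v set) \<Rightarrow> nat \<Rightarrow> 'x \<Rightarrow> 'v set" where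
  "two_step_filt V V1 V2 j =
     (if j = 0 then zero_sub V else if j = 1 then V1 else if j = 2 then V2 else full_sub V)"

text \<open>The second symmetric power of a subbundle is its symmetrized tensor product with itself.\<close>

definition dagger ::
  "'x::t2_space atlas \<Rightarrow> ('x, 'l) vbundle \<Rightarrow> ('x, 'v) vbundle
     \<Rightarrow> ('x \<Rightarrow> ('v \<Rightarrow> complex) \<Rightarrow> ('v \<Rightarrow> complex) \<Rightarrow> 'l) \<Rightarrow> ('x \<Rightarrow> 'v \<Rightarrow> 'v \<Rightarrow> 'l)
     \<Rightarrow> ('x \<Rightarrow> 'v set) \<Rightarrow> ('x \<Rightarrow> 'v set) \<Rightarrow> bool" where
  "dagger X L V \<beta> \<gamma> V1 V2 \<longleftrightarrow>
     \<beta> \<in> H0 (sub_bundle (L_sym2 X L V) (sub_sum (L_sym2 X L V)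
       {L_tensor_S L V V2 V2, L_tensor_S L V V1 (full_sub V)})) \<and>
     \<gamma> \<in> H0 (sub_bundle (L_sym2_dual L V) (sub_sum (L_sym2_dual L V)
       {L_tensor_S_dual L V (perp_sub V V1) (perp_sub V V1),
        L_tensor_S_dual L V (perp_sub V V2) (full_sub (dual_bundle X V))}))"

end

theory Submission
  imports Defs
begin

text \<open>Put \<open>D(W) = deg W - \<alpha> rk W\<close> and \<open>E(V\<^sub>1, V\<^sub>2) = D(V) - D(V\<^sub>2) - D(V\<^sub>1)\<close>. Given a filtration with weights \<open>\<lambda>\<close>
  and a level \<open>t \<ge> 0\<close>, let \<open>p(t)\<close> and \<open>q(t)\<close> be the numbers of weights \<open>< -t\<close> and \<open>\<le> t\<close>. If
  \<open>\<lambda>\<^sub>i + \<lambda>\<^sub>j \<le> 0\<close>, then either both weights are \<open>\<le> t\<close> or one of them is \<open>< -t\<close>; this and its dual show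
  that \<open>\<phi> \<in> H\<^sup>0(N(\<V>, \<lambda>))\<close> makes \<open>V\<^bsub>p(t)\<^esub> \<subseteq> V\<^bsub>q(t)\<^esub>\<close> satisfy the two-step condition. Summation by parts turns
  \<open>\<lambda>\<^sub>i = \<integral> ([\<lambda>\<^sub>i > t] - [\<lambda>\<^sub>i < -t]) dt\<close> into \<open>d(\<V>, \<lambda>) = \<integral> E(V\<^bsub>p(t)\<^esub>, V\<^bsub>q(t)\<^esub>) dt\<close>, a finite combination with
  positive coefficients. Conversely, the two-step condition is that of the weights \<open>-1, 0, 1\<close>.

  For polystability, a splitting of \<open>(\<V>, \<lambda>)\<close> compatible with \<open>\<phi>\<close> is the same as a holomorphic endomorphism
  of \<open>V\<close> that annihilates \<open>\<phi>\<close> infinitesimally and acts on \<open>V\<^sub>i / V\<^bsub>i-1\<^esub>\<close> as \<open>\<lambda>\<^sub>i\<close>: the weights being distinct,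
  its eigenspaces split the filtration. If \<open>d(\<V>, \<lambda>) = 0\<close>, then each level \<open>t\<close> yields such an endomorphism
  \<open>g\<^sub>t\<close> for \<open>V\<^bsub>p(t)\<^esub> \<subseteq> V\<^bsub>q(t)\<^esub>\<close> and the weights \<open>-1, 0, 1\<close>. It is scalar on the three quotients, hence preserves
  every \<open>V\<^sub>i\<close>, and \<open>\<integral> g\<^sub>t dt\<close> acts on \<open>V\<^sub>i / V\<^bsub>i-1\<^esub>\<close> as \<open>\<lambda>\<^sub>i\<close>.\<close>


section \<open>Linear algebra over the complex numbers\<close>

text \<open>The obstacle in part (3) is that the splittings found at different levels are unrelated:
  they need not refine one another and their endomorphisms need not commute, so there is no common
  eigenspace decomposition to work with. Being an infinitesimal symmetry is a linear condition,
  however, and the scalars on the quotients of a fixed flag add up along with the endomorphisms.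
  Hence the endomorphisms are added first, and only the sum is split. On eigenvectors with
  eigenvalues \<open>c\<close> and \<open>d\<close> the symmetry condition reads
  \<open>(c + d) b(u, v) = 0\<close>, which is why exactly the summands with
  \<open>\<lambda>\<^sub>i + \<lambda>\<^sub>j = 0\<close> survive.

  A second obstacle is that two-step flags may repeat members, whereas \<open>filtration\<close> is
  strict. Repetitions are removed before the definitions are applied; the endomorphism does not see
  them and carries the splitting back.

  Membership of \<beta> and \<gamma> in sums of tensor products is checked fibre by fibre.
  Holomorphy of the eigenprojections costs nothing extra, as they are polynomials in one holomorphic
  endomorphism.\<close>

lemma CC_simps [simp]:
  "carrier CC = UNIV" "mult CC = (*)" "one CC = 1" "zero CC = 0" "add CC = (+)"
  by (simp_all add: CC_def)

lemma cring_CC: "cring CC"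
  by (intro cringI abelian_groupI comm_monoidI; simp add: algebra_simps)
     (metis add.right_inverse)

locale cmod =
  fixes M :: "(complex, 'v) module" (structure)
  assumes module: "module CC M"

sublocale cmod \<subseteq> module CC M
  by (rule module)

text \<open>Additive inverses are supplied by \<open>(-1) \<odot> u\<close>, through distributivity
  and the premise on \<open>0 \<odot> u\<close>.\<close>

lemma cmodI:
  fixes M :: "(complex, 'v) module" (structure)
  assumes "\<And>u v. u \<in> carrier M \<Longrightarrow> v \<in> carrier M \<Longrightarrow> u \<oplus> v \<in> carrier M"
    and "\<zero> \<in> carrier M"
    and "\<And>u v w. u \<in> carrier M \<Longrightarrow> v \<in> carrier M \<Longrightarrow> w \<in> carrier M \<Longrightarrow> (u \<oplus> v) \<oplus> w = u \<oplus> (v \<oplus> w)"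
    and "\<And>u v. u \<in> carrier M \<Longrightarrow> v \<in> carrier M \<Longrightarrow> u \<oplus> v = v \<oplus> u"
    and "\<And>u. u \<in> carrier M \<Longrightarrow> \<zero> \<oplus> u = u"
    and "\<And>c u. u \<in> carrier M \<Longrightarrow> c \<odot> u \<in> carrier M"
    and l: "\<And>a b u. u \<in> carrier M \<Longrightarrow> (a + b) \<odot> u = a \<odot> u \<oplus> b \<odot> u"
    and "\<And>a u v. u \<in> carrier M \<Longrightarrow> v \<in> carrier M \<Longrightarrow> a \<odot> (u \<oplus> v) = a \<odot> u \<oplus> a \<odot> v"
    and "\<And>a b u. u \<in> carrier M \<Longrightarrow> (a * b) \<odot> u = a \<odot> (b \<odot> u)"
    and "\<And>u. u \<in> carrier M \<Longrightarrow> 1 \<odot> u = u"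
    and "\<And>u. u \<in> carrier M \<Longrightarrow> 0 \<odot> u = \<zero>"
  shows "cmod M"
proof (unfold cmod_def, rule moduleI)
  have "\<exists>v\<in>carrier M. v \<oplus> u = \<zero>" if "u \<in> carrier M" for u
    using l[of u "-1" 1] assms that by (intro bexI[of _ "(-1) \<odot> u"]) auto
  then show "abelian_group M"
    using assms by (intro abelian_groupI) auto
qed (use assms cring_CC in auto)

context cmod
begin

lemma smult_add_l: "u \<in> carrier M \<Longrightarrow> (a + b) \<odot> u = a \<odot> u \<oplus> b \<odot> u"
  using smult_l_distr[of a b u] by simp

lemma smult_mult: "u \<in> carrier M \<Longrightarrow> a \<odot> (b \<odot> u) = (a * b) \<odot> u"
  using smult_assoc1[of a b u] by simp

lemma smult_closed' [simp]: "u \<in> carrier M \<Longrightarrow> c \<odot> u \<in> carrier M"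
  by simp

lemma smult_1' [simp]: "u \<in> carrier M \<Longrightarrow> 1 \<odot> u = u"
  using smult_one[of u] by simp

lemma smult_0' [simp]: "u \<in> carrier M \<Longrightarrow> 0 \<odot> u = \<zero>"
  using smult_l_null[of u] by simp

lemma smult_zero' [simp]: "c \<odot> \<zero> = \<zero>"
  using smult_r_null[of c] by simp

lemma smult_add_r: "u \<in> carrier M \<Longrightarrow> v \<in> carrier M \<Longrightarrow> a \<odot> (u \<oplus> v) = a \<odot> u \<oplus> a \<odot> v"
  using smult_r_distr[of a u v] by simp

lemma add_neg [simp]: "u \<in> carrier M \<Longrightarrow> u \<oplus> (-1) \<odot> u = \<zero>"
  using smult_add_l[of u 1 "-1"] by simp

lemma neg_add [simp]: "u \<in> carrier M \<Longrightarrow> (-1) \<odot> u \<oplus> u = \<zero>"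
  using smult_add_l[of u "-1" 1] by simp

lemma a_inv_smult: "u \<in> carrier M \<Longrightarrow> \<ominus> u = (-1) \<odot> u"
  by (metis add.inv_equality neg_add smult_closed')

lemma smult_eq_zero: "u \<in> carrier M \<Longrightarrow> c \<noteq> 0 \<Longrightarrow> c \<odot> u = \<zero> \<Longrightarrow> u = \<zero>"
  by (metis smult_mult smult_1' smult_zero' left_inverse)

lemma submodule_iff:
  "submodule N CC M \<longleftrightarrow> N \<subseteq> carrier M \<and> \<zero> \<in> N \<and> (\<forall>u\<in>N. \<forall>v\<in>N. u \<oplus> v \<in> N) \<and> (\<forall>c. \<forall>u\<in>N. c \<odot> u \<in> N)"
proof
  assume N: "submodule N CC M"
  then have "\<zero> \<in> N"
    using subgroup.one_closed[OF submodule.axioms(1)[OF N]] by simp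
  then show "N \<subseteq> carrier M \<and> \<zero> \<in> N \<and> (\<forall>u\<in>N. \<forall>v\<in>N. u \<oplus> v \<in> N) \<and> (\<forall>c. \<forall>u\<in>N. c \<odot> u \<in> N)"
    using submoduleE[OF N] by auto
next
  assume "N \<subseteq> carrier M \<and> \<zero> \<in> N \<and> (\<forall>u\<in>N. \<forall>v\<in>N. u \<oplus> v \<in> N) \<and> (\<forall>c. \<forall>u\<in>N. c \<odot> u \<in> N)"
  then show "submodule N CC M"
    by (intro submoduleI) (auto simp: a_inv_smult subset_iff)
qed

lemma submodule_cmod: "submodule N CC M \<Longrightarrow> cmod (M\<lparr>carrier := N\<rparr>)"
  using submodule.submodule_is_module[of N CC M] module by (simp add: cmod_def)

lemma submodule_mono_restrict:
  "submodule N CC M \<Longrightarrow> submodule N' CC M \<Longrightarrow> N \<subseteq> N' \<Longrightarrow> submodule N CC (M\<lparr>carrier := N'\<rparr>)"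
  using cmod.submodule_iff[OF submodule_cmod[of N'], of N] submodule_iff[of N] by simp

lemma cspan_submodule:
  assumes "S \<subseteq> carrier M" shows "submodule (cspan M S) CC M"
proof -
  have "submodule (carrier M) CC M" by (rule carrier_is_submodule)
  then have "cspan M S \<subseteq> carrier M" using assms by (auto simp: cspan_def)
  then show ?thesis
    unfolding submodule_iff[of "cspan M S"] by (auto simp: cspan_def submodule_iff)
qed

lemma cspan_least: "submodule N CC M \<Longrightarrow> S \<subseteq> N \<Longrightarrow> cspan M S \<subseteq> N"
  by (auto simp: cspan_def)

end

lemma cspan_base: "v \<in> S \<Longrightarrow> v \<in> cspan M S"
  by (auto simp: cspan_def)

lemma cspan_mono: "S \<subseteq> T \<Longrightarrow> cspan M S \<subseteq> cspan M T"
  by (auto simp: cspan_def)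

lemma cspan_subset_cspan: "S \<subseteq> cspan M T \<Longrightarrow> cspan M S \<subseteq> cspan M T"
  unfolding cspan_def by blast

lemma cspan_zero: "\<zero>\<^bsub>M\<^esub> \<in> cspan M S"
  by (auto simp: cspan_def dest!: submodule.axioms(1) subgroup.one_closed)

lemma (in cmod) finsum_mem_submodule:
  assumes "submodule N CC M" "\<And>a. a \<in> A \<Longrightarrow> f a \<in> N"
  shows "(\<Oplus>a\<in>A. f a) \<in> N"
  using assms(2)
proof (induct A rule: infinite_finite_induct)
  case (infinite A)
  then show ?case using assms(1) by (simp add: submodule_iff)
next
  case empty
  then show ?case using assms(1) by (simp add: submodule_iff)
next
  case (insert x F)
  then have "f \<in> F \<rightarrow> carrier M" "f x \<in> carrier M"
    using assms(1) by (auto simp: submodule_iff)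
  then show ?case using insert assms(1) by (simp add: submodule_iff)
qed


subsection \<open>Linear maps\<close>

text \<open>Linearity without the extensionality built into \<open>lin_maps\<close>, so that
  compositions, sums and evaluations written as plain lambda terms qualify.\<close>

definition lin_on :: "(complex, 'v) module \<Rightarrow> (complex, 'w) module \<Rightarrow> ('v \<Rightarrow> 'w) \<Rightarrow> bool" where
  "lin_on M N f \<longleftrightarrow> (\<forall>u\<in>carrier M. f u \<in> carrier N) \<and>
     (\<forall>u\<in>carrier M. \<forall>v\<in>carrier M. f (u \<oplus>\<^bsub>M\<^esub> v) = f u \<oplus>\<^bsub>N\<^esub> f v) \<and>
     (\<forall>c. \<forall>u\<in>carrier M. f (c \<odot>\<^bsub>M\<^esub> u) = c \<odot>\<^bsub>N\<^esub> f u)"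

lemma lin_maps_iff: "f \<in> lin_maps M N \<longleftrightarrow> f \<in> extensional (carrier M) \<and> lin_on M N f"
  by (auto simp: lin_maps_def lin_on_def PiE_def)

lemma lin_on_restrict: "cmod M \<Longrightarrow> lin_on M N f \<Longrightarrow> restrict f (carrier M) \<in> lin_maps M N"
proof -
  assume "cmod M" "lin_on M N f"
  then interpret cmod M by simp
  show ?thesis using \<open>lin_on M N f\<close> by (auto simp: lin_maps_iff lin_on_def)
qed

lemma lin_on_zero: 
  assumes "cmod M" "cmod N" "lin_on M N f" shows "f \<zero>\<^bsub>M\<^esub> = \<zero>\<^bsub>N\<^esub>"
proof -
  interpret M: cmod M by fact
  interpret N: cmod N by fact
  have "f (0 \<odot>\<^bsub>M\<^esub> \<zero>\<^bsub>M\<^esub>) = 0 \<odot>\<^bsub>N\<^esub> f \<zero>\<^bsub>M\<^esub>"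
    using assms(3) M.zero_closed unfolding lin_on_def by blast
  then show ?thesis using assms(3) by (simp add: lin_on_def)
qed

lemma lin_on_finsum: 
  assumes "cmod M" "cmod N" "lin_on M N f" "\<And>a. a \<in> A \<Longrightarrow> h a \<in> carrier M"
  shows "f (\<Oplus>\<^bsub>M\<^esub>a\<in>A. h a) = (\<Oplus>\<^bsub>N\<^esub>a\<in>A. f (h a))"
proof -
  interpret M: cmod M by fact
  interpret N: cmod N by fact
  show ?thesis using assms(4)
  proof (induct A rule: infinite_finite_induct)
    case (insert x F)
    then have "h \<in> F \<rightarrow> carrier M" "(\<lambda>a. f (h a)) \<in> F \<rightarrow> carrier N"
      using assms(3) by (auto simp: lin_on_def)
    then show ?case using insert assms(3) by (simp add: lin_on_def)
  qed (simp_all add: lin_on_zero[OF assms(1-3)])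
qed

lemma complex_line_simps [simp]:
  "carrier complex_line = UNIV" "zero complex_line = 0" "add complex_line = (+)" "smult complex_line = (*)"
  by (simp_all add: complex_line_def)

lemma cmod_complex_line: "cmod complex_line"
  by (rule cmodI) (auto simp: algebra_simps)

lemma finsum_complex_line: "(\<Oplus>\<^bsub>complex_line\<^esub>a\<in>A. f a) = (\<Sum>a\<in>A. f a)"
proof -
  interpret cmod complex_line by (rule cmod_complex_line)
  show ?thesis by (induct A rule: infinite_finite_induct) auto
qed

lemma dual_space_simps [simp]:
  "carrier (dual_space M) = lin_maps M complex_line"
  "zero (dual_space M) = (\<lambda>v\<in>carrier M. 0)"
  "add (dual_space M) = (\<lambda>\<xi> \<eta>. \<lambda>v\<in>carrier M. \<xi> v + \<eta> v)"
  "smult (dual_space M) = (\<lambda>c \<xi>. \<lambda>v\<in>carrier M. c * \<xi> v)"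
  by (simp_all add: dual_space_def)

lemma cmod_dual_space:
  assumes "cmod M" shows "cmod (dual_space M)"
proof -
  interpret cmod M by fact
  show ?thesis
    by (rule cmodI) (auto simp: lin_maps_iff lin_on_def algebra_simps extensional_def fun_eq_iff)
qed

lemma sym2_dual_simps [simp]:
  "carrier (sym2_dual N M) = {b \<in> carrier M \<rightarrow>\<^sub>E lin_maps M N. \<forall>u\<in>carrier M. \<forall>v\<in>carrier M. b u v = b v u}"
  "zero (sym2_dual N M) = (\<lambda>u\<in>carrier M. \<lambda>v\<in>carrier M. \<zero>\<^bsub>N\<^esub>)"
  "add (sym2_dual N M) = (\<lambda>b b'. \<lambda>u\<in>carrier M. \<lambda>v\<in>carrier M. b u v \<oplus>\<^bsub>N\<^esub> b' u v)"
  "smult (sym2_dual N M) = (\<lambda>c b. \<lambda>u\<in>carrier M. \<lambda>v\<in>carrier M. c \<odot>\<^bsub>N\<^esub> b u v)"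
  by (simp_all add: sym2_dual_def)

lemma sym2_dual_eqI:
  assumes "b \<in> carrier (sym2_dual N M)" "b' \<in> carrier (sym2_dual N M)"
    and "\<And>u v. u \<in> carrier M \<Longrightarrow> v \<in> carrier M \<Longrightarrow> b u v = b' u v"
  shows "b = b'"
proof (rule extensionalityI[of _ "carrier M"])
  fix u assume u: "u \<in> carrier M"
  show "b u = b' u"
    using assms u by (intro extensionalityI[of _ "carrier M"]) (auto simp: lin_maps_iff PiE_iff)
qed (use assms in \<open>auto simp: PiE_iff\<close>)

lemma cmod_sym2_dual:
  assumes "cmod M" "cmod N" shows "cmod (sym2_dual N M)"
proof -
  interpret M: cmod M by fact
  interpret N: cmod N by fact
  have cl: "b u v \<in> carrier N" if "b \<in> carrier (sym2_dual N M)" "u \<in> carrier M" "v \<in> carrier M" for b u v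
    using that by (auto simp: lin_maps_iff lin_on_def PiE_iff)
  have add: "b \<oplus>\<^bsub>sym2_dual N M\<^esub> b' \<in> carrier (sym2_dual N M)"
    if "b \<in> carrier (sym2_dual N M)" "b' \<in> carrier (sym2_dual N M)" for b b'
    using that by (auto simp: lin_maps_iff lin_on_def PiE_iff N.a_ac N.smult_add_r)
  have zero: "zero (sym2_dual N M) \<in> carrier (sym2_dual N M)"
    by (auto simp: lin_maps_iff lin_on_def PiE_iff)
  have smult: "c \<odot>\<^bsub>sym2_dual N M\<^esub> b \<in> carrier (sym2_dual N M)"
    if "b \<in> carrier (sym2_dual N M)" for c b
    using that by (auto simp: lin_maps_iff lin_on_def PiE_iff N.smult_add_r N.smult_mult mult.commute)
  show ?thesis
  \<comment> \<open>The case numbers are those of the premises of \<open>cmodI\<close>. The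
    equational ones are compared on values, where they become the laws of \<open>N\<close>.\<close>
  proof (rule cmodI, goal_cases)
    case 3 then show ?case by (intro sym2_dual_eqI[where N = N and M = M] add) (simp_all add: cl N.a_ac del: sym2_dual_simps(1))
  next
    case 4 then show ?case by (intro sym2_dual_eqI[where N = N and M = M] add) (simp_all add: cl N.a_ac del: sym2_dual_simps(1))
  next
    case 5 then show ?case by (intro sym2_dual_eqI[where N = N and M = M] add zero) (simp_all add: cl del: sym2_dual_simps(1))
  next
    case 7 then show ?case by (intro sym2_dual_eqI[where N = N and M = M] add smult) (simp_all add: cl N.smult_add_l del: sym2_dual_simps(1))
  next
    case 8 then show ?case by (intro sym2_dual_eqI[where N = N and M = M] add smult) (simp_all add: cl N.smult_add_r del: sym2_dual_simps(1))
  next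
    case 9 then show ?case by (intro sym2_dual_eqI[where N = N and M = M] smult) (simp_all add: cl N.smult_mult del: sym2_dual_simps(1))
  next
    case 10 then show ?case by (intro sym2_dual_eqI[where N = N and M = M] smult) (simp_all add: cl del: sym2_dual_simps(1))
  next
    case 11 then show ?case by (intro sym2_dual_eqI[where N = N and M = M] smult zero) (simp_all add: cl del: sym2_dual_simps(1))
  qed (use add zero smult in auto)
qed


subsection \<open>Quotients and direct sums\<close>

lemma a_r_coset_restrict [simp]: "W +>\<^bsub>M\<lparr>carrier := A\<rparr>\<^esub> v = W +>\<^bsub>M\<^esub> v"
  by (simp add: a_r_coset_def r_coset_def)

context cmod
begin

lemma submodule_abelian_subgroup: "submodule W CC M \<Longrightarrow> abelian_subgroup W M"
  using submodule.axioms(1) M.abelian_group_axioms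
  by (intro abelian_subgroupI3 additive_subgroup.intro) auto

lemma coset_eq_iff:
  assumes W: "submodule W CC M" and u: "u \<in> carrier M" and v: "v \<in> carrier M"
  shows "W +> u = W +> v \<longleftrightarrow> u \<oplus> (-1) \<odot> v \<in> W"
proof -
  interpret W: abelian_subgroup W M by (rule submodule_abelian_subgroup[OF W])
  have "W +> u = W +> v \<longleftrightarrow> u \<in> W +> v"
    using W.a_repr_independence' W.a_rcos_self u v by metis
  also have "\<dots> \<longleftrightarrow> u \<ominus> v \<in> W"
    using W.a_rcos_module_minus[of v u] u v
    by (metis W.a_rcos_module a_minus_def)
  finally show ?thesis using u v by (simp add: a_minus_def a_inv_smult)
qed

lemma coset_eq_self_iff:
  assumes W: "submodule W CC M" and u: "u \<in> carrier M"
  shows "W +> u = W \<longleftrightarrow> u \<in> W"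
proof -
  have "W +> \<zero> = W"
    using W by (simp add: submodule_iff)
  then show ?thesis using coset_eq_iff[OF W u, of \<zero>] u by simp
qed

lemma mem_coset_iff:
  assumes W: "submodule W CC M" and u: "u \<in> carrier M"
  shows "v \<in> W +> u \<longleftrightarrow> v \<in> carrier M \<and> W +> v = W +> u"
proof -
  interpret W: abelian_subgroup W M by (rule submodule_abelian_subgroup[OF W])
  show ?thesis
    using W.a_repr_independence' W.a_rcos_self W.a_elemrcos_carrier u by metis
qed

lemma quot_space_carrier: "carrier (quot_space M W) = {W +> u |u. u \<in> carrier M}"
  by (auto simp: quot_space_def A_RCOSETS_def')

lemma quot_space_zero [simp]: "\<zero>\<^bsub>quot_space M W\<^esub> = W"
  by (simp add: quot_space_def)

lemma quot_space_add:
  assumes "submodule W CC M" "u \<in> carrier M" "v \<in> carrier M"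
  shows "(W +> u) \<oplus>\<^bsub>quot_space M W\<^esub> (W +> v) = W +> (u \<oplus> v)"
  using abelian_subgroup.a_rcos_sum[OF submodule_abelian_subgroup[OF assms(1)]] assms
  by (simp add: quot_space_def)

lemma quot_space_smult:
  assumes W: "submodule W CC M" and u: "u \<in> carrier M"
  shows "c \<odot>\<^bsub>quot_space M W\<^esub> (W +> u) = W +> (c \<odot> u)"
proof -
  \<comment> \<open>The scalar multiple in \<open>quot_space\<close> is a union over all
    representatives; each of them contributes the same coset.\<close>
  have "W +> (c \<odot> v) = W +> (c \<odot> u)" if "v \<in> W +> u" for v
  proof -
    have v: "v \<in> carrier M" and "W +> v = W +> u"
      using that mem_coset_iff[OF W u] by auto
    then have "v \<oplus> (-1) \<odot> u \<in> W"
      using coset_eq_iff[OF W v u] by simp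
    then have "c \<odot> (v \<oplus> (-1) \<odot> u) \<in> W"
      using W by (simp add: submodule_iff)
    then show ?thesis
      using u v by (simp add: coset_eq_iff[OF W] smult_add_r smult_mult mult.commute)
  qed
  moreover have "u \<in> W +> u"
    using mem_coset_iff[OF W u] u by simp
  ultimately have "(\<Union>v\<in>W +> u. W +> (c \<odot> v)) = W +> (c \<odot> u)"
    by blast
  then show ?thesis
    by (simp add: quot_space_def)
qed

lemma cmod_quot_space:
  assumes W: "submodule W CC M" shows "cmod (quot_space M W)"
proof -
  note simps = quot_space_add[OF W] quot_space_smult[OF W] quot_space_carrier
  \<comment> \<open>The zero of the quotient is \<open>W\<close> itself and has to be written as a
    coset before the rules for cosets apply to it.\<close>
  have Z: "W = W +> \<zero>" using coset_eq_self_iff[OF W, of \<zero>] W by (simp add: submodule_iff)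
  show ?thesis
  proof (rule cmodI, goal_cases)
    case (1 u v)
    then obtain a b where "u = W +> a" "v = W +> b" "a \<in> carrier M" "b \<in> carrier M"
      by (auto simp: simps)
    then show ?case by (auto simp: simps intro!: exI[of _ "a \<oplus> b"])
  next
    case 2 then show ?case using Z by (auto simp: simps)
  next
    case 3 then show ?case by (auto simp: simps a_ac)
  next
    case 4 then show ?case by (auto simp: simps a_ac)
  next
    case (5 u)
    then obtain v where v: "u = W +> v" "v \<in> carrier M" by (auto simp: simps)
    have "(W +> \<zero>) \<oplus>\<^bsub>quot_space M W\<^esub> (W +> v) = W +> v"
      using v by (simp add: quot_space_add[OF W] del: a_coset_add_zero)
    then show ?case using v by (simp flip: Z)
  next
    case 6 then show ?case by (auto simp: simps)
  next
    case 7 then show ?case by (auto simp: simps smult_add_l)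
  next
    case 8 then show ?case by (auto simp: simps smult_add_r)
  next
    case 9 then show ?case by (auto simp: simps smult_mult)
  next
    case 10 then show ?case by (auto simp: simps)
  next
    case (11 u)
    then obtain v where v: "u = W +> v" "v \<in> carrier M" by (auto simp: simps)
    then show ?case by (simp add: quot_space_smult[OF W] flip: Z)
  qed
qed

text \<open>A functional that kills \<open>W\<close> is constant on cosets, so its value at any
  representative, here one picked by \<open>SOME\<close>, depends on the coset alone.\<close>

lemma dual_quot_lift:
  assumes W: "submodule W CC M" and f: "lin_on M complex_line f" and f0: "\<And>w. w \<in> W \<Longrightarrow> f w = 0"
  obtains \<xi> where "\<xi> \<in> carrier (dual_space (quot_space M W))" "\<And>u. u \<in> carrier M \<Longrightarrow> \<xi> (W +> u) = f u"
proof -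
  define \<xi> where "\<xi> = (\<lambda>C\<in>carrier (quot_space M W). f (SOME u. u \<in> C))"
  have \<xi>: "\<xi> (W +> u) = f u" if u: "u \<in> carrier M" for u
  proof -
    have "u \<in> W +> u" using mem_coset_iff[OF W u] u by simp
    then have "(SOME v. v \<in> W +> u) \<in> W +> u" by (rule someI)
    then obtain v where v: "v = (SOME v. v \<in> W +> u)" "v \<in> carrier M" "W +> v = W +> u"
      using mem_coset_iff[OF W u] by auto
    then have "f (v \<oplus> (-1) \<odot> u) = 0"
      using f0 coset_eq_iff[OF W v(2) u] by simp
    then have "f v = f u"
      using f u v(2) by (simp add: lin_on_def)
    then show ?thesis
      using u v(1) by (auto simp: \<xi>_def quot_space_carrier)
  qed
  have "lin_on (quot_space M W) complex_line \<xi>"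
    using f by (auto simp: lin_on_def quot_space_carrier quot_space_add[OF W] quot_space_smult[OF W] \<xi>)
  then have "\<xi> \<in> carrier (dual_space (quot_space M W))"
    by (auto simp: lin_maps_iff \<xi>_def)
  then show thesis using \<xi> that by blast
qed

end

lemma dsum_space_simps [simp]:
  "carrier (dsum_space I M) = (\<Pi>\<^sub>E i\<in>I. carrier (M i))"
  "zero (dsum_space I M) = (\<lambda>i\<in>I. \<zero>\<^bsub>M i\<^esub>)"
  "add (dsum_space I M) = (\<lambda>f g. \<lambda>i\<in>I. f i \<oplus>\<^bsub>M i\<^esub> g i)"
  "smult (dsum_space I M) = (\<lambda>c f. \<lambda>i\<in>I. c \<odot>\<^bsub>M i\<^esub> f i)"
  by (simp_all add: dsum_space_def)

lemma dsum_space_eqI: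
  assumes "f \<in> carrier (dsum_space I M)" "g \<in> carrier (dsum_space I M)" "\<And>i. i \<in> I \<Longrightarrow> f i = g i"
  shows "f = g"
  using assms by (auto intro: PiE_ext)

lemma cmod_dsum_space:
  assumes M: "\<And>i. i \<in> I \<Longrightarrow> cmod (M i)" shows "cmod (dsum_space I M)"
proof -
  have *: "module CC (M i)" if "i \<in> I" for i using M[OF that] by (rule cmod.module)
  note m = module.axioms(2)[OF *]
  note ag = abelian_group.axioms(1)[OF m]
  note cl = abelian_monoid.a_closed[OF ag] abelian_monoid.zero_closed[OF ag] cmod.smult_closed'[OF M]
    abelian_monoid.a_assoc[OF ag] abelian_monoid.l_zero[OF ag]
    cmod.smult_add_l[OF M] cmod.smult_add_r[OF M] cmod.smult_mult[OF M] cmod.smult_1'[OF M] cmod.smult_0'[OF M]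
  show ?thesis
  proof (rule cmodI, goal_cases)
    case (4 u v)
    then show ?case by (auto simp: fun_eq_iff PiE_iff intro!: abelian_monoid.a_comm[OF ag])
  qed (auto simp: cl PiE_iff restrict_def extensional_def fun_eq_iff)
qed


subsection \<open>Symmetrized tensor products\<close>

lemma lin_maps_dual_iff: "f \<in> lin_maps M complex_line \<longleftrightarrow> f \<in> extensional (carrier M) \<and>
    (\<forall>u\<in>carrier M. \<forall>v\<in>carrier M. f (u \<oplus>\<^bsub>M\<^esub> v) = f u + f v) \<and>
    (\<forall>c. \<forall>u\<in>carrier M. f (c \<odot>\<^bsub>M\<^esub> u) = c * f u)"
  by (auto simp: lin_maps_iff lin_on_def)

lemma sym_prod_carrier:
  assumes "cmod M" "cmod N" "l \<in> carrier N" "\<xi> \<in> carrier (dual_space M)" "\<eta> \<in> carrier (dual_space M)"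
  shows "sym_prod N M l \<xi> \<eta> \<in> carrier (sym2_dual N M)"
proof -
  interpret M: cmod M by fact
  interpret N: cmod N by fact
  show ?thesis
    using assms(3-5)
    by (auto simp: sym_prod_def lin_maps_iff lin_on_def PiE_iff N.smult_mult algebra_simps
          add_divide_distrib simp flip: N.smult_add_l)
qed

lemma sym_prod_commute: "sym_prod N M l \<xi> \<eta> = sym_prod N M l \<eta> \<xi>"
  unfolding sym_prod_def by (simp add: add.commute mult.commute cong: restrict_cong)

lemma tensor_S_commute: "tensor_S N M S T = tensor_S N M T S"
proof -
  have "{sym_prod N M l \<xi> \<eta> |l \<xi> \<eta>. l \<in> carrier N \<and> \<xi> \<in> S \<and> \<eta> \<in> T}
      = {sym_prod N M l \<xi> \<eta> |l \<xi> \<eta>. l \<in> carrier N \<and> \<xi> \<in> T \<and> \<eta> \<in> S}"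
    by (subst sym_prod_commute) blast
  then show ?thesis by (simp add: tensor_S_def)
qed

lemma tensor_S_mono: "S \<subseteq> S' \<Longrightarrow> T \<subseteq> T' \<Longrightarrow> tensor_S N M S T \<subseteq> tensor_S N M S' T'"
  unfolding tensor_S_def by (rule cspan_mono) blast

lemma sym_prod_mem_tensor_S:
  "l \<in> carrier N \<Longrightarrow> \<xi> \<in> S \<Longrightarrow> \<eta> \<in> T \<Longrightarrow> sym_prod N M l \<xi> \<eta> \<in> tensor_S N M S T"
  unfolding tensor_S_def by (rule cspan_base) blast

lemma sym_prod_gens_carrier:
  assumes "cmod M" "cmod N" "S \<subseteq> carrier (dual_space M)" "T \<subseteq> carrier (dual_space M)"
  shows "{sym_prod N M l \<xi> \<eta> |l \<xi> \<eta>. l \<in> carrier N \<and> \<xi> \<in> S \<and> \<eta> \<in> T} \<subseteq> carrier (sym2_dual N M)"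
  using sym_prod_carrier[OF assms(1,2)] assms(3,4) by blast

lemma tensor_S_carrier:
  assumes "cmod M" "cmod N" "S \<subseteq> carrier (dual_space M)" "T \<subseteq> carrier (dual_space M)"
  shows "tensor_S N M S T \<subseteq> carrier (sym2_dual N M)"
  using cmod.cspan_submodule[OF cmod_sym2_dual[OF assms(1,2)] sym_prod_gens_carrier[OF assms]]
    cmod.submodule_iff[OF cmod_sym2_dual[OF assms(1,2)]]
  by (simp add: tensor_S_def)

text \<open>Products with the zero vector vanish and so lie in every span. This serves the
  degenerate members of a flag: the zero bundle, and the annihilator of the whole bundle.\<close>

lemma tensor_S_zero_subset:
  assumes "cmod M" "cmod N" "S \<subseteq> carrier (dual_space M)" "T \<subseteq> {\<zero>\<^bsub>dual_space M\<^esub>}"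
  shows "tensor_S N M S T \<subseteq> cspan (sym2_dual N M) G"
proof -
  interpret N: cmod N by fact
  have "{sym_prod N M l \<xi> \<eta> |l \<xi> \<eta>. l \<in> carrier N \<and> \<xi> \<in> S \<and> \<eta> \<in> T} \<subseteq> {\<zero>\<^bsub>sym2_dual N M\<^esub>}"
    using assms(4) by (auto simp: sym_prod_def fun_eq_iff restrict_def)
  moreover have "{\<zero>\<^bsub>sym2_dual N M\<^esub>} \<subseteq> cspan (sym2_dual N M) G"
    using cspan_zero[of "sym2_dual N M" G] by (simp only: insert_subset empty_subsetI simp_thms)
  ultimately show ?thesis
    unfolding tensor_S_def by (intro cspan_subset_cspan) (rule order_trans)
qed

text \<open>Inserting the resolution of the identity into both arguments writes \<open>b\<close> as
  the sum of the symmetrized products of \<open>f s\<close> and \<open>f t\<close> with coefficients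
  \<open>b (y s) (y t)\<close>, so only pairs with nonzero coefficient have to be looked at. The
  \<open>y s\<close> may be linearly dependent; in the application they are the projections of one
  basis to all eigenspaces.\<close>

lemma sym2_dual_resolution:
  assumes "cmod M" "cmod N" and b: "b \<in> carrier (sym2_dual N M)"
    and f: "\<And>s. s \<in> S \<Longrightarrow> f s \<in> carrier (dual_space M)" and y: "\<And>s. s \<in> S \<Longrightarrow> y s \<in> carrier M"
    and res: "\<And>v. v \<in> carrier M \<Longrightarrow> (\<Oplus>\<^bsub>M\<^esub>s\<in>S. f s v \<odot>\<^bsub>M\<^esub> y s) = v"
    and fin: "finite S" and G: "G \<subseteq> carrier (sym2_dual N M)"
    and mem: "\<And>s t. s \<in> S \<Longrightarrow> t \<in> S \<Longrightarrow> b (y s) (y t) \<noteq> \<zero>\<^bsub>N\<^esub> \<Longrightarrow>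
      sym_prod N M (b (y s) (y t)) (f s) (f t) \<in> cspan (sym2_dual N M) G"
  shows "b \<in> cspan (sym2_dual N M) G"
proof -
  interpret M: cmod M by fact
  interpret N: cmod N by fact
  interpret B: cmod "sym2_dual N M" by (rule cmod_sym2_dual) fact+
  have bcl: "b u v \<in> carrier N" and bsym: "b u v = b v u" and blin: "lin_on M N (b u)"
    if "u \<in> carrier M" "v \<in> carrier M" for u v
    using that b by (auto simp: lin_maps_iff lin_on_def PiE_iff)
  define h where "h = (\<lambda>s t. sym_prod N M (b (y s) (y t)) (f s) (f t))"
  have hcl: "h s t \<in> carrier (sym2_dual N M)" if "s \<in> S" "t \<in> S" for s t
    unfolding h_def using that by (intro sym_prod_carrier assms f bcl y)
  have hmem: "h s t \<in> cspan (sym2_dual N M) G" if "s \<in> S" "t \<in> S" for s t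
  proof (cases "b (y s) (y t) = \<zero>\<^bsub>N\<^esub>")
    case True
    then have "h s t = \<zero>\<^bsub>sym2_dual N M\<^esub>" by (simp add: h_def sym_prod_def)
    then show ?thesis using cspan_zero by metis
  qed (use mem that h_def in auto)
  have ev: "lin_on (sym2_dual N M) N (\<lambda>b. b u v)" if "u \<in> carrier M" "v \<in> carrier M" for u v
    using that by (auto simp: lin_on_def lin_maps_iff PiE_iff)
  \<comment> \<open>Both arguments are expanded by the one-variable rule \<open>one\<close>;
    symmetry brings each of them in turn to the second place.\<close>
  have expand: "b u v = (\<Oplus>\<^bsub>N\<^esub>s\<in>S. \<Oplus>\<^bsub>N\<^esub>t\<in>S. (f s u * f t v) \<odot>\<^bsub>N\<^esub> b (y s) (y t))"
    if u: "u \<in> carrier M" and v: "v \<in> carrier M" for u v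
  proof -
    have one: "b w v = (\<Oplus>\<^bsub>N\<^esub>t\<in>S. f t v \<odot>\<^bsub>N\<^esub> b w (y t))"
      if w: "w \<in> carrier M" and v: "v \<in> carrier M" for w v
    proof -
      have "b w v = b w (\<Oplus>\<^bsub>M\<^esub>t\<in>S. f t v \<odot>\<^bsub>M\<^esub> y t)" using res v by simp
      also have "\<dots> = (\<Oplus>\<^bsub>N\<^esub>t\<in>S. b w (f t v \<odot>\<^bsub>M\<^esub> y t))"
        by (rule lin_on_finsum[OF assms(1,2) blin[OF w w]]) (simp add: y)
      also have "\<dots> = (\<Oplus>\<^bsub>N\<^esub>t\<in>S. f t v \<odot>\<^bsub>N\<^esub> b w (y t))"
        by (rule N.finsum_cong') (use blin[OF w w] y w in \<open>auto simp: lin_on_def\<close>)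
      finally show ?thesis .
    qed
    have "b u v = b v u" using bsym u v by simp
    also have "\<dots> = (\<Oplus>\<^bsub>N\<^esub>s\<in>S. f s u \<odot>\<^bsub>N\<^esub> b v (y s))"
      by (rule one[OF v u])
    also have "\<dots> = (\<Oplus>\<^bsub>N\<^esub>s\<in>S. \<Oplus>\<^bsub>N\<^esub>t\<in>S. (f s u * f t v) \<odot>\<^bsub>N\<^esub> b (y s) (y t))"
    proof (rule N.finsum_cong')
      fix s assume s: "s \<in> S"
      have "f s u \<odot>\<^bsub>N\<^esub> b v (y s) = f s u \<odot>\<^bsub>N\<^esub> (\<Oplus>\<^bsub>N\<^esub>t\<in>S. f t v \<odot>\<^bsub>N\<^esub> b (y s) (y t))"
        using bsym[OF v y[OF s]] one[OF y[OF s] v] by simp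
      also have "\<dots> = (\<Oplus>\<^bsub>N\<^esub>t\<in>S. f s u \<odot>\<^bsub>N\<^esub> (f t v \<odot>\<^bsub>N\<^esub> b (y s) (y t)))"
        by (rule N.finsum_smult_ldistr) (use fin s in \<open>auto intro!: bcl y\<close>)
      also have "\<dots> = (\<Oplus>\<^bsub>N\<^esub>t\<in>S. (f s u * f t v) \<odot>\<^bsub>N\<^esub> b (y s) (y t))"
        by (rule N.finsum_cong') (use s in \<open>auto simp: N.smult_mult bcl y\<close>)
      finally show "f s u \<odot>\<^bsub>N\<^esub> b v (y s) = (\<Oplus>\<^bsub>N\<^esub>t\<in>S. (f s u * f t v) \<odot>\<^bsub>N\<^esub> b (y s) (y t))" .
    qed (use y bcl in \<open>auto intro!: N.finsum_closed\<close>)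
    finally show ?thesis .
  qed
  have "b = (\<Oplus>\<^bsub>sym2_dual N M\<^esub>s\<in>S. \<Oplus>\<^bsub>sym2_dual N M\<^esub>t\<in>S. h s t)"
  proof (rule sym2_dual_eqI[where N = N and M = M])
    fix u v assume u: "u \<in> carrier M" and v: "v \<in> carrier M"
    have "(\<Oplus>\<^bsub>sym2_dual N M\<^esub>s\<in>S. \<Oplus>\<^bsub>sym2_dual N M\<^esub>t\<in>S. h s t) u v
        = (\<Oplus>\<^bsub>N\<^esub>s\<in>S. (\<Oplus>\<^bsub>sym2_dual N M\<^esub>t\<in>S. h s t) u v)"
      by (rule lin_on_finsum[OF B.cmod_axioms assms(2) ev[OF u v]]) (auto intro!: B.finsum_closed hcl simp del: sym2_dual_simps)
    also have "\<dots> = (\<Oplus>\<^bsub>N\<^esub>s\<in>S. \<Oplus>\<^bsub>N\<^esub>t\<in>S. h s t u v)"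
    proof (rule N.finsum_cong')
      show "(\<lambda>s. \<Oplus>\<^bsub>N\<^esub>t\<in>S. h s t u v) \<in> S \<rightarrow> carrier N"
        using hcl ev[OF u v] by (auto intro!: N.finsum_closed simp: lin_on_def simp del: sym2_dual_simps)
    qed (auto intro!: lin_on_finsum[OF B.cmod_axioms assms(2) ev[OF u v]] hcl simp del: sym2_dual_simps)
    \<comment> \<open>The two terms in \<open>sym_prod\<close>, each with its factor 1/2, turn the
      double sum into half the expansion of \<open>b u v\<close> plus half that of
      \<open>b v u\<close>.\<close>
    also have "\<dots> = (\<Oplus>\<^bsub>N\<^esub>s\<in>S. (\<Oplus>\<^bsub>N\<^esub>t\<in>S. (1/2 * (f s u * f t v)) \<odot>\<^bsub>N\<^esub> b (y s) (y t))
        \<oplus>\<^bsub>N\<^esub> (\<Oplus>\<^bsub>N\<^esub>t\<in>S. (1/2 * (f s v * f t u)) \<odot>\<^bsub>N\<^esub> b (y s) (y t)))"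
    proof (rule N.finsum_cong')
      fix s assume s: "s \<in> S"
      have "(\<Oplus>\<^bsub>N\<^esub>t\<in>S. h s t u v) = (\<Oplus>\<^bsub>N\<^esub>t\<in>S. (1/2 * (f s u * f t v)) \<odot>\<^bsub>N\<^esub> b (y s) (y t)
          \<oplus>\<^bsub>N\<^esub> (1/2 * (f s v * f t u)) \<odot>\<^bsub>N\<^esub> b (y s) (y t))"
        by (rule N.finsum_cong')
          (use u v s in \<open>auto simp: h_def sym_prod_def add_divide_distrib y bcl simp flip: N.smult_add_l\<close>)
      also have "\<dots> = (\<Oplus>\<^bsub>N\<^esub>t\<in>S. (1/2 * (f s u * f t v)) \<odot>\<^bsub>N\<^esub> b (y s) (y t))
          \<oplus>\<^bsub>N\<^esub> (\<Oplus>\<^bsub>N\<^esub>t\<in>S. (1/2 * (f s v * f t u)) \<odot>\<^bsub>N\<^esub> b (y s) (y t))"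
        by (rule N.finsum_addf) (use s in \<open>auto intro!: bcl y\<close>)
      finally show "(\<Oplus>\<^bsub>N\<^esub>t\<in>S. h s t u v) = \<dots>" .
    qed (auto intro!: N.finsum_closed N.a_closed bcl y)
    also have "\<dots> = (\<Oplus>\<^bsub>N\<^esub>s\<in>S. \<Oplus>\<^bsub>N\<^esub>t\<in>S. (1/2 * (f s u * f t v)) \<odot>\<^bsub>N\<^esub> b (y s) (y t))
        \<oplus>\<^bsub>N\<^esub> (\<Oplus>\<^bsub>N\<^esub>s\<in>S. \<Oplus>\<^bsub>N\<^esub>t\<in>S. (1/2 * (f s v * f t u)) \<odot>\<^bsub>N\<^esub> b (y s) (y t))"
      by (rule N.finsum_addf) (auto intro!: N.finsum_closed bcl y)
    also have "\<dots> = (1/2) \<odot>\<^bsub>N\<^esub> b u v \<oplus>\<^bsub>N\<^esub> (1/2) \<odot>\<^bsub>N\<^esub> b v u"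
    proof -
      have half: "(\<Oplus>\<^bsub>N\<^esub>s\<in>S. \<Oplus>\<^bsub>N\<^esub>t\<in>S. (1/2 * (f s u * f t v)) \<odot>\<^bsub>N\<^esub> b (y s) (y t)) = (1/2) \<odot>\<^bsub>N\<^esub> b u v"
        if u: "u \<in> carrier M" and v: "v \<in> carrier M" for u v
      proof -
        have "(1/2) \<odot>\<^bsub>N\<^esub> b u v = (\<Oplus>\<^bsub>N\<^esub>s\<in>S. (1/2) \<odot>\<^bsub>N\<^esub> (\<Oplus>\<^bsub>N\<^esub>t\<in>S. (f s u * f t v) \<odot>\<^bsub>N\<^esub> b (y s) (y t)))"
          unfolding expand[OF u v]
          by (rule N.finsum_smult_ldistr) (use fin in \<open>auto intro!: N.finsum_closed bcl y\<close>)
        also have "\<dots> = (\<Oplus>\<^bsub>N\<^esub>s\<in>S. \<Oplus>\<^bsub>N\<^esub>t\<in>S. (1/2 * (f s u * f t v)) \<odot>\<^bsub>N\<^esub> b (y s) (y t))"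
        proof (rule N.finsum_cong')
          fix s assume s: "s \<in> S"
          have "(1/2) \<odot>\<^bsub>N\<^esub> (\<Oplus>\<^bsub>N\<^esub>t\<in>S. (f s u * f t v) \<odot>\<^bsub>N\<^esub> b (y s) (y t))
              = (\<Oplus>\<^bsub>N\<^esub>t\<in>S. (1/2) \<odot>\<^bsub>N\<^esub> ((f s u * f t v) \<odot>\<^bsub>N\<^esub> b (y s) (y t)))"
            by (rule N.finsum_smult_ldistr) (use fin s in \<open>auto intro!: bcl y\<close>)
          also have "\<dots> = (\<Oplus>\<^bsub>N\<^esub>t\<in>S. (1/2 * (f s u * f t v)) \<odot>\<^bsub>N\<^esub> b (y s) (y t))"
            by (rule N.finsum_cong') (use s in \<open>auto simp: N.smult_mult bcl y\<close>)
          finally show "(1/2) \<odot>\<^bsub>N\<^esub> (\<Oplus>\<^bsub>N\<^esub>t\<in>S. (f s u * f t v) \<odot>\<^bsub>N\<^esub> b (y s) (y t)) = \<dots>" .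
        qed (auto intro!: N.finsum_closed bcl y)
        finally show ?thesis by simp
      qed
      show ?thesis using half[OF u v] half[OF v u] by simp
    qed
    also have "\<dots> = b u v"
      using bsym[OF u v] bcl[OF u v] N.smult_add_l[of "b u v" "1/2" "1/2"] by simp
    finally show "b u v = (\<Oplus>\<^bsub>sym2_dual N M\<^esub>s\<in>S. \<Oplus>\<^bsub>sym2_dual N M\<^esub>t\<in>S. h s t) u v" by simp
  qed (use b in \<open>auto intro!: B.finsum_closed hcl simp del: sym2_dual_simps\<close>)
  also have "\<dots> \<in> cspan (sym2_dual N M) G"
    by (intro B.finsum_mem_submodule B.cspan_submodule G hmem)
  finally show ?thesis .
qed

lemma eval_dual: "v \<in> carrier M \<Longrightarrow> cmod M \<Longrightarrow> (\<lambda>\<xi>\<in>carrier (dual_space M). \<xi> v) \<in> carrier (dual_space (dual_space M))"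
proof -
  assume v: "v \<in> carrier M" and "cmod M"
  interpret D: cmod "dual_space M" by (rule cmod_dual_space) fact
  have "lin_on (dual_space M) complex_line (\<lambda>\<xi>. \<xi> v)"
    using v by (auto simp: lin_on_def)
  from lin_on_restrict[OF D.cmod_axioms this] show ?thesis by (simp only: dual_space_simps)
qed

lemma evals_carrier: "cmod M \<Longrightarrow> W \<subseteq> carrier M \<Longrightarrow> evals M W \<subseteq> carrier (dual_space (dual_space M))"
  unfolding evals_def by (intro image_subsetI eval_dual) (auto simp del: dual_space_simps)

lemma perp_carrier: "perp M W \<subseteq> carrier (dual_space M)"
  by (auto simp: perp_def)

text \<open>The transpose of a resolution of the identity: on the dual space the \<open>f s\<close>
  become the vectors, and evaluation at \<open>y s\<close> the functionals. It makes \<beta>, a form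
  on the dual, accessible to \<open>sym2_dual_resolution\<close>.\<close>

lemma dual_resolution:
  assumes "cmod M" and f: "\<And>s. s \<in> S \<Longrightarrow> f s \<in> carrier (dual_space M)" and y: "\<And>s. s \<in> S \<Longrightarrow> y s \<in> carrier M"
    and res: "\<And>v. v \<in> carrier M \<Longrightarrow> (\<Oplus>\<^bsub>M\<^esub>s\<in>S. f s v \<odot>\<^bsub>M\<^esub> y s) = v"
    and \<xi>: "\<xi> \<in> carrier (dual_space M)"
  shows "(\<Oplus>\<^bsub>dual_space M\<^esub>s\<in>S. (\<lambda>\<xi>\<in>carrier (dual_space M). \<xi> (y s)) \<xi> \<odot>\<^bsub>dual_space M\<^esub> f s) = \<xi>"
proof -
  interpret M: cmod M by fact
  interpret D: cmod "dual_space M" by (rule cmod_dual_space) fact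
  let ?R = "\<Oplus>\<^bsub>dual_space M\<^esub>s\<in>S. (\<lambda>\<xi>\<in>carrier (dual_space M). \<xi> (y s)) \<xi> \<odot>\<^bsub>dual_space M\<^esub> f s"
  have R: "?R \<in> carrier (dual_space M)"
    by (intro D.finsum_closed Pi_I D.smult_closed' f)
  have "?R v = \<xi> v" if v: "v \<in> carrier M" for v
  proof -
    have "lin_on (dual_space M) complex_line (\<lambda>\<xi>. \<xi> v)"
      using v by (auto simp: lin_on_def)
    then have "?R v = (\<Oplus>\<^bsub>complex_line\<^esub>s\<in>S. ((\<lambda>\<xi>\<in>carrier (dual_space M). \<xi> (y s)) \<xi> \<odot>\<^bsub>dual_space M\<^esub> f s) v)"
      by (intro lin_on_finsum[OF D.cmod_axioms cmod_complex_line, where f = "\<lambda>\<xi>. \<xi> v"] D.smult_closed' f)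
    also have "\<dots> = (\<Sum>s\<in>S. f s v * \<xi> (y s))"
      using v \<xi> by (simp add: finsum_complex_line mult.commute)
    also have "\<dots> = (\<Oplus>\<^bsub>complex_line\<^esub>s\<in>S. \<xi> (f s v \<odot>\<^bsub>M\<^esub> y s))"
      unfolding finsum_complex_line using \<xi> y by (intro sum.cong) (auto simp: lin_maps_dual_iff)
    also have "\<dots> = \<xi> (\<Oplus>\<^bsub>M\<^esub>s\<in>S. f s v \<odot>\<^bsub>M\<^esub> y s)"
      using \<xi> y by (intro lin_on_finsum[symmetric] assms cmod_complex_line) (auto simp: lin_maps_iff)
    also have "\<dots> = \<xi> v" using res v by simp
    finally show ?thesis .
  qed
  then show ?thesis
    using R \<xi> by (intro extensionalityI[of _ "carrier M"]) (auto simp: lin_maps_iff)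
qed


subsection \<open>Coordinates and dimension\<close>

lemma is_coords_iff:
  assumes "cmod M"
  shows "is_coords M n e v c \<longleftrightarrow> c \<in> extensional {..<n} \<and> v = (\<Oplus>\<^bsub>M\<^esub>i\<in>{..<n}. c i \<odot>\<^bsub>M\<^esub> e i)"
  by (auto simp: is_coords_def PiE_def)

lemma is_coords_coord:
  assumes "cbasis M n e" "v \<in> carrier M"
  shows "is_coords M n e v (coord M n e v)"
  using assms unfolding coord_def cbasis_def by (metis (mono_tags, lifting) theI')

lemma coord_eqI:
  assumes "cbasis M n e" "v \<in> carrier M" "is_coords M n e v c"
  shows "coord M n e v = c"
  using assms is_coords_coord[OF assms(1,2)] unfolding cbasis_def by blast

context cmod
begin

lemma coord_expand:
  "cbasis M n e \<Longrightarrow> v \<in> carrier M \<Longrightarrow> v = (\<Oplus>i\<in>{..<n}. coord M n e v i \<odot> e i)"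
  using is_coords_coord[of M n e v] by (simp add: is_coords_def)

lemma finsum_coords:
  assumes "cbasis M n e" "i < n"
  shows "coord M n e (\<Oplus>i\<in>{..<n}. c i \<odot> e i) i = c i"
proof -
  have e: "e j \<in> carrier M" if "j < n" for j using assms that by (auto simp: cbasis_def)
  have "is_coords M n e (\<Oplus>i\<in>{..<n}. c i \<odot> e i) (restrict c {..<n})"
    unfolding is_coords_iff[OF cmod_axioms] by (auto intro!: finsum_cong' simp: e)
  then show ?thesis
    using coord_eqI[OF assms(1)] assms(2) e by (auto intro!: finsum_closed)
qed

lemma coord_add:
  assumes b: "cbasis M n e" and u: "u \<in> carrier M" and v: "v \<in> carrier M" and i: "i < n"
  shows "coord M n e (u \<oplus> v) i = coord M n e u i + coord M n e v i"
proof -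
  have e: "e j \<in> carrier M" if "j < n" for j using b that by (auto simp: cbasis_def)
  have "u \<oplus> v = (\<Oplus>i\<in>{..<n}. coord M n e u i \<odot> e i) \<oplus> (\<Oplus>i\<in>{..<n}. coord M n e v i \<odot> e i)"
    using coord_expand b u v by metis
  also have "\<dots> = (\<Oplus>i\<in>{..<n}. coord M n e u i \<odot> e i \<oplus> coord M n e v i \<odot> e i)"
    by (rule finsum_addf[symmetric]) (auto simp: e)
  also have "\<dots> = (\<Oplus>i\<in>{..<n}. (coord M n e u i + coord M n e v i) \<odot> e i)"
    by (rule finsum_cong') (auto simp: e smult_add_l)
  finally show ?thesis using finsum_coords[OF b i, of "\<lambda>i. coord M n e u i + coord M n e v i"] by simp
qed

lemma coord_smult:
  assumes b: "cbasis M n e" and u: "u \<in> carrier M" and i: "i < n"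
  shows "coord M n e (c \<odot> u) i = c * coord M n e u i"
proof -
  have e: "e j \<in> carrier M" if "j < n" for j using b that by (auto simp: cbasis_def)
  have "c \<odot> u = c \<odot> (\<Oplus>i\<in>{..<n}. coord M n e u i \<odot> e i)"
    using coord_expand b u by metis
  also have "\<dots> = (\<Oplus>i\<in>{..<n}. c \<odot> (coord M n e u i \<odot> e i))"
    by (rule finsum_smult_ldistr) (auto simp: e)
  also have "\<dots> = (\<Oplus>i\<in>{..<n}. (c * coord M n e u i) \<odot> e i)"
    by (rule finsum_cong') (auto simp: e smult_mult)
  finally show ?thesis using finsum_coords[OF b i, of "\<lambda>i. c * coord M n e u i"] by simp
qed

lemma coord_zero: "cbasis M n e \<Longrightarrow> i < n \<Longrightarrow> coord M n e \<zero> i = 0"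
  using coord_smult[of n e \<zero> i 0] by simp

end

text \<open>Gaussian elimination, by induction on the number of equations. Its purpose is invariance
  of dimension, on which the value of \<open>bundle_rank\<close> rests.\<close>

lemma underdetermined_system:
  fixes a :: "nat \<Rightarrow> nat \<Rightarrow> complex"
  assumes "m < n"
  shows "\<exists>c. (\<exists>i<n. c i \<noteq> 0) \<and> (\<forall>j<m. (\<Sum>i<n. a j i * c i) = 0)"
  using assms
proof (induct m arbitrary: n a)
  case 0
  then show ?case by (intro exI[of _ "\<lambda>_. 1"]) auto
next
  case (Suc m)
  obtain N where N: "n = Suc N" "m < N" using Suc.prems by (cases n) auto
  show ?case
  proof (cases "\<exists>p<n. a m p \<noteq> 0")
    case False
    obtain c where "\<exists>i<n. c i \<noteq> 0" "\<forall>j<m. (\<Sum>i<n. a j i * c i) = 0"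
      using Suc.hyps[of n a] N by auto
    then show ?thesis using False by (intro exI[of _ c]) (auto simp: less_Suc_eq)
  next
    case True
    then obtain p where p: "p < n" "a m p \<noteq> 0" by auto
    \<comment> \<open>An enumeration of the unknowns other than the pivot \<open>p\<close>.\<close>
    define r where "r = (\<lambda>i. if i < p then i else Suc i)"
    have r: "bij_betw r {..<N} ({..<n} - {p})"
      by (rule bij_betw_byWitness[where f' = "\<lambda>i. if i < p then i else i - 1"]) (use p N in \<open>auto simp: r_def\<close>)
    \<comment> \<open>Equation \<open>m\<close>, scaled by \<open>a j p / a m p\<close>, is
      subtracted from equation \<open>j\<close> to eliminate the unknown \<open>p\<close>.\<close>
    define b where "b = (\<lambda>j i. a j (r i) - a j p * a m (r i) / a m p)"
    obtain c where c: "\<exists>i<N. c i \<noteq> 0" "\<forall>j<m. (\<Sum>i<N. b j i * c i) = 0"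
      using Suc.hyps[of N b] N by auto
    define s where "s = (\<Sum>i<N. a m (r i) * c i)"
    \<comment> \<open>The value at the pivot is the one that equation \<open>m\<close>
      forces.\<close>
    define d where "d = (\<lambda>i. if i = p then - s / a m p else c (inv_into {..<N} r i))"
    have dr: "d (r i) = c i" if "i < N" for i
      using that r inv_into_f_f[of r "{..<N}" i] by (auto simp: d_def bij_betw_def r_def split: if_splits)
    have sum: "(\<Sum>i<n. a j i * d i) = a j p * (- s / a m p) + (\<Sum>i<N. a j (r i) * c i)" for j
    proof -
      have "(\<Sum>i<n. a j i * d i) = a j p * d p + (\<Sum>i\<in>{..<n} - {p}. a j i * d i)"
        using p by (intro sum.remove) auto
      also have "(\<Sum>i\<in>{..<n} - {p}. a j i * d i) = (\<Sum>i<N. a j (r i) * d (r i))"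
        by (rule sum.reindex_bij_betw[OF r, symmetric])
      finally show ?thesis by (simp add: dr) (simp add: d_def)
    qed
    have "(\<Sum>i<n. a j i * d i) = 0" if "j < Suc m" for j
    proof (cases "j = m")
      case True
      then show ?thesis using p by (simp add: sum s_def)
    next
      case False
      then have "0 = (\<Sum>i<N. b j i * c i)" using c that by auto
      also have "\<dots> = (\<Sum>i<N. a j (r i) * c i - a j p / a m p * (a m (r i) * c i))"
        by (rule sum.cong) (auto simp: b_def algebra_simps)
      also have "\<dots> = (\<Sum>i<N. a j (r i) * c i) - a j p / a m p * s"
        by (simp add: sum_subtractf s_def sum_distrib_left)
      finally show ?thesis unfolding sum by (simp add: mult.commute)
    qed
    moreover obtain i where "i < N" "c i \<noteq> 0" using c by auto
    then have "\<exists>i<n. d i \<noteq> 0"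
      using dr r by (intro exI[of _ "r i"]) (auto simp: bij_betw_def)
    ultimately show ?thesis by blast
  qed
qed

text \<open>If \<open>n\<close> exceeded \<open>m\<close>, the \<open>f\<close>-coordinates of the
  \<open>e i\<close> would form a homogeneous system with a nonzero solution, that is, a linear
  relation among the \<open>e i\<close>.\<close>

lemma (in cmod) cbasis_card_le:
  assumes e: "cbasis M n e" and f: "cbasis M m f" shows "n \<le> m"
proof (rule ccontr)
  assume "\<not> n \<le> m"
  then obtain c where c: "\<exists>i<n. c i \<noteq> 0" "\<And>j. j < m \<Longrightarrow> (\<Sum>i<n. coord M m f (e i) j * c i) = 0"
    using underdetermined_system[of m n "\<lambda>j i. coord M m f (e i) j"] by auto
  have ecl: "e j \<in> carrier M" if "j < n" for j using e that by (auto simp: cbasis_def)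
  have fcl: "f j \<in> carrier M" if "j < m" for j using f that by (auto simp: cbasis_def)
  let ?v = "\<Oplus>i\<in>{..<n}. c i \<odot> e i"
  have v: "?v \<in> carrier M" by (auto intro!: finsum_closed ecl)
  have "coord M m f ?v j = 0" if j: "j < m" for j
  proof -
    have "coord M m f (\<Oplus>i\<in>A. c i \<odot> e i) j = (\<Sum>i\<in>A. coord M m f (e i) j * c i)"
      if "finite A" "A \<subseteq> {..<n}" for A
      using that
    proof (induct A)
      case (insert x A)
      then have "(\<lambda>i. c i \<odot> e i) \<in> A \<rightarrow> carrier M" "e x \<in> carrier M" using ecl by auto
      then show ?case
        using insert by (simp add: coord_add[OF f _ _ j] coord_smult[OF f _ j] finsum_closed mult.commute)
    qed (simp add: coord_zero[OF f j])
    from this[of "{..<n}"] show ?thesis using c(2)[OF j] by simp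
  qed
  then have "(\<Oplus>j\<in>{..<m}. coord M m f ?v j \<odot> f j) = (\<Oplus>j\<in>{..<m}. \<zero>)"
    by (intro finsum_cong') (auto simp: fcl)
  then have "?v = \<zero>" using coord_expand[OF f v] by simp
  then show False using c(1) finsum_coords[OF e, of _ c] coord_zero[OF e] by metis
qed

lemma (in cmod) cbasis_card_unique: "cbasis M n e \<Longrightarrow> cbasis M m f \<Longrightarrow> n = m"
  using cbasis_card_le by (meson le_antisym)


section \<open>Holomorphic sections\<close>

lemma chart_open_image:
  assumes "riemann_surface X" "(W, z) \<in> X" "open U"
  shows "open (z ` (U \<inter> W))"
proof -
  have W: "open W" "open (z ` W)" "homeomorphism W (z ` W) z (inv_into W z)"
    using assms(1,2) by (auto simp: riemann_surface_def)
  have "openin (top_of_set W) (U \<inter> W)"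
    using openin_open_Int[OF assms(3), of W] by (simp add: Int_commute)
  then have "openin (top_of_set (z ` W)) (z ` (U \<inter> W))"
    by (rule homeomorphism_imp_open_map[OF W(3)])
  then show ?thesis using W(2) openin_open_trans by blast
qed

lemma chart_inv_into:
  assumes "riemann_surface X" "(W, z) \<in> X" "y \<in> W"
  shows "inv_into W z (z y) = y"
proof -
  have "homeomorphism W (z ` W) z (inv_into W z)"
    using assms(1,2) by (auto simp: riemann_surface_def)
  then show ?thesis using assms(3) by (simp add: homeomorphism_def)
qed

lemma hol_fun_cong:
  assumes "riemann_surface X" "\<And>x. x \<in> U \<Longrightarrow> f x = g x"
  shows "hol_fun X U f \<longleftrightarrow> hol_fun X U g"
proof -
  have "(f \<circ> inv_into W z) holomorphic_on z ` (U \<inter> W) \<longleftrightarrow> (g \<circ> inv_into W z) holomorphic_on z ` (U \<inter> W)"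
    if "(W, z) \<in> X" for W z
    by (rule holomorphic_cong) (use assms that in \<open>auto simp: chart_inv_into\<close>)
  then show ?thesis by (auto simp: hol_fun_def)
qed

lemma hol_fun_const: "hol_fun X U (\<lambda>_. c)"
  by (auto simp: hol_fun_def o_def)

lemma hol_fun_add: "hol_fun X U f \<Longrightarrow> hol_fun X U g \<Longrightarrow> hol_fun X U (\<lambda>x. f x + g x)"
  by (auto simp: hol_fun_def o_def intro!: holomorphic_on_add)

lemma hol_fun_mult: "hol_fun X U f \<Longrightarrow> hol_fun X U g \<Longrightarrow> hol_fun X U (\<lambda>x. f x * g x)"
  by (auto simp: hol_fun_def o_def intro!: holomorphic_on_mult)

text \<open>Chart images of open sets are open, so holomorphy near each point gives
  differentiability at each point of the chart image.\<close>

lemma hol_fun_local: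
  assumes X: "riemann_surface X" and loc: "\<And>x. x \<in> U \<Longrightarrow> \<exists>U'. open U' \<and> x \<in> U' \<and> hol_fun X U' f"
  shows "hol_fun X U f"
  unfolding hol_fun_def
proof clarify
  fix W z assume Wz: "(W, z) \<in> X"
  show "(f \<circ> inv_into W z) holomorphic_on z ` (U \<inter> W)"
    unfolding holomorphic_on_def
  proof
    fix w assume "w \<in> z ` (U \<inter> W)"
    then obtain y where y: "w = z y" "y \<in> U" "y \<in> W" by auto
    then obtain U' where U': "open U'" "y \<in> U'" "hol_fun X U' f" using loc by auto
    then have "(f \<circ> inv_into W z) holomorphic_on z ` (U' \<inter> W)" "w \<in> z ` (U' \<inter> W)"
      using Wz y by (auto simp: hol_fun_def)
    then have "(f \<circ> inv_into W z) field_differentiable at w"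
      using chart_open_image[OF X Wz U'(1)] holomorphic_on_imp_differentiable_at by blast
    then show "(f \<circ> inv_into W z) field_differentiable at w within z ` (U \<inter> W)"
      by (rule field_differentiable_at_within)
  qed
qed

locale hol_vb =
  fixes X :: "'x::t2_space atlas" and n :: nat and V :: "('x, 'v) vbundle"
  assumes surface: "riemann_surface X" and hol: "hol_bundle X n V"
begin

lemma cmod_fibre: "cmod (fibre V x)"
  using hol by (simp add: hol_bundle_def cmod_def)

sublocale fib: cmod "fibre V x" for x by (rule cmod_fibre)

text \<open>The last clause of \<open>hol_bundle\<close> with its quantifier over pairs unpacked, in
  a form that rewrites \<open>hsec\<close> into conditions on coordinates.\<close>

definition hol_coords :: "('x set \<times> (nat \<Rightarrow> 'x \<Rightarrow> 'v)) set \<Rightarrow> bool" where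
  "hol_coords T \<longleftrightarrow> (\<forall>U s. hsec V U s \<longleftrightarrow> open U \<and> (\<forall>x\<in>U. s x \<in> carrier (fibre V x)) \<and>
     (\<forall>U' e i. (U', e) \<in> T \<longrightarrow> i < n \<longrightarrow>
        hol_fun X (U \<inter> U') (\<lambda>x. coord (fibre V x) n (\<lambda>j. e j x) (s x) i)))"

lemmas hol_coordsD = hol_coords_def[THEN iffD1, rule_format]

lemma trivialization:
  obtains T where "hol_coords T" "\<And>x. \<exists>(U, e)\<in>T. x \<in> U" "\<And>U e. (U, e) \<in> T \<Longrightarrow> hol_frame V n U e"
proof -
  obtain T where T: "(\<forall>x. \<exists>(U, e)\<in>T. x \<in> U)" "(\<forall>(U, e)\<in>T. hol_frame V n U e)"
    "(\<forall>U s. hsec V U s \<longleftrightarrow>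
             open U \<and> (\<forall>x\<in>U. s x \<in> carrier (fibre V x)) \<and>
             (\<forall>(U', e)\<in>T. \<forall>i<n.
                hol_fun X (U \<inter> U') (\<lambda>x. coord (fibre V x) n (\<lambda>j. e j x) (s x) i)))"
    using hol unfolding hol_bundle_def by auto
  show thesis
  proof (rule that)
    show "hol_coords T"
      unfolding hol_coords_def T(3)[rule_format] by fast
  qed (use T in auto)
qed

lemma hsec_open: "hsec V U s \<Longrightarrow> open U"
  and hsec_carrier: "hsec V U s \<Longrightarrow> x \<in> U \<Longrightarrow> s x \<in> carrier (fibre V x)"
  using trivialization hol_coordsD by metis+

text \<open>The gluing property of the sheaf of sections, inherited from holomorphic functions
  through coordinates.\<close>

lemma hsec_local:
  assumes "open U" and loc: "\<And>x. x \<in> U \<Longrightarrow> \<exists>U'. x \<in> U' \<and> hsec V U' s"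
  shows "hsec V U s"
proof (rule trivialization)
  fix T assume hc: "hol_coords T"
    and fr: "\<And>U e. (U, e) \<in> T \<Longrightarrow> hol_frame V n U e"
  note T = hol_coordsD[OF hc]
  have "hol_fun X (U \<inter> U') (\<lambda>x. coord (fibre V x) n (\<lambda>j. e j x) (s x) i)" if e: "(U', e) \<in> T" "i < n" for U' e i
  proof (rule hol_fun_local[OF surface])
    fix x assume x: "x \<in> U \<inter> U'"
    then obtain U'' where U'': "x \<in> U''" "hsec V U'' s" using loc by auto
    have "open U'" using fr[OF e(1)] by (simp add: hol_frame_def)
    then show "\<exists>U''. open U'' \<and> x \<in> U'' \<and> hol_fun X U'' (\<lambda>x. coord (fibre V x) n (\<lambda>j. e j x) (s x) i)"
      using U'' x e unfolding T[of U'' s] by (intro exI[of _ "U'' \<inter> U'"]) auto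
  qed
  then show "hsec V U s"
    unfolding T[of U s] using assms(1) loc hsec_carrier by blast
qed

lemma hsec_cong:
  assumes "\<And>x. x \<in> U \<Longrightarrow> s x = t x"
  shows "hsec V U s \<longleftrightarrow> hsec V U t"
proof (rule trivialization)
  fix T assume hc: "hol_coords T"
  note T = hol_coordsD[OF hc]
  have "hol_fun X (U \<inter> U') (\<lambda>x. coord (fibre V x) n (\<lambda>j. e j x) (s x) i) \<longleftrightarrow>
      hol_fun X (U \<inter> U') (\<lambda>x. coord (fibre V x) n (\<lambda>j. e j x) (t x) i)" for U' e i
    by (rule hol_fun_cong[OF surface]) (use assms in auto)
  then show ?thesis unfolding T[of U s] T[of U t] using assms by auto
qed

lemma hsec_add:
  assumes "hsec V U s" "hsec V U t" shows "hsec V U (\<lambda>x. s x \<oplus>\<^bsub>fibre V x\<^esub> t x)"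
proof (rule trivialization)
  fix T assume hc: "hol_coords T"
    and fr: "\<And>U e. (U, e) \<in> T \<Longrightarrow> hol_frame V n U e"
  note T = hol_coordsD[OF hc]
  have "hol_fun X (U \<inter> U') (\<lambda>x. coord (fibre V x) n (\<lambda>j. e j x) (s x \<oplus>\<^bsub>fibre V x\<^esub> t x) i)" if e: "(U', e) \<in> T" "i < n" for U' e i
  proof -
    have "hol_fun X (U \<inter> U') (\<lambda>x. coord (fibre V x) n (\<lambda>j. e j x) (s x) i + coord (fibre V x) n (\<lambda>j. e j x) (t x) i)"
      using assms e unfolding T by (intro hol_fun_add) auto
    moreover have "coord (fibre V x) n (\<lambda>j. e j x) (s x \<oplus>\<^bsub>fibre V x\<^esub> t x) i =
        coord (fibre V x) n (\<lambda>j. e j x) (s x) i + coord (fibre V x) n (\<lambda>j. e j x) (t x) i" if "x \<in> U \<inter> U'" for x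
      using fr[OF e(1)] that e assms by (intro fib.coord_add) (auto simp: hol_frame_def hsec_carrier)
    ultimately show ?thesis using hol_fun_cong[OF surface] by (metis (no_types, lifting))
  qed
  then show ?thesis
    unfolding T[of U "\<lambda>x. s x \<oplus>\<^bsub>fibre V x\<^esub> t x"] using assms hsec_open hsec_carrier by auto
qed

lemma hsec_smult:
  assumes "hsec V U s" shows "hsec V U (\<lambda>x. c \<odot>\<^bsub>fibre V x\<^esub> s x)"
proof (rule trivialization)
  fix T assume hc: "hol_coords T"
    and fr: "\<And>U e. (U, e) \<in> T \<Longrightarrow> hol_frame V n U e"
  note T = hol_coordsD[OF hc]
  have "hol_fun X (U \<inter> U') (\<lambda>x. coord (fibre V x) n (\<lambda>j. e j x) (c \<odot>\<^bsub>fibre V x\<^esub> s x) i)" if e: "(U', e) \<in> T" "i < n" for U' e i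
  proof -
    have "hol_fun X (U \<inter> U') (\<lambda>x. c * coord (fibre V x) n (\<lambda>j. e j x) (s x) i)"
      using assms e unfolding T by (intro hol_fun_mult hol_fun_const) auto
    moreover have "coord (fibre V x) n (\<lambda>j. e j x) (c \<odot>\<^bsub>fibre V x\<^esub> s x) i =
        c * coord (fibre V x) n (\<lambda>j. e j x) (s x) i" if "x \<in> U \<inter> U'" for x
      using fr[OF e(1)] that e assms by (intro fib.coord_smult) (auto simp: hol_frame_def hsec_carrier)
    ultimately show ?thesis using hol_fun_cong[OF surface] by (metis (no_types, lifting))
  qed
  then show ?thesis
    unfolding T[of U "\<lambda>x. c \<odot>\<^bsub>fibre V x\<^esub> s x"] using assms hsec_open hsec_carrier by auto
qed

lemma hsec_zero: "open U \<Longrightarrow> hsec V U (\<lambda>x. \<zero>\<^bsub>fibre V x\<^esub>)"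
proof (rule trivialization)
  fix T assume U: "open U"
    and hc: "hol_coords T"
    and fr: "\<And>U e. (U, e) \<in> T \<Longrightarrow> hol_frame V n U e"
  note T = hol_coordsD[OF hc]
  have "hol_fun X (U \<inter> U') (\<lambda>x. coord (fibre V x) n (\<lambda>j. e j x) \<zero>\<^bsub>fibre V x\<^esub> i)" if e: "(U', e) \<in> T" "i < n" for U' e i
  proof -
    have "coord (fibre V x) n (\<lambda>j. e j x) \<zero>\<^bsub>fibre V x\<^esub> i = 0" if "x \<in> U \<inter> U'" for x
      using fr[OF e(1)] that e by (intro fib.coord_zero) (auto simp: hol_frame_def)
    then show ?thesis using hol_fun_cong[OF surface] hol_fun_const by (metis (no_types, lifting))
  qed
  then show ?thesis
    unfolding T[of U "\<lambda>x. \<zero>\<^bsub>fibre V x\<^esub>"] using U by auto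
qed

lemma frame_exists: obtains U e where "x \<in> U" "hol_frame V n U e"
  using trivialization by (metis (no_types, lifting) case_prodE)

lemma basis_exists: obtains e where "cbasis (fibre V x) n e"
proof -
  obtain U e where "x \<in> U" "hol_frame V n U e" by (rule frame_exists)
  then show thesis using that by (auto simp: hol_frame_def)
qed

lemma bundle_rank: "bundle_rank V = n"
  unfolding bundle_rank_def
proof (rule the_equality)
  show "\<forall>x. \<exists>e. cbasis (fibre V x) n e" using basis_exists by blast
next
  fix m assume "\<forall>x. \<exists>e. cbasis (fibre V x) m e"
  then show "m = n" using basis_exists fib.cbasis_card_unique by metis
qed

lemma subbundle_submodule:
  assumes "subbundle V W" shows "submodule (W x) CC (fibre V x)"
proof -
  obtain r U e where r: "r \<le> n" "x \<in> U" "hol_frame V n U e" "\<forall>y\<in>U. W y = cspan (fibre V y) {e i y |i. i < r}"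
    using assms unfolding subbundle_def bundle_rank by blast
  then have "{e i x |i. i < r} \<subseteq> carrier (fibre V x)"
    by (auto simp: hol_frame_def cbasis_def)
  then show ?thesis using fib.cspan_submodule r by auto
qed

lemma subbundle_zero_sub: "subbundle V (zero_sub V)"
proof -
  have "cspan (fibre V y) {} = {\<zero>\<^bsub>fibre V y\<^esub>}" for y
    using cspan_zero[of "fibre V y" "{}"] fib.cspan_least[of "{\<zero>\<^bsub>fibre V y\<^esub>}" y "{}"] by (auto simp: fib.submodule_iff)
  then have "\<exists>U e. x \<in> U \<and> hol_frame V n U e \<and> (\<forall>y\<in>U. zero_sub V y = cspan (fibre V y) {e i y |i. i < 0})" for x
    by (rule_tac frame_exists[of x]) (auto simp: zero_sub_def)
  then show ?thesis
    unfolding subbundle_def bundle_rank by blast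
qed

lemma subbundle_full_sub: "subbundle V (full_sub V)"
proof -
  have "carrier (fibre V y) = cspan (fibre V y) {e i y |i. i < n}" if "hol_frame V n U e" "y \<in> U" for U e y
  proof -
    have b: "cbasis (fibre V y) n (\<lambda>i. e i y)" using that by (auto simp: hol_frame_def)
    then have sub: "{e i y |i. i < n} \<subseteq> carrier (fibre V y)" by (auto simp: cbasis_def)
    note S = fib.cspan_submodule[OF this]
    have "v \<in> cspan (fibre V y) {e i y |i. i < n}" if v: "v \<in> carrier (fibre V y)" for v
    proof -
      have "(\<Oplus>\<^bsub>fibre V y\<^esub>i\<in>{..<n}. coord (fibre V y) n (\<lambda>i. e i y) v i \<odot>\<^bsub>fibre V y\<^esub> e i y)
        \<in> cspan (fibre V y) {e i y |i. i < n}"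
      proof (rule fib.finsum_mem_submodule[OF S])
        fix i assume "i \<in> {..<n}"
        then have "e i y \<in> cspan (fibre V y) {e i y |i. i < n}" by (intro cspan_base) auto
        then show "coord (fibre V y) n (\<lambda>i. e i y) v i \<odot>\<^bsub>fibre V y\<^esub> e i y \<in> cspan (fibre V y) {e i y |i. i < n}"
          using S by (simp add: fib.submodule_iff)
      qed
      then show ?thesis using fib.coord_expand[OF b v] by simp
    qed
    moreover have "cspan (fibre V y) {e i y |i. i < n} \<subseteq> carrier (fibre V y)"
      using S by (simp add: fib.submodule_iff)
    ultimately show ?thesis by blast
  qed
  then have "\<exists>U e. x \<in> U \<and> hol_frame V n U e \<and> (\<forall>y\<in>U. full_sub V y = cspan (fibre V y) {e i y |i. i < n})" for x
  proof -
    assume span: "\<And>U e y. hol_frame V n U e \<Longrightarrow> y \<in> U \<Longrightarrow> carrier (fibre V y) = cspan (fibre V y) {e i y |i. i < n}"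
    obtain U e where "x \<in> U" "hol_frame V n U e" by (rule frame_exists)
    with span[OF this(2)] show ?thesis
      by (intro exI[of _ U] exI[of _ e]) (simp add: full_sub_def)
  qed
  then show ?thesis
    unfolding subbundle_def bundle_rank by blast
qed

lemma subbundle_zero_mem: "subbundle V W \<Longrightarrow> \<zero>\<^bsub>fibre V x\<^esub> \<in> W x"
  using subbundle_submodule[of W x] by (simp add: fib.submodule_iff)

lemma subbundle_carrier: "subbundle V W \<Longrightarrow> W x \<subseteq> carrier (fibre V x)"
  using subbundle_submodule[of W x] by (simp add: fib.submodule_iff)

lemma subbundle_add: "subbundle V W \<Longrightarrow> u \<in> W x \<Longrightarrow> v \<in> W x \<Longrightarrow> u \<oplus>\<^bsub>fibre V x\<^esub> v \<in> W x"
  using subbundle_submodule[of W x] by (simp add: fib.submodule_iff)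

lemma subbundle_smult: "subbundle V W \<Longrightarrow> u \<in> W x \<Longrightarrow> c \<odot>\<^bsub>fibre V x\<^esub> u \<in> W x"
  using subbundle_submodule[of W x] by (simp add: fib.submodule_iff)

lemma sub_bundle_full_sub: "sub_bundle V (full_sub V) = V"
proof -
  have "(\<lambda>U s. hsec V U s \<and> (\<forall>x\<in>U. s x \<in> carrier (fibre V x))) = hsec V"
    using hsec_carrier by (intro ext) blast
  then show ?thesis by (simp add: sub_bundle_def full_sub_def)
qed

lemma bundle_rank_zero_sub: "bundle_rank (sub_bundle V (zero_sub V)) = 0"
proof -
  have sm: "submodule {\<zero>\<^bsub>fibre V x\<^esub>} CC (fibre V x)" for x by (simp add: fib.submodule_iff)
  have b: "cbasis (fibre (sub_bundle V (zero_sub V)) x) 0 e" for x e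
    by (auto simp: cbasis_def sub_bundle_def zero_sub_def is_coords_def
        cmod.module[THEN module.axioms(2), THEN abelian_group.axioms(1), THEN abelian_monoid.finsum_empty, OF fib.submodule_cmod[OF sm]])
  have c: "cmod (fibre (sub_bundle V (zero_sub V)) x)" for x
    using fib.submodule_cmod[OF sm] by (simp add: sub_bundle_def zero_sub_def)
  show ?thesis unfolding bundle_rank_def
    by (rule the_equality) (use b cmod.cbasis_card_unique[OF c] in blast)+
qed

lemma bundle_degree_zero_sub: "bundle_degree X (sub_bundle V (zero_sub V)) = 0"
  by (simp add: bundle_degree_def bundle_rank_zero_sub)


subsection \<open>Holomorphic endomorphisms\<close>

text \<open>Holomorphy is encoded as preservation of the sheaf of sections rather than by matrix
  entries, so sums, multiples and composites are handled without frames. Values off the fibres are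
  left free.\<close>

definition hol_endo :: "('x \<Rightarrow> 'v \<Rightarrow> 'v) \<Rightarrow> bool" where
  "hol_endo g \<longleftrightarrow> (\<forall>x. lin_on (fibre V x) (fibre V x) (g x)) \<and>
     (\<forall>U s. hsec V U s \<longrightarrow> hsec V U (\<lambda>x. g x (s x)))"

lemma hol_endo_closed: "hol_endo g \<Longrightarrow> u \<in> carrier (fibre V x) \<Longrightarrow> g x u \<in> carrier (fibre V x)"
  and hol_endo_add: "hol_endo g \<Longrightarrow> u \<in> carrier (fibre V x) \<Longrightarrow> v \<in> carrier (fibre V x) \<Longrightarrow>
    g x (u \<oplus>\<^bsub>fibre V x\<^esub> v) = g x u \<oplus>\<^bsub>fibre V x\<^esub> g x v"
  and hol_endo_smult: "hol_endo g \<Longrightarrow> u \<in> carrier (fibre V x) \<Longrightarrow>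
    g x (c \<odot>\<^bsub>fibre V x\<^esub> u) = c \<odot>\<^bsub>fibre V x\<^esub> g x u"
  by (simp_all add: hol_endo_def lin_on_def)

lemma hol_endo_lin_on: "hol_endo g \<Longrightarrow> lin_on (fibre V x) (fibre V x) (g x)"
  by (simp add: hol_endo_def)

lemma hol_endo_zero_map: "hol_endo (\<lambda>x u. \<zero>\<^bsub>fibre V x\<^esub>)"
  unfolding hol_endo_def using hsec_zero hsec_open by (auto simp: lin_on_def)

lemma hol_endo_id: "hol_endo (\<lambda>x u. u)"
  unfolding hol_endo_def by (auto simp: lin_on_def)

lemma hol_endo_comp: "hol_endo g \<Longrightarrow> hol_endo h \<Longrightarrow> hol_endo (\<lambda>x u. g x (h x u))"
  unfolding hol_endo_def by (auto simp: lin_on_def)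

lemma hol_endo_plus: "hol_endo g \<Longrightarrow> hol_endo h \<Longrightarrow> hol_endo (\<lambda>x u. g x u \<oplus>\<^bsub>fibre V x\<^esub> h x u)"
  unfolding hol_endo_def using hsec_add by (auto simp: lin_on_def fib.a_ac fib.smult_add_r)

lemma hol_endo_scale: "hol_endo g \<Longrightarrow> hol_endo (\<lambda>x u. c \<odot>\<^bsub>fibre V x\<^esub> g x u)"
  unfolding hol_endo_def using hsec_smult by (auto simp: lin_on_def fib.smult_add_r fib.smult_mult mult.commute)


subsection \<open>Graded pieces\<close>

lemma fibre_gr_piece: "fibre (gr_piece V F i) x = quot_space ((fibre V x)\<lparr>carrier := F i x\<rparr>) (F (i - 1) x)"
  by (simp add: gr_piece_def quot_bundle_def sub_bundle_def)

lemma gr_piece_zero: "\<zero>\<^bsub>fibre (gr_piece V F i) x\<^esub> = F (i - 1) x"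
  by (simp add: fibre_gr_piece quot_space_def)

lemma hsec_gr_piece: "hsec (gr_piece V F i) U q \<longleftrightarrow> open U \<and>
    (\<forall>x\<in>U. \<exists>U' s. x \<in> U' \<and> U' \<subseteq> U \<and> hsec V U' s \<and> (\<forall>y\<in>U'. s y \<in> F i y) \<and>
      (\<forall>y\<in>U'. q y = F (i - 1) y +>\<^bsub>fibre V y\<^esub> s y))"
  by (simp add: gr_piece_def quot_bundle_def sub_bundle_def conj_ac)

context
  fixes F :: "nat \<Rightarrow> 'x \<Rightarrow> 'v set" and i :: nat
  assumes F: "subbundle V (F i)" and F1: "subbundle V (F (i - 1))" and le: "\<And>x. F (i - 1) x \<subseteq> F i x"
begin

lemma cmod_restrict_sub: "cmod ((fibre V x)\<lparr>carrier := F i x\<rparr>)"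
  by (rule fib.submodule_cmod[OF subbundle_submodule[OF F]])

lemma submodule_restrict_sub: "submodule (F (i - 1) x) CC ((fibre V x)\<lparr>carrier := F i x\<rparr>)"
  by (rule fib.submodule_mono_restrict[OF subbundle_submodule[OF F1] subbundle_submodule[OF F] le])

lemma cmod_gr_piece: "cmod (fibre (gr_piece V F i) x)"
  unfolding fibre_gr_piece by (rule cmod.cmod_quot_space[OF cmod_restrict_sub submodule_restrict_sub])

lemma gr_piece_carrier: "carrier (fibre (gr_piece V F i) x) = {F (i - 1) x +>\<^bsub>fibre V x\<^esub> u |u. u \<in> F i x}"
  unfolding fibre_gr_piece cmod.quot_space_carrier[OF cmod_restrict_sub] by simp

lemma gr_piece_add: "u \<in> F i x \<Longrightarrow> v \<in> F i x \<Longrightarrow>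
    (F (i - 1) x +>\<^bsub>fibre V x\<^esub> u) \<oplus>\<^bsub>fibre (gr_piece V F i) x\<^esub> (F (i - 1) x +>\<^bsub>fibre V x\<^esub> v)
      = F (i - 1) x +>\<^bsub>fibre V x\<^esub> (u \<oplus>\<^bsub>fibre V x\<^esub> v)"
  unfolding fibre_gr_piece using cmod.quot_space_add[OF cmod_restrict_sub submodule_restrict_sub, of u x v] by simp

lemma gr_piece_smult: "u \<in> F i x \<Longrightarrow>
    c \<odot>\<^bsub>fibre (gr_piece V F i) x\<^esub> (F (i - 1) x +>\<^bsub>fibre V x\<^esub> u) = F (i - 1) x +>\<^bsub>fibre V x\<^esub> (c \<odot>\<^bsub>fibre V x\<^esub> u)"
  unfolding fibre_gr_piece using cmod.quot_space_smult[OF cmod_restrict_sub submodule_restrict_sub, of u x c] by simp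

lemma gr_coset_eq_iff:
  assumes "u \<in> F i x" "v \<in> F i x"
  shows "F (i - 1) x +>\<^bsub>fibre V x\<^esub> u = F (i - 1) x +>\<^bsub>fibre V x\<^esub> v \<longleftrightarrow>
    u \<oplus>\<^bsub>fibre V x\<^esub> (-1) \<odot>\<^bsub>fibre V x\<^esub> v \<in> F (i - 1) x"
  using cmod.coset_eq_iff[OF cmod_restrict_sub submodule_restrict_sub, of u x v] assms by simp

lemma gr_coset_eq_zero_iff:
  assumes "u \<in> F i x"
  shows "F (i - 1) x +>\<^bsub>fibre V x\<^esub> u = F (i - 1) x \<longleftrightarrow> u \<in> F (i - 1) x"
  using cmod.coset_eq_self_iff[OF cmod_restrict_sub submodule_restrict_sub, of u x] assms by simp

lemma dual_gr_lift:
  assumes "lin_on (fibre V x) complex_line f" "\<And>w. w \<in> F (i - 1) x \<Longrightarrow> f w = 0"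
  obtains \<xi> where "\<xi> \<in> carrier (dual_space (fibre (gr_piece V F i) x))"
    "\<And>u. u \<in> F i x \<Longrightarrow> \<xi> (F (i - 1) x +>\<^bsub>fibre V x\<^esub> u) = f u"
proof -
  have "lin_on ((fibre V x)\<lparr>carrier := F i x\<rparr>) complex_line f"
    using assms(1) subbundle_carrier[OF F] by (auto simp: lin_on_def subset_iff)
  from cmod.dual_quot_lift[OF cmod_restrict_sub submodule_restrict_sub this assms(2)] that show thesis
    unfolding fibre_gr_piece by auto
qed

lemma hsec_gr_piece_smult:
  assumes "hsec (gr_piece V F i) U q"
  shows "hsec (gr_piece V F i) U (\<lambda>x. c \<odot>\<^bsub>fibre (gr_piece V F i) x\<^esub> q x)"
  unfolding hsec_gr_piece
proof (intro conjI ballI)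
  show "open U" using assms by (simp add: hsec_gr_piece)
  fix x assume "x \<in> U"
  then obtain U' s where "x \<in> U'" "U' \<subseteq> U" "hsec V U' s" "\<forall>y\<in>U'. s y \<in> F i y"
      "\<forall>y\<in>U'. q y = F (i - 1) y +>\<^bsub>fibre V y\<^esub> s y"
    using assms unfolding hsec_gr_piece by meson
  then show "\<exists>U' s. x \<in> U' \<and> U' \<subseteq> U \<and> hsec V U' s \<and> (\<forall>y\<in>U'. s y \<in> F i y) \<and>
      (\<forall>y\<in>U'. c \<odot>\<^bsub>fibre (gr_piece V F i) y\<^esub> q y = F (i - 1) y +>\<^bsub>fibre V y\<^esub> s y)"
    using hsec_smult[of U' s c] subbundle_smult[OF F] gr_piece_smult
    by (intro exI[of _ U'] exI[of _ "\<lambda>y. c \<odot>\<^bsub>fibre V y\<^esub> s y"]) auto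
qed

end

end


section \<open>Cutting a weighted filtration at a level\<close>

text \<open>The weight -1, 0 or 1 that a step of weight \<open>y\<close> receives in the two-step
  flag cut out at level \<open>t\<close>.\<close>

definition sgn_cut :: "real \<Rightarrow> real \<Rightarrow> real" where
  "sgn_cut t y = (if y > t then 1 else if y < - t then -1 else 0)"

text \<open>As a function of the level, \<open>sgn_cut\<close> changes only at the absolute values
  of members of \<open>A\<close>. The integral over levels is thus a sum over the gaps between
  consecutive elements of 0 and these absolute values. Each gap starts strictly below some
  \<open>\<bar>y\<bar>\<close>, which will keep the cut flags away from the excluded one.\<close>

lemma layer_cake:
  assumes "finite A"
  obtains R :: nat and t :: "nat \<Rightarrow> real" where
    "\<And>r. r < R \<Longrightarrow> 0 \<le> t r" "\<And>r. r < R \<Longrightarrow> t r < t (Suc r)"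
    "\<And>r. r < R \<Longrightarrow> \<exists>y\<in>A. t r < \<bar>y\<bar>"
    "\<And>y. y \<in> A \<Longrightarrow> y = (\<Sum>r<R. (t (Suc r) - t r) * sgn_cut (t r) y)"
    "R = 0 \<Longrightarrow> A \<subseteq> {0}"
proof -
  \<comment> \<open>The value 0 is inserted so that the lowest gap begins at level 0.\<close>
  define ts where "ts = sorted_list_of_set (insert 0 (abs ` A))"
  define R where "R = length ts - 1"
  define t where "t = (\<lambda>r. ts ! r)"
  have set: "set ts = insert 0 (abs ` A)" and sorted: "sorted_wrt (<) ts"
    unfolding ts_def using assms
    by (metis finite_imageI finite_insert set_sorted_list_of_set, metis strict_sorted_list_of_set)
  then have len: "length ts = Suc R" by (cases ts) (auto simp: R_def)
  have less: "t r < t s" if "r < s" "s \<le> R" for r s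
    using sorted_wrt_nth_less[OF sorted, of r s] that len by (simp add: t_def)
  have mem: "t r \<in> insert 0 (abs ` A)" if "r \<le> R" for r
    using nth_mem[of r ts] that len by (simp add: set t_def)
  have ge0: "0 \<le> t r" if "r \<le> R" for r
    using mem[OF that] by auto
  have idx: "\<exists>m\<le>R. t m = a" if "a \<in> insert 0 (abs ` A)" for a
    using that set len by (metis in_set_conv_nth less_Suc_eq_le t_def)
  have t0: "t 0 = 0"
  proof -
    obtain m where "m \<le> R" "t m = 0" using idx[of 0] by auto
    then show ?thesis using less[of 0 m] ge0[of 0] by (cases m) auto
  qed
  have cake: "t m = (\<Sum>r<R. if r < m then t (Suc r) - t r else 0)" if "m \<le> R" for m
  proof -
    have "(\<Sum>r<R. if r < m then t (Suc r) - t r else 0) = (\<Sum>r<m. t (Suc r) - t r)"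
      using that by (intro sum.mono_neutral_cong_right) auto
    then show ?thesis by (simp add: sum_lessThan_telescope t0)
  qed
  have cut: "t r < t m \<longleftrightarrow> r < m" if "r < R" "m \<le> R" for r m
    using less[of r m] less[of m r] that by (metis less_asym less_irrefl linorder_neqE_nat nat_less_le)
  show thesis
  proof (rule that[of R t])
    fix y assume "y \<in> A"
    then obtain m where m: "m \<le> R" "t m = \<bar>y\<bar>" using idx[of "\<bar>y\<bar>"] by auto
    show "y = (\<Sum>r<R. (t (Suc r) - t r) * sgn_cut (t r) y)"
    proof (cases "y \<ge> 0")
      case True
      have "(\<Sum>r<R. (t (Suc r) - t r) * sgn_cut (t r) y) = (\<Sum>r<R. if r < m then t (Suc r) - t r else 0)"
        using True m cut ge0 by (intro sum.cong) (auto simp: sgn_cut_def dest: less_imp_le)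
      then show ?thesis using cake[OF m(1)] m(2) True by simp
    next
      case False
      have "(\<Sum>r<R. (t (Suc r) - t r) * sgn_cut (t r) y) = (\<Sum>r<R. - (if r < m then t (Suc r) - t r else 0))"
      proof (rule sum.cong)
        fix r assume "r \<in> {..<R}"
        then show "(t (Suc r) - t r) * sgn_cut (t r) y = - (if r < m then t (Suc r) - t r else 0)"
          using False m cut[of r m] ge0[of r] by (auto simp: sgn_cut_def)
      qed simp
      also have "\<dots> = - t m" unfolding sum_negf cake[OF m(1), symmetric] ..
      finally show ?thesis using m(2) False by simp
    qed
  next
    fix r assume r: "r < R"
    then have "t r < t R" using less by simp
    then show "\<exists>y\<in>A. t r < \<bar>y\<bar>" using mem[of R] ge0[of r] r by auto
  next
    assume "R = 0"
    then show "A \<subseteq> {0}" using idx t0 by fastforce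
  qed (use ge0 less in auto)
qed

text \<open>A downward closed subset of \<open>{1..k}\<close> is some \<open>{1..c}\<close>, and
  \<open>c\<close> is its cardinality. This lets a count of weights serve as an index into the
  filtration.\<close>

lemma initial_segment_card:
  assumes "\<And>i j. P j \<Longrightarrow> i \<le> j \<Longrightarrow> 1 \<le> i \<Longrightarrow> j \<le> k \<Longrightarrow> P i"
  shows "i \<in> {1..k} \<Longrightarrow> i \<le> card {j\<in>{1..k}. P j} \<longleftrightarrow> P i" "card {j\<in>{1..k}. P j} \<le> k"
proof -
  obtain c where eq: "{j\<in>{1..k}. P j} = {1..c}"
  proof (cases "{j\<in>{1..k}. P j} = {}")
    case True
    then show thesis using that[of 0] by simp
  next
    case False
    have fin: "finite {j\<in>{1..k}. P j}" by simp
    define m where "m = Max {j\<in>{1..k}. P j}"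
    have m: "m \<in> {j\<in>{1..k}. P j}" unfolding m_def using Max_in[OF fin False] .
    have "{j\<in>{1..k}. P j} = {1..m}"
    proof (intro equalityI subsetI)
      fix i assume "i \<in> {j\<in>{1..k}. P j}"
      then show "i \<in> {1..m}" using Max_ge[OF fin] by (auto simp: m_def)
    next
      fix i assume "i \<in> {1..m}"
      then show "i \<in> {j\<in>{1..k}. P j}" using m assms[of m i] by auto
    qed
    then show thesis by (rule that)
  qed
  show "i \<le> card {j\<in>{1..k}. P j} \<longleftrightarrow> P i" if "i \<in> {1..k}"
  proof -
    have "i \<in> {j\<in>{1..k}. P j} \<longleftrightarrow> i \<in> {1..c}" by (simp only: eq)
    then have "P i \<longleftrightarrow> i \<le> c" using that by simp
    then show ?thesis unfolding eq by simp
  qed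
  have "card {j\<in>{1..k}. P j} \<le> card {1..k}"
    by (rule card_mono) auto
  then show "card {j\<in>{1..k}. P j} \<le> k" by simp
qed

text \<open>This and \<open>cut_up\<close> are the indices p(t) and q(t) of the overview. The
  extreme values 0 and \<open>k\<close> do occur and then pick out the zero bundle and the whole
  bundle.\<close>

definition cut_low :: "nat \<Rightarrow> (nat \<Rightarrow> real) \<Rightarrow> real \<Rightarrow> nat" where
  "cut_low k l t = card {j\<in>{1..k}. l j < - t}"

definition cut_up :: "nat \<Rightarrow> (nat \<Rightarrow> real) \<Rightarrow> real \<Rightarrow> nat" where
  "cut_up k l t = card {j\<in>{1..k}. l j \<le> t}"

lemma cut_low_iff: "strict_mono_on {1..k} l \<Longrightarrow> i \<in> {1..k} \<Longrightarrow> i \<le> cut_low k l t \<longleftrightarrow> l i < - t"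
  and cut_up_iff: "strict_mono_on {1..k} l \<Longrightarrow> i \<in> {1..k} \<Longrightarrow> i \<le> cut_up k l t \<longleftrightarrow> l i \<le> t"
  and cut_low_le: "strict_mono_on {1..k} l \<Longrightarrow> cut_low k l t \<le> k"
  and cut_up_le: "strict_mono_on {1..k} l \<Longrightarrow> cut_up k l t \<le> k"
proof -
  assume l: "strict_mono_on {1..k} l"
  have mono: "l i \<le> l j" if "1 \<le> i" "i \<le> j" "j \<le> k" for i j
    using strict_mono_onD[OF l, of i j] that by (cases "i = j") auto
  show "i \<in> {1..k} \<Longrightarrow> i \<le> cut_low k l t \<longleftrightarrow> l i < - t" "cut_low k l t \<le> k"
    unfolding cut_low_def by (rule initial_segment_card; use mono in force)+
  show "i \<in> {1..k} \<Longrightarrow> i \<le> cut_up k l t \<longleftrightarrow> l i \<le> t" "cut_up k l t \<le> k"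
    unfolding cut_up_def by (rule initial_segment_card; use mono in force)+
qed

lemma cut_low_le_up:
  assumes "0 \<le> t" shows "cut_low k l t \<le> cut_up k l t"
  unfolding cut_low_def cut_up_def by (rule card_mono) (use assms in auto)

text \<open>At a level \<open>t\<close>, the value \<open>sgn_cut t (l j)\<close> is 1 minus the
  indicator of \<open>j \<le> cut_up k l t\<close> minus the indicator of
  \<open>j \<le> cut_low k l t\<close>, and each of the three sums telescopes.\<close>

lemma sum_sgn_cut:
  fixes D :: "nat \<Rightarrow> real"
  assumes l: "strict_mono_on {1..k} l" and D0: "D 0 = 0" and t: "0 \<le> t"
  shows "(\<Sum>j=1..k. sgn_cut t (l j) * (D j - D (j - 1))) = D k - D (cut_up k l t) - D (cut_low k l t)"
proof -
  have tele: "(\<Sum>j\<in>{1..k}. if j \<le> m then D j - D (j - 1) else 0) = D m" if "m \<le> k" for m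
  proof -
    have "(\<Sum>j\<in>{1..k}. if j \<le> m then D j - D (j - 1) else 0) = (\<Sum>j\<in>{1..m}. D j - D (j - 1))"
      using that by (intro sum.mono_neutral_cong_right) auto
    also have "\<dots> = D m"
      by (induct m) (simp_all add: D0)
    finally show ?thesis .
  qed
  have "(\<Sum>j=1..k. sgn_cut t (l j) * (D j - D (j - 1))) =
      (\<Sum>j=1..k. (if j \<le> k then D j - D (j - 1) else 0) - (if j \<le> cut_up k l t then D j - D (j - 1) else 0)
        - (if j \<le> cut_low k l t then D j - D (j - 1) else 0))"
    using t by (intro sum.cong) (auto simp: cut_up_iff[OF l] cut_low_iff[OF l] sgn_cut_def)
  then show ?thesis
    by (simp only: sum_subtractf tele cut_low_le[OF l] cut_up_le[OF l] order_refl)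
qed

lemma abel_summation:
  fixes D l :: "nat \<Rightarrow> real"
  assumes "k \<ge> 1" "D 0 = 0"
  shows "l k * D k + (\<Sum>j = 1..<k. (l j - l (j + 1)) * D j) = (\<Sum>j=1..k. l j * (D j - D (j - 1)))"
  using assms(1)
proof (induct k rule: dec_induct)
  case base then show ?case by (simp add: assms(2))
next
  case (step m) then show ?case by (simp add: algebra_simps)
qed


section \<open>Two-step filtrations and weighted filtrations\<close>

lemma in_H0_sub_bundle: "s \<in> H0 (sub_bundle E W) \<longleftrightarrow> s \<in> H0 E \<and> (\<forall>x. s x \<in> W x)"
  by (simp add: H0_def sub_bundle_def)

lemma sub_sum_mono:
  "(\<And>W. W \<in> \<W> \<Longrightarrow> W x \<subseteq> sub_sum E \<W>' x) \<Longrightarrow> sub_sum E \<W> x \<subseteq> sub_sum E \<W>' x"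
  unfolding sub_sum_def by (rule cspan_subset_cspan) blast

lemma subset_sub_sum: "W \<in> \<W> \<Longrightarrow> A \<subseteq> W x \<Longrightarrow> A \<subseteq> sub_sum E \<W> x"
  unfolding sub_sum_def using cspan_base[of _ "\<Union>W\<in>\<W>. W x"] by blast

lemma fibre_L_sym2: "fibre (L_sym2 X L V) x = sym2_dual (fibre L x) (dual_space (fibre V x))"
  by (simp add: L_sym2_def L_sym2_dual_def dual_bundle_def)

lemma fibre_L_sym2_dual: "fibre (L_sym2_dual L V) x = sym2_dual (fibre L x) (fibre V x)"
  by (simp add: L_sym2_dual_def)

lemma L_tensor_S_mono: "A x \<subseteq> A' x \<Longrightarrow> B x \<subseteq> B' x \<Longrightarrow> L_tensor_S L V A B x \<subseteq> L_tensor_S L V A' B' x"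
  unfolding L_tensor_S_def evals_def by (intro tensor_S_mono image_mono)

lemma L_tensor_S_dual_mono: "A x \<subseteq> A' x \<Longrightarrow> B x \<subseteq> B' x \<Longrightarrow> L_tensor_S_dual L V A B x \<subseteq> L_tensor_S_dual L V A' B' x"
  unfolding L_tensor_S_dual_def by (intro tensor_S_mono)

lemma L_tensor_S_commute: "L_tensor_S L V A B = L_tensor_S L V B A"
  unfolding L_tensor_S_def by (intro ext tensor_S_commute)

lemma L_tensor_S_dual_commute: "L_tensor_S_dual L V A B = L_tensor_S_dual L V B A"
  unfolding L_tensor_S_dual_def by (intro ext tensor_S_commute)

lemma perp_antimono: "A x \<subseteq> B x \<Longrightarrow> perp_sub V B x \<subseteq> perp_sub V A x"
  by (auto simp: perp_sub_def perp_def)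

text \<open>Flags with possible repetitions. The splitting arguments work at this generality,
  because the flag given by \<open>V1\<close> and \<open>V2\<close> may repeat members.\<close>

definition weak_filtration :: "('x::t2_space, 'v) vbundle \<Rightarrow> nat \<Rightarrow> (nat \<Rightarrow> 'x \<Rightarrow> 'v set) \<Rightarrow> bool" where
  "weak_filtration V k F \<longleftrightarrow> (\<forall>j\<le>k. subbundle V (F j)) \<and> F 0 = zero_sub V \<and> F k = full_sub V \<and>
     (\<forall>j<k. \<forall>x. F j x \<subseteq> F (Suc j) x)"

lemma filtration_weak: "filtration V k F \<Longrightarrow> weak_filtration V k F"
  by (simp add: filtration_def weak_filtration_def)

lemma weak_filtration_mono:
  assumes "weak_filtration V k F" "i \<le> j" "j \<le> k" shows "F i x \<subseteq> F j x"
  using assms(2,3)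
proof (induct j rule: dec_induct)
  case (step m)
  then have "F m x \<subseteq> F (Suc m) x" using assms(1) by (simp add: weak_filtration_def)
  then show ?case using step by simp
qed simp

lemmas filtration_mono = weak_filtration_mono[OF filtration_weak]

lemma filtration_neq:
  assumes F: "filtration V k F" "i < j" "j \<le> k" shows "F i \<noteq> F j"
proof
  assume eq: "F i = F j"
  have "F i x \<subseteq> F (Suc i) x" "F (Suc i) x \<subseteq> F j x" for x
    using filtration_mono[OF F(1)] F(2,3) by simp_all
  then have "F (Suc i) = F i" using eq by (intro ext equalityI) auto
  moreover have "i < k" using F by simp
  ultimately show False using F(1) unfolding filtration_def by metis
qed

section \<open>Higgs pairs, the degree excess, and the extreme members of a flag\<close>

locale higgs = hol_vb X n V
  for X :: "'x::t2_space atlas" and n :: nat and V :: "('x, 'v) vbundle" +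
  fixes L :: "('x, 'l) vbundle"
    and \<beta> :: "'x \<Rightarrow> ('v \<Rightarrow> complex) \<Rightarrow> ('v \<Rightarrow> complex) \<Rightarrow> 'l"
    and \<gamma> :: "'x \<Rightarrow> 'v \<Rightarrow> 'v \<Rightarrow> 'l"
    and \<alpha> :: real
  assumes line: "hol_bundle X 1 L"
    and \<beta>: "\<beta> \<in> H0 (L_sym2 X L V)" and \<gamma>: "\<gamma> \<in> H0 (L_sym2_dual L V)"
begin

lemma cmod_line: "cmod (fibre L x)"
  using line by (simp add: hol_bundle_def cmod_def)

lemma cmod_dual: "cmod (dual_space (fibre V x))"
  by (rule cmod_dual_space[OF cmod_fibre])

lemma \<beta>_carrier: "\<beta> x \<in> carrier (sym2_dual (fibre L x) (dual_space (fibre V x)))"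
  using \<beta> by (simp add: H0_def L_sym2_def L_sym2_dual_def dual_bundle_def del: sym2_dual_simps)

lemma \<gamma>_carrier: "\<gamma> x \<in> carrier (sym2_dual (fibre L x) (fibre V x))"
  using \<gamma> by (simp add: H0_def L_sym2_dual_def del: sym2_dual_simps)

text \<open>The difference of the two sides of the inequality in the theorem, called E in the
  overview; \<open>slope_deg\<close> is its D.\<close>

definition deg_excess :: "('x \<Rightarrow> 'v set) \<Rightarrow> ('x \<Rightarrow> 'v set) \<Rightarrow> real" where
  "deg_excess V1 V2 =
     real_of_int (bundle_degree X V - bundle_degree X (sub_bundle V V2) - bundle_degree X (sub_bundle V V1))
       - \<alpha> * (real n - real (bundle_rank (sub_bundle V V2)) - real (bundle_rank (sub_bundle V V1)))"

definition slope_deg :: "('x \<Rightarrow> 'v set) \<Rightarrow> real" where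
  "slope_deg W = real_of_int (bundle_degree X (sub_bundle V W)) - \<alpha> * real (bundle_rank (sub_bundle V W))"

lemma slope_deg_zero_sub: "slope_deg (zero_sub V) = 0"
  by (simp add: slope_deg_def bundle_rank_zero_sub bundle_degree_zero_sub)

lemma deg_excess_eq: "deg_excess V1 V2 = slope_deg (full_sub V) - slope_deg V2 - slope_deg V1"
  by (simp add: deg_excess_def slope_deg_def sub_bundle_full_sub bundle_rank algebra_simps)

lemma d_filt_eq:
  assumes "filtration V k F"
  shows "d_filt X V k F l \<alpha> = (\<Sum>j=1..k. l j * (slope_deg (F j) - slope_deg (F (j - 1))))"
proof -
  have "k \<ge> 1" "F 0 = zero_sub V" using assms by (auto simp: filtration_def)
  then show ?thesis
    using abel_summation[of k "\<lambda>j. slope_deg (F j)" l] slope_deg_zero_sub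
    by (simp add: d_filt_def Let_def slope_deg_def)
qed

text \<open>The factor \<open>full_sub (dual_bundle X V)\<close> in \<open>dagger\<close> thus
  arises in \<open>N_gamma\<close> at index 1, where the annihilator of \<open>F 0\<close>
  stands.\<close>

lemma perp_zero_sub: "perp_sub V (zero_sub V) = full_sub (dual_bundle X V)"
  using lin_on_zero[OF cmod_fibre cmod_complex_line]
  by (auto simp: perp_sub_def perp_def zero_sub_def full_sub_def dual_bundle_def lin_maps_iff fun_eq_iff)

lemma perp_full_sub: "perp_sub V (full_sub V) x = {\<zero>\<^bsub>dual_space (fibre V x)\<^esub>}"
proof -
  have "\<zero>\<^bsub>dual_space (fibre V x)\<^esub> \<in> carrier (dual_space (fibre V x))"
    by (auto simp: lin_maps_iff lin_on_def)
  then show ?thesis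
    by (auto simp: perp_sub_def perp_def full_sub_def lin_maps_iff extensional_def fun_eq_iff)
qed

lemma L_tensor_S_zero_sub:
  assumes "A x \<subseteq> carrier (fibre V x)"
  shows "L_tensor_S L V A (zero_sub V) x \<subseteq> sub_sum (L_sym2 X L V) \<W> x"
proof -
  have "\<xi> \<zero>\<^bsub>fibre V x\<^esub> = 0" if "\<xi> \<in> lin_maps (fibre V x) complex_line" for \<xi>
    using lin_on_zero[OF cmod_fibre cmod_complex_line, of x \<xi>] that by (auto simp: lin_maps_iff)
  then have "evals (fibre V x) (zero_sub V x) \<subseteq> {\<zero>\<^bsub>dual_space (dual_space (fibre V x))\<^esub>}"
    by (auto simp: evals_def zero_sub_def)
  then show ?thesis
    unfolding L_tensor_S_def sub_sum_def fibre_L_sym2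
    by (intro tensor_S_zero_subset cmod_dual cmod_line evals_carrier cmod_fibre assms)
qed

lemma L_tensor_S_dual_full_sub:
  assumes "A x \<subseteq> carrier (dual_space (fibre V x))"
  shows "L_tensor_S_dual L V A (perp_sub V (full_sub V)) x \<subseteq> sub_sum (L_sym2_dual L V) \<W> x"
  unfolding L_tensor_S_dual_def sub_sum_def fibre_L_sym2_dual perp_full_sub
  by (intro tensor_S_zero_subset cmod_line cmod_fibre assms order_refl)

lemma full_sub_carrier: "subbundle V W \<Longrightarrow> W x \<subseteq> full_sub V x"
  using subbundle_carrier by (simp add: full_sub_def)

section \<open>From weighted filtrations to two-step filtrations\<close>

lemma dagger_cut:
  assumes wf: "weighted_filtration V k F l" and N: "in_H0_N X L V \<beta> \<gamma> k F l" and t: "0 \<le> t"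
  shows "two_step V (F (cut_low k l t)) (F (cut_up k l t))"
    "dagger X L V \<beta> \<gamma> (F (cut_low k l t)) (F (cut_up k l t))"
proof -
  let ?p = "cut_low k l t" and ?q = "cut_up k l t"
  have F: "filtration V k F" and l: "strict_mono_on {1..k} l"
    using wf by (auto simp: weighted_filtration_def)
  have pq: "?p \<le> ?q" "?p \<le> k" "?q \<le> k"
    using cut_low_le_up[OF t] cut_low_le[OF l] cut_up_le[OF l] by auto
  have sub: "subbundle V (F j)" if "j \<le> k" for j using F that by (auto simp: filtration_def)
  show "two_step V (F ?p) (F ?q)"
    using sub pq filtration_mono[OF F pq(1,3)] by (simp add: two_step_def)
  have full: "F j x \<subseteq> full_sub V x" if "j \<le> k" for j x
    using full_sub_carrier[OF sub[OF that]] .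
  have dfull: "perp_sub V W x \<subseteq> full_sub (dual_bundle X V) x" for W x
    using perp_carrier[of "fibre V x" "W x"] by (simp add: perp_sub_def full_sub_def dual_bundle_def)
  have "L_tensor_S L V (F i) (F j) x \<subseteq>
      sub_sum (L_sym2 X L V) {L_tensor_S L V (F ?q) (F ?q), L_tensor_S L V (F ?p) (full_sub V)} x"
    if ij: "i \<in> {1..k}" "j \<in> {1..k}" "l i + l j \<le> 0" for i j x
  proof -
    \<comment> \<open>If one of the weights exceeds \<open>t\<close>, the other one is below
      \<open>- t\<close>.\<close>
    consider "l i \<le> t" "l j \<le> t" | "l i < - t" | "l j < - t" using ij(3) by linarith
    then show ?thesis
    proof cases
      case 1
      then have "i \<le> ?q" "j \<le> ?q" using ij cut_up_iff[OF l] by auto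
      then show ?thesis
        using filtration_mono[OF F] pq
        by (intro subset_sub_sum[of "L_tensor_S L V (F ?q) (F ?q)"] L_tensor_S_mono) auto
    next
      case 2
      then have "i \<le> ?p" using ij cut_low_iff[OF l] by auto
      then show ?thesis
        using filtration_mono[OF F] pq full ij
        by (intro subset_sub_sum[of "L_tensor_S L V (F ?p) (full_sub V)"] L_tensor_S_mono) auto
    next
      case 3
      then have "j \<le> ?p" using ij cut_low_iff[OF l] by auto
      then show ?thesis
        using filtration_mono[OF F] pq full ij
        by (subst L_tensor_S_commute, intro subset_sub_sum[of "L_tensor_S L V (F ?p) (full_sub V)"] L_tensor_S_mono) auto
    qed
  qed
  then have \<beta>': "N_beta X L V k F l x \<subseteq>
      sub_sum (L_sym2 X L V) {L_tensor_S L V (F ?q) (F ?q), L_tensor_S L V (F ?p) (full_sub V)} x" for x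
    unfolding N_beta_def by (intro sub_sum_mono) blast
  have "L_tensor_S_dual L V (perp_sub V (F (i - 1))) (perp_sub V (F (j - 1))) x \<subseteq>
      sub_sum (L_sym2_dual L V) {L_tensor_S_dual L V (perp_sub V (F ?p)) (perp_sub V (F ?p)),
        L_tensor_S_dual L V (perp_sub V (F ?q)) (full_sub (dual_bundle X V))} x"
    if ij: "i \<in> {1..k}" "j \<in> {1..k}" "l i + l j \<ge> 0" for i j x
  proof -
    \<comment> \<open>If one of the weights is below \<open>- t\<close>, the other one exceeds
      \<open>t\<close>.\<close>
    consider "l i \<ge> - t" "l j \<ge> - t" | "l i > t" | "l j > t" using ij(3) by linarith
    then show ?thesis
    proof cases
      case 1
      \<comment> \<open>Step \<open>i\<close> contributes the annihilator of
        \<open>F (i - 1)\<close>. The negated inequality says precisely that the cut index is at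
        most \<open>i - 1\<close>, and annihilators reverse inclusions.\<close>
      then have "\<not> i \<le> ?p" "\<not> j \<le> ?p" using ij cut_low_iff[OF l] by auto
      then show ?thesis
        using filtration_mono[OF F] ij
        by (intro subset_sub_sum[of "L_tensor_S_dual L V (perp_sub V (F ?p)) (perp_sub V (F ?p))"]
            L_tensor_S_dual_mono perp_antimono) auto
    next
      case 2
      then have "\<not> i \<le> ?q" using ij cut_up_iff[OF l] by auto
      then show ?thesis
        using filtration_mono[OF F] dfull ij
        by (intro subset_sub_sum[of "L_tensor_S_dual L V (perp_sub V (F ?q)) (full_sub (dual_bundle X V))"]
            L_tensor_S_dual_mono perp_antimono) auto
    next
      case 3
      then have "\<not> j \<le> ?q" using ij cut_up_iff[OF l] by auto
      then show ?thesis
        using filtration_mono[OF F] dfull ij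
        by (subst L_tensor_S_dual_commute, intro subset_sub_sum[of "L_tensor_S_dual L V (perp_sub V (F ?q)) (full_sub (dual_bundle X V))"]
            L_tensor_S_dual_mono perp_antimono) auto
    qed
  qed
  then have \<gamma>': "N_gamma L V k F l x \<subseteq>
      sub_sum (L_sym2_dual L V) {L_tensor_S_dual L V (perp_sub V (F ?p)) (perp_sub V (F ?p)),
        L_tensor_S_dual L V (perp_sub V (F ?q)) (full_sub (dual_bundle X V))} x" for x
    unfolding N_gamma_def by (intro sub_sum_mono) blast
  show "dagger X L V \<beta> \<gamma> (F ?p) (F ?q)"
    using N \<beta>' \<gamma>' unfolding dagger_def in_H0_N_def in_H0_sub_bundle by blast
qed

text \<open>The integral formula in finite form. Positivity of the coefficients and the absence of
  the excluded flag are what stability uses; the formula for the weights is kept because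
  polystability reassembles an endomorphism from the same levels.\<close>

lemma d_filt_layers:
  assumes wf: "weighted_filtration V k F l" and nt: "\<not> trivial_weighted k l"
  obtains R :: nat and t :: "nat \<Rightarrow> real" where "R > 0"
    "\<And>r. r < R \<Longrightarrow> 0 \<le> t r" "\<And>r. r < R \<Longrightarrow> t r < t (Suc r)"
    "\<And>r. r < R \<Longrightarrow> \<not> (F (cut_low k l (t r)) = zero_sub V \<and> F (cut_up k l (t r)) = full_sub V)"
    "\<And>j. j \<in> {1..k} \<Longrightarrow> l j = (\<Sum>r<R. (t (Suc r) - t r) * sgn_cut (t r) (l j))"
    "d_filt X V k F l \<alpha> = (\<Sum>r<R. (t (Suc r) - t r) * deg_excess (F (cut_low k l (t r))) (F (cut_up k l (t r))))"
proof -
  have F: "filtration V k F" and l: "strict_mono_on {1..k} l"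
    using wf by (auto simp: weighted_filtration_def)
  have k: "k \<ge> 1" "F 0 = zero_sub V" "F k = full_sub V" using F by (auto simp: filtration_def)
  obtain R t where Rt: "\<And>r. r < R \<Longrightarrow> 0 \<le> t r" "\<And>r. r < R \<Longrightarrow> t r < t (Suc r)"
    "\<And>r. r < R \<Longrightarrow> \<exists>y\<in>l ` {1..k}. t r < \<bar>y\<bar>"
    "\<And>y. y \<in> l ` {1..k} \<Longrightarrow> y = (\<Sum>r<R. (t (Suc r) - t r) * sgn_cut (t r) y)"
    "R = 0 \<Longrightarrow> l ` {1..k} \<subseteq> {0}"
    by (rule layer_cake[of "l ` {1..k}"], simp, rule that)
  \<comment> \<open>Without levels all weights are 0; being distinct, there is then only one, and
    the weighted filtration is trivial.\<close>
  have "R > 0"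
  proof (rule ccontr)
    assume "\<not> R > 0"
    then have z: "l j = 0" if "j \<in> {1..k}" for j using Rt(5) imageI[OF that, of l] by blast
    then have "k = 1"
      using k(1) strict_mono_onD[OF l, of 1 k] z[of 1] z[of k] by (cases "k = 1") auto
    then show False using nt z[of 1] by (simp add: trivial_weighted_def)
  qed
  moreover have "\<not> (F (cut_low k l (t r)) = zero_sub V \<and> F (cut_up k l (t r)) = full_sub V)" if r: "r < R" for r
  proof
    assume a: "F (cut_low k l (t r)) = zero_sub V \<and> F (cut_up k l (t r)) = full_sub V"
    then have "cut_low k l (t r) = 0"
      using filtration_neq[OF F, of 0 "cut_low k l (t r)"] k cut_low_le[OF l] by (metis gr0I)
    moreover have "cut_up k l (t r) = k"
      using a filtration_neq[OF F, of "cut_up k l (t r)" k] k cut_up_le[OF l] by (metis le_neq_implies_less order_refl)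
    \<comment> \<open>Step \<open>j\<close> has its weight outside \<open>[- t r, t r]\<close>, so
      it is either counted by \<open>cut_low\<close> or missed by \<open>cut_up\<close>.\<close>
    moreover obtain j where "j \<in> {1..k}" "t r < \<bar>l j\<bar>" using Rt(3)[OF r] by auto
    ultimately show False using cut_low_iff[OF l, of j "t r"] cut_up_iff[OF l, of j "t r"] by auto
  qed
  moreover have "d_filt X V k F l \<alpha> = (\<Sum>r<R. (t (Suc r) - t r) * deg_excess (F (cut_low k l (t r))) (F (cut_up k l (t r))))"
  proof -
    define D where "D = (\<lambda>j. slope_deg (F j))"
    have D0: "D 0 = 0" using k slope_deg_zero_sub by (simp add: D_def)
    have "d_filt X V k F l \<alpha> = (\<Sum>j=1..k. l j * (D j - D (j - 1)))"
      unfolding d_filt_eq[OF F] D_def ..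
    also have "\<dots> = (\<Sum>j=1..k. \<Sum>r<R. (t (Suc r) - t r) * (sgn_cut (t r) (l j) * (D j - D (j - 1))))"
    proof (rule sum.cong)
      fix j assume "j \<in> {1..k}"
      then have "l j = (\<Sum>r<R. (t (Suc r) - t r) * sgn_cut (t r) (l j))" using Rt(4)[of "l j"] by simp
      then have "l j * (D j - D (j - 1)) = (\<Sum>r<R. (t (Suc r) - t r) * sgn_cut (t r) (l j)) * (D j - D (j - 1))" by simp
      then show "l j * (D j - D (j - 1)) = (\<Sum>r<R. (t (Suc r) - t r) * (sgn_cut (t r) (l j) * (D j - D (j - 1))))"
        by (simp add: sum_distrib_right mult.assoc)
    qed simp
    also have "\<dots> = (\<Sum>r<R. \<Sum>j=1..k. (t (Suc r) - t r) * (sgn_cut (t r) (l j) * (D j - D (j - 1))))"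
      by (rule sum.swap)
    also have "\<dots> = (\<Sum>r<R. (t (Suc r) - t r) * (D k - D (cut_up k l (t r)) - D (cut_low k l (t r))))"
      using Rt(1) by (intro sum.cong) (simp_all only: sum_distrib_left[symmetric] sum_sgn_cut[where D = D, OF l D0] lessThan_iff)
    finally show ?thesis
      by (simp add: deg_excess_eq D_def k)
  qed
  ultimately show thesis using that[of R t] Rt(1,2) Rt(4)[OF imageI] by blast
qed

lemma alpha_semistableI:
  assumes "\<And>V1 V2. two_step V V1 V2 \<Longrightarrow> dagger X L V \<beta> \<gamma> V1 V2 \<Longrightarrow> deg_excess V1 V2 \<ge> 0"
  shows "alpha_semistable X L V \<beta> \<gamma> \<alpha>"
  unfolding alpha_semistable_def
proof clarify
  fix k F l assume wf: "weighted_filtration V k F l" and nt: "\<not> trivial_weighted k l" and N: "in_H0_N X L V \<beta> \<gamma> k F l"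
  obtain R t where Rt: "\<And>r. r < R \<Longrightarrow> 0 \<le> t r" "\<And>r. r < R \<Longrightarrow> t r < t (Suc r)"
    "d_filt X V k F l \<alpha> = (\<Sum>r<R. (t (Suc r) - t r) * deg_excess (F (cut_low k l (t r))) (F (cut_up k l (t r))))"
    by (rule d_filt_layers[OF wf nt], rule that)
  show "d_filt X V k F l \<alpha> \<ge> 0"
    unfolding Rt(3)
  proof (rule sum_nonneg)
    fix r assume "r \<in> {..<R}"
    then show "(t (Suc r) - t r) * deg_excess (F (cut_low k l (t r))) (F (cut_up k l (t r))) \<ge> 0"
      using Rt(1,2)[of r] assms dagger_cut[OF wf N] by (intro mult_nonneg_nonneg) auto
  qed
qed

text \<open>Strict inequality survives the summation since there is at least one level and every
  level yields a flag other than the excluded one.\<close>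

lemma alpha_stableI:
  assumes "\<And>V1 V2. two_step V V1 V2 \<Longrightarrow> dagger X L V \<beta> \<gamma> V1 V2 \<Longrightarrow> \<not> (V1 = zero_sub V \<and> V2 = full_sub V) \<Longrightarrow>
    deg_excess V1 V2 > 0"
  shows "alpha_stable X L V \<beta> \<gamma> \<alpha>"
  unfolding alpha_stable_def
proof clarify
  fix k F l assume wf: "weighted_filtration V k F l" and nt: "\<not> trivial_weighted k l" and N: "in_H0_N X L V \<beta> \<gamma> k F l"
  obtain R t where Rt: "R > 0"
    "\<And>r. r < R \<Longrightarrow> 0 \<le> t r" "\<And>r. r < R \<Longrightarrow> t r < t (Suc r)"
    "\<And>r. r < R \<Longrightarrow> \<not> (F (cut_low k l (t r)) = zero_sub V \<and> F (cut_up k l (t r)) = full_sub V)"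
    "d_filt X V k F l \<alpha> = (\<Sum>r<R. (t (Suc r) - t r) * deg_excess (F (cut_low k l (t r))) (F (cut_up k l (t r))))"
    by (rule d_filt_layers[OF wf nt], rule that)
  show "d_filt X V k F l \<alpha> > 0"
    unfolding Rt(5)
  proof (rule sum_pos)
    fix r assume "r \<in> {..<R}"
    then show "(t (Suc r) - t r) * deg_excess (F (cut_low k l (t r))) (F (cut_up k l (t r))) > 0"
      using Rt assms dagger_cut[OF wf N] by (intro mult_pos_pos) auto
  qed (use Rt(1) in auto)
qed

section \<open>From two-step filtrations to weighted filtrations\<close>

lemma two_step_filt_simps:
  "two_step_filt V V1 V2 0 = zero_sub V" "two_step_filt V V1 V2 (Suc 0) = V1" "two_step_filt V V1 V2 1 = V1"
  "two_step_filt V V1 V2 2 = V2" "two_step_filt V V1 V2 3 = full_sub V"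
  by (simp_all add: two_step_filt_def)

lemma two_step_filt_subbundle: "two_step V V1 V2 \<Longrightarrow> subbundle V (two_step_filt V V1 V2 i)"
  by (auto simp: two_step_filt_def two_step_def subbundle_zero_sub subbundle_full_sub)

lemma two_step_filt_mono: "two_step V V1 V2 \<Longrightarrow> two_step_filt V V1 V2 (i - 1) x \<subseteq> two_step_filt V V1 V2 i x"
  using subbundle_carrier[of _ x] subbundle_zero_mem[of _ x]
  by (auto simp: two_step_filt_def two_step_def zero_sub_def full_sub_def)

lemma two_step_filt_weak: "two_step V V1 V2 \<Longrightarrow> weak_filtration V 3 (two_step_filt V V1 V2)"
  using two_step_filt_subbundle two_step_filt_mono[of V1 V2 "Suc _"]
  by (simp add: weak_filtration_def two_step_filt_simps)

end

text \<open>The filtration \<open>0 \<subseteq> V\<^sub>1 \<subseteq> V\<^sub>2 \<subseteq> V\<close> with weights \<open>-1, 0, 1\<close>, after removal of the equalities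
  among its members; \<open>j\<close> records the original index of the steps that remain.\<close>

definition (in higgs) reduced_two_step ::
  "('x \<Rightarrow> 'v set) \<Rightarrow> ('x \<Rightarrow> 'v set) \<Rightarrow> nat \<Rightarrow> (nat \<Rightarrow> 'x \<Rightarrow> 'v set) \<Rightarrow> (nat \<Rightarrow> real) \<Rightarrow> (nat \<Rightarrow> nat) \<Rightarrow> bool" where
  "reduced_two_step V1 V2 k F l j \<longleftrightarrow>
     weighted_filtration V k F l \<and> \<not> trivial_weighted k l \<and>
     d_filt X V k F l \<alpha> = deg_excess V1 V2 \<and>
     (\<forall>m\<in>{1..k}. j m \<in> {1..3} \<and> l m = real (j m) - 2 \<and> F m = two_step_filt V V1 V2 (j m) \<and>
        F (m - 1) = two_step_filt V V1 V2 (j m - 1)) \<and>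
     (\<forall>i\<le>3. \<exists>M\<le>k. two_step_filt V V1 V2 i = F M \<and> (\<forall>m\<in>{1..k}. m \<le> M \<longleftrightarrow> j m \<le> i))"

context higgs
begin

text \<open>Dropping a repeated step leaves \<open>d_filt\<close> unchanged, since its weight is
  multiplied by a difference of equal slopes. The remaining weights stay strictly increasing, and
  when a single step is left its weight is -1 or 1, so the result is not trivial.\<close>

lemma reduced_two_step_exists:
  assumes ts: "two_step V V1 V2" and nt: "\<not> (V1 = zero_sub V \<and> V2 = full_sub V)"
  obtains k F l j where "reduced_two_step V1 V2 k F l j"
proof -
  let ?W = "two_step_filt V V1 V2"
  have subs: "subbundle V V1" "subbundle V V2" "subbundle V (zero_sub V)" "subbundle V (full_sub V)"
    using ts subbundle_zero_sub subbundle_full_sub by (auto simp: two_step_def)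
  have le: "zero_sub V x \<subseteq> V1 x" "V1 x \<subseteq> V2 x" "V2 x \<subseteq> full_sub V x" "zero_sub V x \<subseteq> V2 x" "V1 x \<subseteq> full_sub V x"
    "zero_sub V x \<subseteq> full_sub V x" for x
    using two_step_filt_mono[OF ts, of 1 x] two_step_filt_mono[OF ts, of 2 x] two_step_filt_mono[OF ts, of 3 x]
    by (auto simp: two_step_filt_def)
  \<comment> \<open>Small ranges are listed explicitly so that every bounded quantifier below is
    settled by enumeration.\<close>
  have upto: "{..Suc 0} = {0, 1}" "(\<forall>m. m \<le> Suc 0 \<longrightarrow> P m) \<longleftrightarrow> P 0 \<and> P 1" "{Suc 0..2} = {1, 2}" "{Suc 0..3} = {1, 2, 3}" "{1..1::nat} = {1}" "{1..2::nat} = {1, 2}" "{1..3::nat} = {1, 2, 3}"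
    "{..1::nat} = {0, 1}" "{..2::nat} = {0, 1, 2}" "{..3::nat} = {0, 1, 2, 3}"
    "{..<1::nat} = {0}" "{..<2::nat} = {0, 1}" "{..<3::nat} = {0, 1, 2}" for P
    by (auto simp: le_Suc_eq)
  have all: "(\<forall>m\<le>b. P m) \<longleftrightarrow> (\<forall>m\<in>{..b}. P m)" "(\<forall>m<b. P m) \<longleftrightarrow> (\<forall>m\<in>{..<b}. P m)"
    "(\<exists>m\<le>b. P m) \<longleftrightarrow> (\<exists>m\<in>{..b}. P m)" for b :: nat and P
    by auto
  \<comment> \<open>The list \<open>js\<close> holds the original indices of the steps that are
    kept. The 0 in front stands for the zero bundle and makes the steps start at position 1.\<close>
  define FF where "FF = (\<lambda>js m. ?W ((0 # js) ! m))"
  define ll where "ll = (\<lambda>js m. real ((0 # js) ! m) - 2)"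
  define jj where "jj = (\<lambda>js m. (0 # js :: nat list) ! m)"
  have fin: "reduced_two_step V1 V2 k (FF js) (ll js) (jj js)"
    if "filtration V k (FF js)" "strict_mono_on {1..k} (ll js)" "\<not> trivial_weighted k (ll js)"
      "(\<Sum>j=1..k. ll js j * (slope_deg (FF js j) - slope_deg (FF js (j - 1)))) = deg_excess V1 V2"
      "\<forall>m\<in>{1..k}. jj js m \<in> {1..3} \<and> ll js m = real (jj js m) - 2 \<and> FF js m = ?W (jj js m) \<and>
        FF js (m - 1) = ?W (jj js m - 1)"
      "\<forall>i\<le>3. \<exists>M\<le>k. ?W i = FF js M \<and> (\<forall>m\<in>{1..k}. m \<le> M \<longleftrightarrow> jj js m \<le> i)"
    for k js
    unfolding reduced_two_step_def weighted_filtration_def using that d_filt_eq[OF that(1)] by simp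
  note defs = FF_def ll_def jj_def filtration_def two_step_filt_simps subs le upto all strict_mono_on_def
    trivial_weighted_def deg_excess_eq slope_deg_zero_sub
  \<comment> \<open>Three inclusions admit eight patterns of equality; \<open>nt\<close> excludes
    the two in which both outer inclusions are equalities.\<close>
  consider "zero_sub V \<noteq> V1" "V1 \<noteq> V2" "V2 \<noteq> full_sub V"
    | "zero_sub V \<noteq> V1" "V1 \<noteq> V2" "V2 = full_sub V"
    | "zero_sub V \<noteq> V1" "V1 = V2" "V2 \<noteq> full_sub V"
    | "zero_sub V = V1" "V1 \<noteq> V2" "V2 \<noteq> full_sub V"
    | "zero_sub V \<noteq> V1" "V1 = V2" "V2 = full_sub V"
    | "zero_sub V = V1" "V1 = V2" "V2 \<noteq> full_sub V"
    using nt by (cases "zero_sub V = V1"; cases "V1 = V2"; cases "V2 = full_sub V") auto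
  then have "\<exists>k F l j. reduced_two_step V1 V2 k F l j"
  proof cases
    case 1
    show ?thesis by (rule exI, rule exI, rule exI, rule exI, rule fin[of 3 "[1,2,3]"]) (use 1 in \<open>auto simp: defs\<close>)
  next
    case 2
    show ?thesis by (rule exI, rule exI, rule exI, rule exI, rule fin[of 2 "[1,2]"]) (use 2 in \<open>auto simp: defs\<close>)
  next
    case 3
    show ?thesis by (rule exI, rule exI, rule exI, rule exI, rule fin[of 2 "[1,3]"]) (use 3 in \<open>auto simp: defs\<close>)
  next
    case 4
    show ?thesis by (rule exI, rule exI, rule exI, rule exI, rule fin[of 2 "[2,3]"]) (use 4 in \<open>auto simp: defs\<close>)
  next
    case 5
    show ?thesis by (rule exI, rule exI, rule exI, rule exI, rule fin[of 1 "[1]"]) (use 5 in \<open>auto simp: defs\<close>)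
  next
    case 6
    show ?thesis by (rule exI, rule exI, rule exI, rule exI, rule fin[of 1 "[3]"]) (use 6 in \<open>auto simp: defs\<close>)
  qed
  then obtain k F l j where "reduced_two_step V1 V2 k F l j" by blast
  then show thesis by (rule that)
qed

text \<open>Each of the four tensor products in \<open>dagger\<close> is matched with one admissible
  pair of indices of the reduced filtration, or has a vanishing factor.\<close>

lemma reduced_in_H0_N:
  assumes ts: "two_step V V1 V2" and dg: "dagger X L V \<beta> \<gamma> V1 V2" and red: "reduced_two_step V1 V2 k F l j"
  shows "in_H0_N X L V \<beta> \<gamma> k F l"
proof -
  let ?W = "two_step_filt V V1 V2"
  have wf: "weighted_filtration V k F l" using red by (simp add: reduced_two_step_def)
  then have F: "filtration V k F" by (simp add: weighted_filtration_def)
  have k: "k \<ge> 1" "F 0 = zero_sub V" "F k = full_sub V" using F by (auto simp: filtration_def)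
  have j: "j m \<in> {1..3}" "l m = real (j m) - 2" "F m = ?W (j m)" "F (m - 1) = ?W (j m - 1)"
    if "m \<in> {1..k}" for m
    using red that by (simp_all add: reduced_two_step_def)
  have piv: "\<exists>M\<le>k. ?W i = F M \<and> (\<forall>m\<in>{1..k}. m \<le> M \<longleftrightarrow> j m \<le> i)" if "i \<le> 3" for i
    using red that by (simp add: reduced_two_step_def)
  have sub: "subbundle V V1" "subbundle V V2" using ts by (auto simp: two_step_def)
  \<comment> \<open>\<open>M1\<close> and \<open>M2\<close> are the positions of \<open>V1\<close>
    and \<open>V2\<close> in the reduced filtration: weights up to \<open>M1\<close> are -1, those
    between \<open>M1\<close> and \<open>M2\<close> are 0, and those beyond \<open>M2\<close> are
    1.\<close>
  obtain M1 where M1: "M1 \<le> k" "V1 = F M1" "\<And>m. m \<in> {1..k} \<Longrightarrow> m \<le> M1 \<longleftrightarrow> j m \<le> 1"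
    using piv[of 1] by (auto simp: two_step_filt_simps)
  obtain M2 where M2: "M2 \<le> k" "V2 = F M2" "\<And>m. m \<in> {1..k} \<Longrightarrow> m \<le> M2 \<longleftrightarrow> j m \<le> 2"
    using piv[of 2] by (auto simp: two_step_filt_simps)
  \<comment> \<open>Bounds on the extreme weights, for the products with all of V or all of its
    dual: these use the indices \<open>k\<close> and 1.\<close>
  have lk: "l k \<le> 1" and l1: "l 1 \<ge> -1"
    using j(1,2)[of k] j(1,2)[of 1] k(1) by auto
  let ?\<B> = "{L_tensor_S L V (F i) (F j) |i j. i \<in> {1..k} \<and> j \<in> {1..k} \<and> l i + l j \<le> 0}"
  let ?\<G> = "{L_tensor_S_dual L V (perp_sub V (F (i - 1))) (perp_sub V (F (j - 1))) |i j.
        i \<in> {1..k} \<and> j \<in> {1..k} \<and> l i + l j \<ge> 0}"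
  have b1: "L_tensor_S L V V2 V2 x \<subseteq> sub_sum (L_sym2 X L V) ?\<B> x" for x
  proof (cases "M2 = 0")
    \<comment> \<open>Position 0 carries no weight; here \<open>V2\<close> is the zero bundle and
      the product vanishes.\<close>
    case True
    then show ?thesis
      using M2(2) k(2) L_tensor_S_zero_sub[of "zero_sub V" x ?\<B>] subbundle_carrier[OF subbundle_zero_sub] by simp
  next
    case False
    then have m: "M2 \<in> {1..k}" using M2(1) by simp
    then have "l M2 \<le> 0" using M2(3)[OF m] j(2)[OF m] by simp
    then show ?thesis
      unfolding M2(2) using m by (intro subset_sub_sum[of "L_tensor_S L V (F M2) (F M2)"]) force+
  qed
  have b2: "L_tensor_S L V V1 (full_sub V) x \<subseteq> sub_sum (L_sym2 X L V) ?\<B> x" for x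
  proof (cases "M1 = 0")
    case True
    then show ?thesis
      unfolding L_tensor_S_commute[of L V V1]
      using M1(2) k(2) L_tensor_S_zero_sub[of "full_sub V" x ?\<B>] subbundle_carrier[OF subbundle_full_sub] by simp
  next
    case False
    then have m: "M1 \<in> {1..k}" using M1(1) by simp
    then have "l M1 \<le> -1" using M1(3)[OF m] j(2)[OF m] by simp
    then show ?thesis
      unfolding M1(2) k(3)[symmetric] using lk k(1) m
      by (intro subset_sub_sum[of "L_tensor_S L V (F M1) (F k)"]) force+
  qed
  have perp_sub_carrier: "perp_sub V W x \<subseteq> carrier (dual_space (fibre V x))" for W x
    using perp_carrier[of "fibre V x" "W x"] by (simp add: perp_sub_def)
  have g1: "L_tensor_S_dual L V (perp_sub V V1) (perp_sub V V1) x \<subseteq> sub_sum (L_sym2_dual L V) ?\<G> x" for x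
  proof (cases "M1 = k")
    case True
    then show ?thesis
      using M1(2) k(3) L_tensor_S_dual_full_sub[of "perp_sub V (full_sub V)" x ?\<G>, OF perp_sub_carrier] by simp
  next
    case False
    then have m: "Suc M1 \<in> {1..k}" using M1(1) by simp
    then have l0: "l (Suc M1) \<ge> 0" using M1(3)[OF m] j(2)[OF m] by simp
    \<comment> \<open>The annihilator of \<open>F M1\<close> belongs to step \<open>M1 + 1\<close>,
      whose weight is the first one that is not -1.\<close>
    have "V1 = F (Suc M1 - 1)" using M1 by simp
    then show ?thesis
      using m l0 by (intro subset_sub_sum[of "L_tensor_S_dual L V (perp_sub V (F (Suc M1 - 1))) (perp_sub V (F (Suc M1 - 1)))"]) force+
  qed
  have g2: "L_tensor_S_dual L V (perp_sub V V2) (full_sub (dual_bundle X V)) x \<subseteq> sub_sum (L_sym2_dual L V) ?\<G> x" for x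
  proof (cases "M2 = k")
    case True
    have "full_sub (dual_bundle X V) x \<subseteq> carrier (dual_space (fibre V x))"
      by (simp add: full_sub_def dual_bundle_def)
    then show ?thesis
      unfolding L_tensor_S_dual_commute[of L V "perp_sub V V2"]
      using True M2(2) k(3) L_tensor_S_dual_full_sub[of "full_sub (dual_bundle X V)" x ?\<G>] by simp
  next
    case False
    then have m: "Suc M2 \<in> {1..k}" using M2(1) by simp
    then have l0: "l (Suc M2) \<ge> 1" using M2(3)[OF m] j(2)[OF m] by simp
    have "V2 = F (Suc M2 - 1)" "full_sub (dual_bundle X V) = perp_sub V (F (1 - 1))"
      using M2 k(2) perp_zero_sub by simp_all
    then show ?thesis
      using m l0 l1 k(1) by (intro subset_sub_sum[of "L_tensor_S_dual L V (perp_sub V (F (Suc M2 - 1))) (perp_sub V (F (1 - 1)))"]) force+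
  qed
  have "sub_sum (L_sym2 X L V) {L_tensor_S L V V2 V2, L_tensor_S L V V1 (full_sub V)} x \<subseteq> N_beta X L V k F l x" for x
    unfolding N_beta_def using b1 b2 by (intro sub_sum_mono) blast
  moreover have "sub_sum (L_sym2_dual L V) {L_tensor_S_dual L V (perp_sub V V1) (perp_sub V V1),
      L_tensor_S_dual L V (perp_sub V V2) (full_sub (dual_bundle X V))} x \<subseteq> N_gamma L V k F l x" for x
    unfolding N_gamma_def using g1 g2 by (intro sub_sum_mono) blast
  ultimately show ?thesis
    using dg unfolding dagger_def in_H0_N_def in_H0_sub_bundle by blast
qed

lemma alpha_semistableD:
  assumes ss: "alpha_semistable X L V \<beta> \<gamma> \<alpha>" and ts: "two_step V V1 V2" and dg: "dagger X L V \<beta> \<gamma> V1 V2"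
  shows "deg_excess V1 V2 \<ge> 0"
proof (cases "V1 = zero_sub V \<and> V2 = full_sub V")
  case True
  then show ?thesis using deg_excess_eq slope_deg_zero_sub by simp
next
  case False
  obtain k F l j where red: "reduced_two_step V1 V2 k F l j"
    by (rule reduced_two_step_exists[OF ts False])
  then show ?thesis
    using ss reduced_in_H0_N[OF ts dg red] unfolding alpha_semistable_def reduced_two_step_def by metis
qed

lemma alpha_stableD:
  assumes st: "alpha_stable X L V \<beta> \<gamma> \<alpha>" and ts: "two_step V V1 V2" and dg: "dagger X L V \<beta> \<gamma> V1 V2"
    and nt: "\<not> (V1 = zero_sub V \<and> V2 = full_sub V)"
  shows "deg_excess V1 V2 > 0"
proof -
  obtain k F l j where red: "reduced_two_step V1 V2 k F l j"
    by (rule reduced_two_step_exists[OF ts nt])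
  then show ?thesis
    using st reduced_in_H0_N[OF ts dg red] unfolding alpha_stable_def reduced_two_step_def by metis
qed

end


section \<open>Infinitesimal symmetries\<close>

text \<open>The derivative at 0 of \<open>b (exp (s p) u) (exp (s p) v)\<close> with respect to
  \<open>s\<close> vanishes: \<open>p\<close> lies in the Lie algebra of the isometries of
  \<open>b\<close>.\<close>

definition skew :: "(complex, 'l) module \<Rightarrow> (complex, 'v) module \<Rightarrow> ('v \<Rightarrow> 'v) \<Rightarrow> ('v \<Rightarrow> 'v \<Rightarrow> 'l) \<Rightarrow> bool" where
  "skew N M p b \<longleftrightarrow> (\<forall>u\<in>carrier M. \<forall>v\<in>carrier M. b (p u) v \<oplus>\<^bsub>N\<^esub> b u (p v) = \<zero>\<^bsub>N\<^esub>)"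

lemma sym2_dual_bilinear:
  assumes "b \<in> carrier (sym2_dual N M)"
  shows "u \<in> carrier M \<Longrightarrow> v \<in> carrier M \<Longrightarrow> b u v \<in> carrier N"
    and "u \<in> carrier M \<Longrightarrow> v \<in> carrier M \<Longrightarrow> b u v = b v u"
    and "u \<in> carrier M \<Longrightarrow> v \<in> carrier M \<Longrightarrow> w \<in> carrier M \<Longrightarrow> b u (v \<oplus>\<^bsub>M\<^esub> w) = b u v \<oplus>\<^bsub>N\<^esub> b u w"
    and "u \<in> carrier M \<Longrightarrow> v \<in> carrier M \<Longrightarrow> b u (c \<odot>\<^bsub>M\<^esub> v) = c \<odot>\<^bsub>N\<^esub> b u v"
  using assms by (auto simp: PiE_iff lin_maps_iff lin_on_def)

lemma sym2_dual_bilinear_left: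
  assumes "cmod M" and b: "b \<in> carrier (sym2_dual N M)"
  shows "u \<in> carrier M \<Longrightarrow> v \<in> carrier M \<Longrightarrow> w \<in> carrier M \<Longrightarrow> b (v \<oplus>\<^bsub>M\<^esub> w) u = b v u \<oplus>\<^bsub>N\<^esub> b w u"
    and "u \<in> carrier M \<Longrightarrow> v \<in> carrier M \<Longrightarrow> b (c \<odot>\<^bsub>M\<^esub> v) u = c \<odot>\<^bsub>N\<^esub> b v u"
proof -
  interpret M: cmod M by fact
  show "u \<in> carrier M \<Longrightarrow> v \<in> carrier M \<Longrightarrow> w \<in> carrier M \<Longrightarrow> b (v \<oplus>\<^bsub>M\<^esub> w) u = b v u \<oplus>\<^bsub>N\<^esub> b w u"
    using sym2_dual_bilinear(2,3)[OF b] by (metis M.add.m_closed)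
  show "u \<in> carrier M \<Longrightarrow> v \<in> carrier M \<Longrightarrow> b (c \<odot>\<^bsub>M\<^esub> v) u = c \<odot>\<^bsub>N\<^esub> b v u"
    using sym2_dual_bilinear(2,4)[OF b] by (metis M.smult_closed')
qed

text \<open>For a fixed map the condition is linear in the form, so it may be verified on generators
  of a span.\<close>

lemma skew_submodule:
  assumes "cmod M" "cmod N" and p: "\<And>u. u \<in> carrier M \<Longrightarrow> p u \<in> carrier M"
  shows "submodule {b \<in> carrier (sym2_dual N M). skew N M p b} CC (sym2_dual N M)"
proof -
  interpret N: cmod N by fact
  interpret B: cmod "sym2_dual N M" by (rule cmod_sym2_dual) fact+
  show ?thesis
    unfolding B.submodule_iff
  proof (intro conjI ballI allI)
    show "\<zero>\<^bsub>sym2_dual N M\<^esub> \<in> {b \<in> carrier (sym2_dual N M). skew N M p b}"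
      using B.zero_closed p by (auto simp: skew_def simp del: sym2_dual_simps(1))
  next
    fix b b' assume "b \<in> {b \<in> carrier (sym2_dual N M). skew N M p b}" "b' \<in> {b \<in> carrier (sym2_dual N M). skew N M p b}"
    then have b: "b \<in> carrier (sym2_dual N M)" "skew N M p b" "b' \<in> carrier (sym2_dual N M)" "skew N M p b'"
      by blast+
    have "(b (p u) v \<oplus>\<^bsub>N\<^esub> b' (p u) v) \<oplus>\<^bsub>N\<^esub> (b u (p v) \<oplus>\<^bsub>N\<^esub> b' u (p v)) = \<zero>\<^bsub>N\<^esub>"
      if uv: "u \<in> carrier M" "v \<in> carrier M" for u v
    proof -
      have cl: "b (p u) v \<in> carrier N" "b' (p u) v \<in> carrier N" "b u (p v) \<in> carrier N" "b' u (p v) \<in> carrier N"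
        using sym2_dual_bilinear(1)[OF b(1)] sym2_dual_bilinear(1)[OF b(3)] uv p by blast+
      have "(b (p u) v \<oplus>\<^bsub>N\<^esub> b' (p u) v) \<oplus>\<^bsub>N\<^esub> (b u (p v) \<oplus>\<^bsub>N\<^esub> b' u (p v))
          = (b (p u) v \<oplus>\<^bsub>N\<^esub> b u (p v)) \<oplus>\<^bsub>N\<^esub> (b' (p u) v \<oplus>\<^bsub>N\<^esub> b' u (p v))"
        using cl by (simp add: N.a_ac)
      then show ?thesis using b(2,4) uv by (simp add: skew_def)
    qed
    then show "b \<oplus>\<^bsub>sym2_dual N M\<^esub> b' \<in> {b \<in> carrier (sym2_dual N M). skew N M p b}"
      using B.a_closed[OF b(1,3)] p by (auto simp: skew_def simp del: sym2_dual_simps(1))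
  next
    fix c b assume "b \<in> {b \<in> carrier (sym2_dual N M). skew N M p b}"
    then have b: "b \<in> carrier (sym2_dual N M)" "skew N M p b"
      by blast+
    have "c \<odot>\<^bsub>N\<^esub> b (p u) v \<oplus>\<^bsub>N\<^esub> c \<odot>\<^bsub>N\<^esub> b u (p v) = \<zero>\<^bsub>N\<^esub>"
      if uv: "u \<in> carrier M" "v \<in> carrier M" for u v
    proof -
      have cl: "b (p u) v \<in> carrier N" "b u (p v) \<in> carrier N"
        using sym2_dual_bilinear(1)[OF b(1)] uv p by blast+
      then show ?thesis using b(2) uv by (simp add: skew_def flip: N.smult_add_r)
    qed
    then show "c \<odot>\<^bsub>sym2_dual N M\<^esub> b \<in> {b \<in> carrier (sym2_dual N M). skew N M p b}"
      using B.smult_closed'[OF b(1)] p by (auto simp: skew_def simp del: sym2_dual_simps(1))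
  qed blast
qed

text \<open>Under the induced action a product of eigenvectors has the sum of the two eigenvalues as
  its eigenvalue, here 0.\<close>

lemma sym_prod_skew:
  assumes "cmod M" "cmod N" "l \<in> carrier N" and p: "\<And>u. u \<in> carrier M \<Longrightarrow> p u \<in> carrier M"
    and "\<And>u. u \<in> carrier M \<Longrightarrow> \<xi> (p u) = a * \<xi> u" "\<And>u. u \<in> carrier M \<Longrightarrow> \<eta> (p u) = b * \<eta> u"
    and "a + b = 0"
  shows "skew N M p (sym_prod N M l \<xi> \<eta>)"
proof -
  interpret N: cmod N by fact
  have b: "b = - a" using assms(7) by (simp add: eq_neg_iff_add_eq_0 add.commute)
  show ?thesis
    unfolding skew_def
  proof (intro ballI)
    fix u v assume uv: "u \<in> carrier M" "v \<in> carrier M"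
    have "(\<xi> (p u) * \<eta> v + \<xi> v * \<eta> (p u)) + (\<xi> u * \<eta> (p v) + \<xi> (p v) * \<eta> u) = 0"
      using uv by (simp add: assms(5,6) b algebra_simps)
    then have "(\<xi> (p u) * \<eta> v + \<xi> v * \<eta> (p u)) / 2 + (\<xi> u * \<eta> (p v) + \<xi> (p v) * \<eta> u) / 2 = 0"
      by (simp only: add_divide_distrib[symmetric]) simp
    then show "sym_prod N M l \<xi> \<eta> (p u) v \<oplus>\<^bsub>N\<^esub> sym_prod N M l \<xi> \<eta> u (p v) = \<zero>\<^bsub>N\<^esub>"
      using uv p N.smult_add_l[OF assms(3), symmetric] N.smult_0'[OF assms(3)] by (simp add: sym_prod_def)
  qed
qed

lemma tensor_S_skew:
  assumes "cmod M" "cmod N" "S \<subseteq> carrier (dual_space M)" "T \<subseteq> carrier (dual_space M)"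
    and p: "\<And>u. u \<in> carrier M \<Longrightarrow> p u \<in> carrier M"
    and "\<And>\<xi> u. \<xi> \<in> S \<Longrightarrow> u \<in> carrier M \<Longrightarrow> \<xi> (p u) = a * \<xi> u"
    and "\<And>\<xi> u. \<xi> \<in> T \<Longrightarrow> u \<in> carrier M \<Longrightarrow> \<xi> (p u) = b * \<xi> u"
    and "a + b = 0"
  shows "tensor_S N M S T \<subseteq> {b \<in> carrier (sym2_dual N M). skew N M p b}"
  unfolding tensor_S_def
proof (rule cmod.cspan_least[OF cmod_sym2_dual[OF assms(1,2)] skew_submodule[OF assms(1,2) p]])
  show "{sym_prod N M l \<xi> \<eta> |l \<xi> \<eta>. l \<in> carrier N \<and> \<xi> \<in> S \<and> \<eta> \<in> T}
      \<subseteq> {b \<in> carrier (sym2_dual N M). skew N M p b}"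
  proof clarify
    fix l \<xi> \<eta> assume "l \<in> carrier N" "\<xi> \<in> S" "\<eta> \<in> T"
    then show "sym_prod N M l \<xi> \<eta> \<in> carrier (sym2_dual N M) \<and> skew N M p (sym_prod N M l \<xi> \<eta>)"
      using assms by (intro conjI sym_prod_carrier sym_prod_skew[where a = a and b = b]) auto
  qed
qed

lemma skew_zero:
  assumes "cmod M" "cmod N" "b \<in> carrier (sym2_dual N M)"
  shows "skew N M (\<lambda>_. \<zero>\<^bsub>M\<^esub>) b"
proof -
  interpret M: cmod M by fact
  interpret N: cmod N by fact
  have "b u \<zero>\<^bsub>M\<^esub> = \<zero>\<^bsub>N\<^esub>" if "u \<in> carrier M" for u
    using sym2_dual_bilinear(4)[OF assms(3) that M.zero_closed, where c = 0]
      sym2_dual_bilinear(1)[OF assms(3) that M.zero_closed] by simp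
  then show ?thesis
    unfolding skew_def using sym2_dual_bilinear(2)[OF assms(3)] by auto
qed

text \<open>Additivity in the map is what permits superposing the symmetries that come from
  different levels.\<close>

lemma skew_add:
  assumes "cmod M" "cmod N" and b: "b \<in> carrier (sym2_dual N M)"
    and p: "\<And>u. u \<in> carrier M \<Longrightarrow> p u \<in> carrier M" and q: "\<And>u. u \<in> carrier M \<Longrightarrow> q u \<in> carrier M"
    and "skew N M p b" "skew N M q b"
  shows "skew N M (\<lambda>u. p u \<oplus>\<^bsub>M\<^esub> q u) b"
  unfolding skew_def
proof (intro ballI)
  interpret N: cmod N by fact
  fix u v assume uv: "u \<in> carrier M" "v \<in> carrier M"
  note cl = sym2_dual_bilinear(1)[OF b]
  have "b (p u \<oplus>\<^bsub>M\<^esub> q u) v \<oplus>\<^bsub>N\<^esub> b u (p v \<oplus>\<^bsub>M\<^esub> q v)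
      = (b (p u) v \<oplus>\<^bsub>N\<^esub> b u (p v)) \<oplus>\<^bsub>N\<^esub> (b (q u) v \<oplus>\<^bsub>N\<^esub> b u (q v))"
    using uv p q by (simp add: sym2_dual_bilinear(3)[OF b] sym2_dual_bilinear_left[OF assms(1) b] cl N.a_ac)
  then show "b (p u \<oplus>\<^bsub>M\<^esub> q u) v \<oplus>\<^bsub>N\<^esub> b u (p v \<oplus>\<^bsub>M\<^esub> q v) = \<zero>\<^bsub>N\<^esub>"
    using assms(6,7) uv by (simp add: skew_def)
qed

lemma skew_smult:
  assumes "cmod M" "cmod N" and b: "b \<in> carrier (sym2_dual N M)"
    and p: "\<And>u. u \<in> carrier M \<Longrightarrow> p u \<in> carrier M" and "skew N M p b"
  shows "skew N M (\<lambda>u. c \<odot>\<^bsub>M\<^esub> p u) b"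
  unfolding skew_def
proof (intro ballI)
  interpret N: cmod N by fact
  fix u v assume uv: "u \<in> carrier M" "v \<in> carrier M"
  have "b (c \<odot>\<^bsub>M\<^esub> p u) v \<oplus>\<^bsub>N\<^esub> b u (c \<odot>\<^bsub>M\<^esub> p v) = c \<odot>\<^bsub>N\<^esub> (b (p u) v \<oplus>\<^bsub>N\<^esub> b u (p v))"
    using uv p by (simp add: sym2_dual_bilinear(4)[OF b] sym2_dual_bilinear_left[OF assms(1) b]
        sym2_dual_bilinear(1)[OF b] N.smult_add_r)
  then show "b (c \<odot>\<^bsub>M\<^esub> p u) v \<oplus>\<^bsub>N\<^esub> b u (c \<odot>\<^bsub>M\<^esub> p v) = \<zero>\<^bsub>N\<^esub>"
    using assms(5) uv by (simp add: skew_def)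
qed

lemma skew_cong:
  "(\<And>u. u \<in> carrier M \<Longrightarrow> p u = q u) \<Longrightarrow> skew N M p b \<longleftrightarrow> skew N M q b"
  by (simp add: skew_def)

text \<open>On eigenvectors skewness becomes \<open>(c + d) b(u, v) = 0\<close>.\<close>

lemma skew_eigen:
  assumes "cmod M" "cmod N" and b: "b \<in> carrier (sym2_dual N M)" and "skew N M p b"
    and u: "u \<in> carrier M" and v: "v \<in> carrier M" and "p u = c \<odot>\<^bsub>M\<^esub> u" "p v = d \<odot>\<^bsub>M\<^esub> v" "c + d \<noteq> 0"
  shows "b u v = \<zero>\<^bsub>N\<^esub>"
proof -
  interpret N: cmod N by fact
  have "c \<odot>\<^bsub>N\<^esub> b u v \<oplus>\<^bsub>N\<^esub> d \<odot>\<^bsub>N\<^esub> b u v = \<zero>\<^bsub>N\<^esub>"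
    using assms(4,7,8) u v sym2_dual_bilinear(4)[OF b u v] sym2_dual_bilinear_left(2)[OF assms(1) b v u]
    unfolding skew_def by metis
  then show ?thesis
    using N.smult_eq_zero[OF sym2_dual_bilinear(1)[OF b u v] assms(9)] sym2_dual_bilinear(1)[OF b u v]
    by (simp add: N.smult_add_l)
qed

text \<open>The transpose of \<open>g\<close>. The action of an endomorphism of V on \<beta>,
  regarded as a form on the dual, goes through it.\<close>

definition pull :: "(complex, 'v) module \<Rightarrow> ('v \<Rightarrow> 'v) \<Rightarrow> ('v \<Rightarrow> complex) \<Rightarrow> 'v \<Rightarrow> complex" where
  "pull M g \<xi> = (\<lambda>v\<in>carrier M. \<xi> (g v))"

lemma pull_carrier:
  assumes "cmod M" "lin_on M M g" "\<xi> \<in> carrier (dual_space M)"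
  shows "pull M g \<xi> \<in> carrier (dual_space M)"
proof -
  have "lin_on M complex_line (\<lambda>v. \<xi> (g v))"
    using assms(2,3) by (simp add: lin_on_def lin_maps_iff)
  then show ?thesis
    using lin_on_restrict[OF assms(1)] by (simp add: pull_def)
qed


subsection \<open>The endomorphism of a splitting\<close>

lemma fibre_gr_bundle: "fibre (gr_bundle V k F) x = dsum_space {1..k} (\<lambda>i. fibre (gr_piece V F i) x)"
  by (simp add: gr_bundle_def dsum_bundle_def)

lemma hsec_gr_bundle: "hsec (gr_bundle V k F) U s \<longleftrightarrow> open U \<and>
    (\<forall>x\<in>U. s x \<in> (\<Pi>\<^sub>E i\<in>{1..k}. carrier (fibre (gr_piece V F i) x))) \<and>
    (\<forall>i\<in>{1..k}. hsec (gr_piece V F i) U (\<lambda>x. s x i))"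
  by (simp add: gr_bundle_def dsum_bundle_def)

lemma (in hol_vb) hsec_gr_piece_cong:
  assumes "\<And>x. x \<in> U \<Longrightarrow> q x = q' x"
  shows "hsec (gr_piece V F i) U q \<longleftrightarrow> hsec (gr_piece V F i) U q'"
proof -
  have "hsec (gr_piece V F i) U q'" if q: "hsec (gr_piece V F i) U q" and eq: "\<And>x. x \<in> U \<Longrightarrow> q x = q' x" for q q'
    unfolding hsec_gr_piece
  proof (intro conjI ballI)
    show "open U" using q by (simp add: hsec_gr_piece)
    fix x assume "x \<in> U"
    then obtain U' s where "x \<in> U'" "U' \<subseteq> U" "hsec V U' s" "\<forall>y\<in>U'. s y \<in> F i y"
        "\<forall>y\<in>U'. q y = F (i - 1) y +>\<^bsub>fibre V y\<^esub> s y"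
      using q unfolding hsec_gr_piece by meson
    moreover have "q' y = F (i - 1) y +>\<^bsub>fibre V y\<^esub> s y" if "y \<in> U'" for y
      using calculation eq[of y] that by auto
    ultimately show "\<exists>U' s. x \<in> U' \<and> U' \<subseteq> U \<and> hsec V U' s \<and> (\<forall>y\<in>U'. s y \<in> F i y) \<and>
        (\<forall>y\<in>U'. q' y = F (i - 1) y +>\<^bsub>fibre V y\<^esub> s y)"
      by (intro exI[of _ U'] exI[of _ s] conjI ballI) simp_all
  qed
  note imp = this
  show ?thesis
  proof
    assume "hsec (gr_piece V F i) U q" then show "hsec (gr_piece V F i) U q'"
      by (rule imp) (rule assms)
  next
    assume "hsec (gr_piece V F i) U q'" then show "hsec (gr_piece V F i) U q"
      by (rule imp) (rule assms[symmetric])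
  qed
qed

context hol_vb
begin

context
  fixes k :: nat and F :: "nat \<Rightarrow> 'x \<Rightarrow> 'v set" and \<sigma> :: "'x \<Rightarrow> 'v \<Rightarrow> nat \<Rightarrow> 'v set"
  assumes iso: "bundle_iso V (gr_bundle V k F) \<sigma>"
begin

lemma gr_iso_lin_on: "lin_on (fibre V x) (dsum_space {1..k} (\<lambda>i. fibre (gr_piece V F i) x)) (\<sigma> x)"
  and gr_iso_bij: "bij_betw (\<sigma> x) (carrier (fibre V x)) (carrier (dsum_space {1..k} (\<lambda>i. fibre (gr_piece V F i) x)))"
  using iso by (simp_all add: bundle_iso_def fibre_gr_bundle lin_maps_iff del: dsum_space_simps)

lemma gr_iso_closed:
  "v \<in> carrier (fibre V x) \<Longrightarrow> \<sigma> x v \<in> carrier (dsum_space {1..k} (\<lambda>i. fibre (gr_piece V F i) x))"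
  using gr_iso_lin_on by (simp add: lin_on_def)

lemma gr_iso_component:
  "v \<in> carrier (fibre V x) \<Longrightarrow> i \<in> {1..k} \<Longrightarrow> \<sigma> x v i \<in> carrier (fibre (gr_piece V F i) x)"
  using gr_iso_closed[of v x] by (auto simp: PiE_iff)

lemma gr_iso_add:
  "u \<in> carrier (fibre V x) \<Longrightarrow> v \<in> carrier (fibre V x) \<Longrightarrow> i \<in> {1..k} \<Longrightarrow>
    \<sigma> x (u \<oplus>\<^bsub>fibre V x\<^esub> v) i = \<sigma> x u i \<oplus>\<^bsub>fibre (gr_piece V F i) x\<^esub> \<sigma> x v i"
  using gr_iso_lin_on[of x] by (simp add: lin_on_def)

lemma gr_iso_smult:
  "v \<in> carrier (fibre V x) \<Longrightarrow> i \<in> {1..k} \<Longrightarrow>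
    \<sigma> x (c \<odot>\<^bsub>fibre V x\<^esub> v) i = c \<odot>\<^bsub>fibre (gr_piece V F i) x\<^esub> \<sigma> x v i"
  using gr_iso_lin_on[of x] by (simp add: lin_on_def)

lemma dual_gr_carrier: "i \<in> {1..k} \<Longrightarrow> dual_gr V F \<sigma> i x \<subseteq> carrier (dual_space (fibre V x))"
  by (auto simp: dual_gr_def lin_maps_dual_iff gr_iso_add gr_iso_smult gr_iso_component)

lemma gr_iso_eqI:
  assumes "\<And>i. i \<in> {1..k} \<Longrightarrow> \<sigma> x u i = \<sigma> x v i" "u \<in> carrier (fibre V x)" "v \<in> carrier (fibre V x)"
  shows "u = v"
proof -
  have "\<sigma> x u = \<sigma> x v" by (rule dsum_space_eqI[OF gr_iso_closed gr_iso_closed]) (use assms in auto)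
  then show ?thesis using gr_iso_bij[of x] assms by (auto simp: bij_betw_def inj_on_def)
qed

end

end

text \<open>The existential clause of \<open>alpha_polystable\<close>, isolated so that it can also
  be used for flags with repetitions, where the definition itself does not apply.\<close>

definition (in higgs) splits ::
  "nat \<Rightarrow> (nat \<Rightarrow> 'x \<Rightarrow> 'v set) \<Rightarrow> (nat \<Rightarrow> real) \<Rightarrow> ('x \<Rightarrow> 'v \<Rightarrow> nat \<Rightarrow> 'v set) \<Rightarrow> bool" where
  "splits k F l \<sigma> \<longleftrightarrow> bundle_iso V (gr_bundle V k F) \<sigma> \<and>
     (\<forall>j\<in>{1..k}. F j = pre_gr V k F \<sigma> {1..j}) \<and>
     \<beta> \<in> H0 (sub_bundle (L_sym2 X L V) (sub_sum (L_sym2 X L V)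
       {L_tensor_S L V (pre_gr V k F \<sigma> {i}) (pre_gr V k F \<sigma> {j}) |i j.
          i \<in> {1..k} \<and> j \<in> {1..k} \<and> l i + l j = 0})) \<and>
     \<gamma> \<in> H0 (sub_bundle (L_sym2_dual L V) (sub_sum (L_sym2_dual L V)
       {L_tensor_S_dual L V (dual_gr V F \<sigma> i) (dual_gr V F \<sigma> j) |i j.
          i \<in> {1..k} \<and> j \<in> {1..k} \<and> l i + l j = 0}))"

section \<open>Infinitesimal automorphisms of a Higgs pair\<close>

context higgs
begin

text \<open>Holomorphic endomorphisms annihilating the Higgs field, that is, the Lie algebra of the
  automorphisms of V that fix \<beta> and \<gamma>.\<close>

definition infinitesimal :: "('x \<Rightarrow> 'v \<Rightarrow> 'v) \<Rightarrow> bool" where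
  "infinitesimal g \<longleftrightarrow> hol_endo g \<and>
     (\<forall>x. skew (fibre L x) (dual_space (fibre V x)) (pull (fibre V x) (g x)) (\<beta> x) \<and>
          skew (fibre L x) (fibre V x) (g x) (\<gamma> x))"

lemma infinitesimal_zero: "infinitesimal (\<lambda>x u. \<zero>\<^bsub>fibre V x\<^esub>)"
proof -
  have "pull (fibre V x) (\<lambda>u. \<zero>\<^bsub>fibre V x\<^esub>) \<xi> = \<zero>\<^bsub>dual_space (fibre V x)\<^esub>" if "\<xi> \<in> carrier (dual_space (fibre V x))" for x \<xi>
    using that lin_on_zero[OF cmod_fibre cmod_complex_line, of x \<xi>] by (auto simp: pull_def lin_maps_iff)
  then have "skew (fibre L x) (dual_space (fibre V x)) (pull (fibre V x) (\<lambda>u. \<zero>\<^bsub>fibre V x\<^esub>)) (\<beta> x)" for x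
    using skew_zero[OF cmod_dual cmod_line \<beta>_carrier, of x] by (subst skew_cong)
  then show ?thesis
    unfolding infinitesimal_def
    using hol_endo_zero_map skew_zero[OF cmod_fibre cmod_line \<gamma>_carrier] by blast
qed

lemma infinitesimal_add:
  assumes "infinitesimal g" "infinitesimal h"
  shows "infinitesimal (\<lambda>x u. g x u \<oplus>\<^bsub>fibre V x\<^esub> h x u)"
  unfolding infinitesimal_def
proof (intro conjI allI)
  note lin = hol_endo_lin_on hol_endo_closed
  have gh: "hol_endo g" "hol_endo h" using assms by (auto simp: infinitesimal_def)
  then show "hol_endo (\<lambda>x u. g x u \<oplus>\<^bsub>fibre V x\<^esub> h x u)" by (rule hol_endo_plus)
  fix x
  have sk: "skew (fibre L x) (fibre V x) (g x) (\<gamma> x)" "skew (fibre L x) (fibre V x) (h x) (\<gamma> x)"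
    "skew (fibre L x) (dual_space (fibre V x)) (pull (fibre V x) (g x)) (\<beta> x)"
    "skew (fibre L x) (dual_space (fibre V x)) (pull (fibre V x) (h x)) (\<beta> x)"
    using assms by (simp_all add: infinitesimal_def)
  show "skew (fibre L x) (fibre V x) (\<lambda>u. g x u \<oplus>\<^bsub>fibre V x\<^esub> h x u) (\<gamma> x)"
    using sk by (intro skew_add[OF cmod_fibre cmod_line \<gamma>_carrier lin(2)[OF gh(1)] lin(2)[OF gh(2)]]) auto
  have "skew (fibre L x) (dual_space (fibre V x))
      (\<lambda>\<xi>. pull (fibre V x) (g x) \<xi> \<oplus>\<^bsub>dual_space (fibre V x)\<^esub> pull (fibre V x) (h x) \<xi>) (\<beta> x)"
    using sk by (intro skew_add[OF cmod_dual cmod_line \<beta>_carrier pull_carrier[OF cmod_fibre lin(1)[OF gh(1)]]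
          pull_carrier[OF cmod_fibre lin(1)[OF gh(2)]]]) auto
  moreover have "pull (fibre V x) (g x) \<xi> \<oplus>\<^bsub>dual_space (fibre V x)\<^esub> pull (fibre V x) (h x) \<xi> =
      pull (fibre V x) (\<lambda>u. g x u \<oplus>\<^bsub>fibre V x\<^esub> h x u) \<xi>" if "\<xi> \<in> carrier (dual_space (fibre V x))" for \<xi>
    using that gh by (auto simp: pull_def lin_maps_dual_iff hol_endo_closed)
  ultimately show "skew (fibre L x) (dual_space (fibre V x))
      (pull (fibre V x) (\<lambda>u. g x u \<oplus>\<^bsub>fibre V x\<^esub> h x u)) (\<beta> x)"
    by (subst (asm) skew_cong)
qed

lemma infinitesimal_smult:
  assumes "infinitesimal g"
  shows "infinitesimal (\<lambda>x u. c \<odot>\<^bsub>fibre V x\<^esub> g x u)"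
  unfolding infinitesimal_def
proof (intro conjI allI)
  note lin = hol_endo_lin_on hol_endo_closed
  have g: "hol_endo g" using assms by (auto simp: infinitesimal_def)
  then show "hol_endo (\<lambda>x u. c \<odot>\<^bsub>fibre V x\<^esub> g x u)" by (rule hol_endo_scale)
  fix x
  have sk: "skew (fibre L x) (fibre V x) (g x) (\<gamma> x)"
    "skew (fibre L x) (dual_space (fibre V x)) (pull (fibre V x) (g x)) (\<beta> x)"
    using assms by (simp_all add: infinitesimal_def)
  show "skew (fibre L x) (fibre V x) (\<lambda>u. c \<odot>\<^bsub>fibre V x\<^esub> g x u) (\<gamma> x)"
    using sk by (intro skew_smult[OF cmod_fibre cmod_line \<gamma>_carrier lin(2)[OF g]]) auto
  have "skew (fibre L x) (dual_space (fibre V x))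
      (\<lambda>\<xi>. c \<odot>\<^bsub>dual_space (fibre V x)\<^esub> pull (fibre V x) (g x) \<xi>) (\<beta> x)"
    using sk by (intro skew_smult[OF cmod_dual cmod_line \<beta>_carrier pull_carrier[OF cmod_fibre lin(1)[OF g]]]) auto
  moreover have "c \<odot>\<^bsub>dual_space (fibre V x)\<^esub> pull (fibre V x) (g x) \<xi> =
      pull (fibre V x) (\<lambda>u. c \<odot>\<^bsub>fibre V x\<^esub> g x u) \<xi>" if "\<xi> \<in> carrier (dual_space (fibre V x))" for \<xi>
    using that g by (auto simp: pull_def lin_maps_dual_iff hol_endo_closed)
  ultimately show "skew (fibre L x) (dual_space (fibre V x))
      (pull (fibre V x) (\<lambda>u. c \<odot>\<^bsub>fibre V x\<^esub> g x u)) (\<beta> x)"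
    by (subst (asm) skew_cong)
qed

text \<open>The diagonal endomorphism with entries \<open>a i\<close> of the graded bundle,
  conjugated by \<sigma>. It is holomorphic because a bundle isomorphism matches the sheaves of
  sections in both directions.\<close>

lemma splitting_endo:
  fixes F :: "nat \<Rightarrow> 'x \<Rightarrow> 'v set" and a :: "nat \<Rightarrow> complex"
  assumes sub: "\<And>i. i \<le> k \<Longrightarrow> subbundle V (F i)" and le: "\<And>i x. i \<in> {1..k} \<Longrightarrow> F (i - 1) x \<subseteq> F i x"
    and iso: "bundle_iso V (gr_bundle V k F) \<sigma>"
  obtains g where "hol_endo g"
    "\<And>x v i. v \<in> carrier (fibre V x) \<Longrightarrow> i \<in> {1..k} \<Longrightarrow>
       \<sigma> x (g x v) i = a i \<odot>\<^bsub>fibre (gr_piece V F i) x\<^esub> \<sigma> x v i"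
proof -
  have gr: "cmod (fibre (gr_piece V F i) x)" if "i \<in> {1..k}" for i x
    using that by (intro cmod_gr_piece sub le) auto
  let ?D = "\<lambda>x. dsum_space {1..k} (\<lambda>i. fibre (gr_piece V F i) x)"
  define T where "T = (\<lambda>x C. \<lambda>i\<in>{1..k}. a i \<odot>\<^bsub>fibre (gr_piece V F i) x\<^esub> C i)"
  define g where "g = (\<lambda>x v. inv_into (carrier (fibre V x)) (\<sigma> x) (T x (\<sigma> x v)))"
  note lin = gr_iso_lin_on[OF iso] and bij = gr_iso_bij[OF iso] and \<sigma>cl = gr_iso_closed[OF iso]
    and \<sigma>i = gr_iso_component[OF iso]
  have T: "T x C \<in> carrier (?D x)" if "C \<in> carrier (?D x)" for x C
    using that cmod.smult_closed'[OF gr] by (auto simp: T_def PiE_iff)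
  have gcl: "g x v \<in> carrier (fibre V x)" and \<sigma>g: "\<sigma> x (g x v) = T x (\<sigma> x v)" if "v \<in> carrier (fibre V x)" for x v
    using T[OF \<sigma>cl[OF that]] bij[of x] by (auto simp: g_def bij_betw_def inv_into_into f_inv_into_f simp del: dsum_space_simps)
  have inj: "u = v" if "\<sigma> x u = \<sigma> x v" "u \<in> carrier (fibre V x)" "v \<in> carrier (fibre V x)" for x u v
    using bij[of x] that by (auto simp: bij_betw_def inj_on_def)
  have "g x (u \<oplus>\<^bsub>fibre V x\<^esub> v) = g x u \<oplus>\<^bsub>fibre V x\<^esub> g x v"
    if "u \<in> carrier (fibre V x)" "v \<in> carrier (fibre V x)" for x u v
  proof (rule inj)
    show "\<sigma> x (g x (u \<oplus>\<^bsub>fibre V x\<^esub> v)) = \<sigma> x (g x u \<oplus>\<^bsub>fibre V x\<^esub> g x v)"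
      using lin[of x] that cmod.smult_add_r[OF gr \<sigma>i \<sigma>i] by (auto simp: \<sigma>g gcl lin_on_def T_def intro!: restrict_ext)
  qed (use that gcl in auto)
  moreover have "g x (c \<odot>\<^bsub>fibre V x\<^esub> v) = c \<odot>\<^bsub>fibre V x\<^esub> g x v"
    if "v \<in> carrier (fibre V x)" for x c v
  proof (rule inj)
    show "\<sigma> x (g x (c \<odot>\<^bsub>fibre V x\<^esub> v)) = \<sigma> x (c \<odot>\<^bsub>fibre V x\<^esub> g x v)"
      using lin[of x] that cmod.smult_mult[OF gr \<sigma>i] by (auto simp: \<sigma>g gcl lin_on_def T_def mult.commute intro!: restrict_ext)
  qed (use that gcl in auto)
  moreover have "hsec V U (\<lambda>x. g x (s x))" if s: "hsec V U s" for U s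
  proof -
    have scl: "s x \<in> carrier (fibre V x)" if "x \<in> U" for x using hsec_carrier[OF s that] .
    have "hsec (gr_bundle V k F) U (\<lambda>x. \<sigma> x (s x))"
      using iso s scl by (simp add: bundle_iso_def)
    then have h: "open U" "hsec (gr_piece V F i) U (\<lambda>x. \<sigma> x (s x) i)" if "i \<in> {1..k}" for i
      using that by (auto simp: hsec_gr_bundle)
    have "hsec (gr_piece V F i) U (\<lambda>x. \<sigma> x (g x (s x)) i)" if i: "i \<in> {1..k}" for i
    proof -
      have "hsec (gr_piece V F i) U (\<lambda>x. a i \<odot>\<^bsub>fibre (gr_piece V F i) x\<^esub> \<sigma> x (s x) i)"
        using i by (intro hsec_gr_piece_smult sub le h) auto
      moreover have "\<sigma> x (g x (s x)) i = a i \<odot>\<^bsub>fibre (gr_piece V F i) x\<^esub> \<sigma> x (s x) i" if "x \<in> U" for x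
        using \<sigma>g[OF scl[OF that]] i by (simp add: T_def)
      ultimately show ?thesis by (subst hsec_gr_piece_cong)
    qed
    then have "hsec (gr_bundle V k F) U (\<lambda>x. \<sigma> x (g x (s x)))"
      unfolding hsec_gr_bundle using hsec_open[OF s] \<sigma>cl[OF gcl[OF scl]] by auto
    then show ?thesis
      using iso gcl scl by (auto simp: bundle_iso_def)
  qed
  ultimately have "hol_endo g"
    using gcl by (simp add: hol_endo_def lin_on_def)
  moreover have "\<sigma> x (g x v) i = a i \<odot>\<^bsub>fibre (gr_piece V F i) x\<^esub> \<sigma> x v i"
    if "v \<in> carrier (fibre V x)" "i \<in> {1..k}" for x v i
    using \<sigma>g[OF that(1)] that(2) by (simp add: T_def)
  ultimately show thesis by (rule that)
qed

text \<open>The endomorphism is the scalar \<open>l i\<close> on the \<open>i\<close>-th summand.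
  The summands in which \<beta> and \<gamma> take values pair opposite weights, so it annihilates
  both.\<close>

lemma infinitesimal_of_splits:
  assumes F: "weak_filtration V k F" and split: "splits k F l \<sigma>"
  obtains g where "infinitesimal g"
    "\<And>x i v. i \<in> {1..k} \<Longrightarrow> v \<in> F i x \<Longrightarrow>
      g x v \<oplus>\<^bsub>fibre V x\<^esub> (- complex_of_real (l i)) \<odot>\<^bsub>fibre V x\<^esub> v \<in> F (i - 1) x"
proof -
  have iso: "bundle_iso V (gr_bundle V k F) \<sigma>" and flag: "\<And>i. i \<in> {1..k} \<Longrightarrow> F i = pre_gr V k F \<sigma> {1..i}"
    using split by (simp_all add: splits_def)
  have sub: "subbundle V (F i)" if "i \<le> k" for i using F that by (simp add: weak_filtration_def)
  have sub1: "subbundle V (F i)" "subbundle V (F (i - 1))" if "i \<in> {1..k}" for i using sub that by auto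
  have le: "F (i - 1) x \<subseteq> F i x" if "i \<in> {1..k}" for i x
    using weak_filtration_mono[OF F, of "i - 1" i] that by auto
  define a :: "nat \<Rightarrow> complex" where "a = (\<lambda>i. of_real (l i))"
  obtain g where g: "hol_endo g" "\<And>x v i. v \<in> carrier (fibre V x) \<Longrightarrow> i \<in> {1..k} \<Longrightarrow>
       \<sigma> x (g x v) i = a i \<odot>\<^bsub>fibre (gr_piece V F i) x\<^esub> \<sigma> x v i"
    by (rule splitting_endo[OF sub le iso, where a = a], assumption, assumption, rule that)
  have gr: "cmod (fibre (gr_piece V F i) x)" if "i \<in> {1..k}" for i x
    by (rule cmod_gr_piece[where F = F, OF sub1[OF that] le[OF that]])
  note \<sigma>i = gr_iso_component[OF iso] and \<sigma>add = gr_iso_add[OF iso] and \<sigma>smult = gr_iso_smult[OF iso]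
    and inj = gr_iso_eqI[OF iso]
  have gcl: "g x v \<in> carrier (fibre V x)" if "v \<in> carrier (fibre V x)" for x v
    using hol_endo_closed[OF g(1) that] .
  have eig: "g x v = a i \<odot>\<^bsub>fibre V x\<^esub> v" if v: "v \<in> pre_gr V k F \<sigma> {i} x" and i: "i \<in> {1..k}" for x v i
  proof (rule inj)
    have vc: "v \<in> carrier (fibre V x)" using v by (simp add: pre_gr_def)
    then show "g x v \<in> carrier (fibre V x)" "a i \<odot>\<^bsub>fibre V x\<^esub> v \<in> carrier (fibre V x)" using gcl by auto
    fix i' :: nat assume i': "i' \<in> {1..k}"
    then have "i' \<noteq> i \<Longrightarrow> \<sigma> x v i' = \<zero>\<^bsub>fibre (gr_piece V F i') x\<^esub>"
      using v by (auto simp: pre_gr_def)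
    then show "\<sigma> x (g x v) i' = \<sigma> x (a i \<odot>\<^bsub>fibre V x\<^esub> v) i'"
      using g(2)[OF vc i'] \<sigma>smult[OF vc i', of "a i"] cmod.smult_zero'[OF gr[OF i']] by (cases "i' = i") auto
  qed
  have "g x v \<oplus>\<^bsub>fibre V x\<^esub> (- complex_of_real (l i)) \<odot>\<^bsub>fibre V x\<^esub> v \<in> F (i - 1) x"
    if i: "i \<in> {1..k}" and v: "v \<in> F i x" for x i v
  proof -
    let ?w = "g x v \<oplus>\<^bsub>fibre V x\<^esub> (- complex_of_real (l i)) \<odot>\<^bsub>fibre V x\<^esub> v"
    have vc: "v \<in> carrier (fibre V x)" and vz: "\<And>m. m \<in> {1..k} \<Longrightarrow> i < m \<Longrightarrow> \<sigma> x v m = \<zero>\<^bsub>fibre (gr_piece V F m) x\<^esub>"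
      using v unfolding flag[OF i] pre_gr_def by auto
    have wc: "?w \<in> carrier (fibre V x)" using gcl[OF vc] vc by simp
    \<comment> \<open>Components beyond \<open>i\<close> vanish because \<open>v\<close> lies in
      \<open>F i\<close>; the \<open>i\<close>-th one vanishes because the two scalars
      cancel.\<close>
    have wz: "\<sigma> x ?w m = \<zero>\<^bsub>fibre (gr_piece V F m) x\<^esub>" if m: "m \<in> {1..k}" "i \<le> m" for m
    proof -
      interpret G: cmod "fibre (gr_piece V F m) x" by (rule gr[OF m(1)])
      have "\<sigma> x ?w m = (a m + (- a i)) \<odot>\<^bsub>fibre (gr_piece V F m) x\<^esub> \<sigma> x v m"
        unfolding G.smult_add_l[OF \<sigma>i[OF vc m(1)]]
        using \<sigma>add[OF gcl[OF vc] fib.smult_closed'[OF vc] m(1)] \<sigma>smult[OF vc m(1)] g(2)[OF vc m(1)] by (simp add: a_def)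
      then show ?thesis using vz[OF m(1)] m(2) \<sigma>i[OF vc m(1)] by (cases "i = m") auto
    qed
    show ?thesis
    \<comment> \<open>The description of the flag by \<open>pre_gr\<close> starts at index 1. For
      \<open>F 0\<close> all components of the vector vanish, and injectivity of \<sigma> makes the
      vector itself zero.\<close>
    proof (cases "i = 1")
      case True
      have "?w = \<zero>\<^bsub>fibre V x\<^esub>"
      proof (rule inj[OF _ wc])
        fix m assume m: "m \<in> {1..k}"
        have "\<sigma> x \<zero>\<^bsub>fibre V x\<^esub> m = \<zero>\<^bsub>fibre (gr_piece V F m) x\<^esub>"
          using \<sigma>smult[OF fib.zero_closed m, of x 0] cmod.smult_0'[OF gr[OF m] \<sigma>i[OF fib.zero_closed m]] by simp
        then show "\<sigma> x ?w m = \<sigma> x \<zero>\<^bsub>fibre V x\<^esub> m" using wz[OF m] True m by simp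
      qed simp
      then show ?thesis using subbundle_zero_mem[OF sub1(2)[OF i]] by simp
    next
      case False
      then have i1: "i - 1 \<in> {1..k}" using i by auto
      show ?thesis
        unfolding flag[OF i1] pre_gr_def using wc wz i1 by auto
    qed
  qed
  moreover have "infinitesimal g"
    unfolding infinitesimal_def
  proof (intro conjI allI g(1))
    fix x
    have pull: "pull (fibre V x) (g x) \<xi> \<in> carrier (dual_space (fibre V x))" if "\<xi> \<in> carrier (dual_space (fibre V x))" for \<xi>
      by (rule pull_carrier[OF cmod_fibre hol_endo_lin_on[OF g(1)] that])
    have prec: "pre_gr V k F \<sigma> {i} x \<subseteq> carrier (fibre V x)" for i by (auto simp: pre_gr_def)
    have a0: "a i + a j = 0" if "l i + l j = 0" for i j
      using that unfolding a_def by (metis of_real_add of_real_0)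
    have ev: "\<Xi> (pull (fibre V x) (g x) \<xi>) = a i * \<Xi> \<xi>"
      if h: "\<Xi> \<in> evals (fibre V x) (pre_gr V k F \<sigma> {i} x)" "\<xi> \<in> carrier (dual_space (fibre V x))" "i \<in> {1..k}" for \<Xi> \<xi> i
    proof -
      obtain v where v: "v \<in> pre_gr V k F \<sigma> {i} x" "\<Xi> = (\<lambda>\<xi>\<in>carrier (dual_space (fibre V x)). \<xi> v)"
        using h by (auto simp: evals_def)
      then have "\<xi> (g x v) = a i * \<xi> v"
        using eig[OF v(1) h(3)] h(2) subsetD[OF prec v(1)] by (auto simp: lin_maps_dual_iff)
      then show ?thesis
        using v pull[OF h(2)] h(2) prec by (auto simp: pull_def simp del: dual_space_simps)
    qed
    let ?\<B> = "{L_tensor_S L V (pre_gr V k F \<sigma> {i}) (pre_gr V k F \<sigma> {j}) |i j.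
        i \<in> {1..k} \<and> j \<in> {1..k} \<and> l i + l j = 0}"
    let ?K = "{b \<in> carrier (sym2_dual (fibre L x) (dual_space (fibre V x))).
            skew (fibre L x) (dual_space (fibre V x)) (pull (fibre V x) (g x)) b}"
    \<comment> \<open>Skew forms make up a subspace, so each tensor product spanning the sum can be
      treated by itself; there the two eigenvalues cancel.\<close>
    have "sub_sum (L_sym2 X L V) ?\<B> x \<subseteq> ?K"
      unfolding sub_sum_def fibre_L_sym2
    proof (rule cmod.cspan_least[OF cmod_sym2_dual[OF cmod_dual cmod_line] skew_submodule[OF cmod_dual cmod_line pull] UN_least], assumption)
      fix W assume "W \<in> ?\<B>"
      then obtain i j where W: "W = L_tensor_S L V (pre_gr V k F \<sigma> {i}) (pre_gr V k F \<sigma> {j})"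
        and ij: "i \<in> {1..k}" "j \<in> {1..k}" "l i + l j = 0" by blast
      show "W x \<subseteq> ?K"
        unfolding W L_tensor_S_def
        by (rule tensor_S_skew[OF cmod_dual cmod_line _ _ _ _ _ a0[OF ij(3)]])
          (use ij ev pull evals_carrier[OF cmod_fibre prec] in \<open>auto simp del: dual_space_simps\<close>)
    qed
    then show "skew (fibre L x) (dual_space (fibre V x)) (pull (fibre V x) (g x)) (\<beta> x)"
      using split unfolding splits_def in_H0_sub_bundle by blast
    have dgr: "\<xi> (g x v) = a i * \<xi> v"
      if "\<xi> \<in> dual_gr V F \<sigma> i x" "v \<in> carrier (fibre V x)" "i \<in> {1..k}" for \<xi> v i
      using that g(2)[OF that(2,3)] gcl[OF that(2)] \<sigma>i[OF that(2,3)]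
      by (auto simp: dual_gr_def lin_maps_dual_iff)
    note dgrc = dual_gr_carrier[OF iso]
    let ?\<G> = "{L_tensor_S_dual L V (dual_gr V F \<sigma> i) (dual_gr V F \<sigma> j) |i j.
        i \<in> {1..k} \<and> j \<in> {1..k} \<and> l i + l j = 0}"
    let ?K' = "{b \<in> carrier (sym2_dual (fibre L x) (fibre V x)). skew (fibre L x) (fibre V x) (g x) b}"
    have "sub_sum (L_sym2_dual L V) ?\<G> x \<subseteq> ?K'"
      unfolding sub_sum_def fibre_L_sym2_dual
    proof (rule cmod.cspan_least[OF cmod_sym2_dual[OF cmod_fibre cmod_line] skew_submodule[OF cmod_fibre cmod_line gcl] UN_least], assumption)
      fix W assume "W \<in> ?\<G>"
      then obtain i j where W: "W = L_tensor_S_dual L V (dual_gr V F \<sigma> i) (dual_gr V F \<sigma> j)"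
        and ij: "i \<in> {1..k}" "j \<in> {1..k}" "l i + l j = 0" by blast
      show "W x \<subseteq> ?K'"
        unfolding W L_tensor_S_dual_def
        by (rule tensor_S_skew[OF cmod_fibre cmod_line _ _ _ _ _ a0[OF ij(3)]])
          (use ij dgr gcl dgrc in \<open>auto simp del: dual_space_simps\<close>)
    qed
    then show "skew (fibre L x) (fibre V x) (g x) (\<gamma> x)"
      using split unfolding splits_def in_H0_sub_bundle by blast
  qed
  ultimately show thesis by (intro that)
qed

end


section \<open>Splitting a filtration by an endomorphism\<close>

lemma (in cmod) finsum_delta:
  assumes "finite A" "i \<in> A" "f i \<in> carrier M"
  shows "(\<Oplus>j\<in>A. if j = i then f j else \<zero>) = f i"
proof -
  have "(\<Oplus>j\<in>A. if j = i then f j else \<zero>) = (\<Oplus>j\<in>A. if i = j then f i else \<zero>)"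
    using assms(3) by (intro finsum_cong') auto
  also have "\<dots> = f i"
    using finsum_singleton[of i A "\<lambda>_. f i"] assms by auto
  finally show ?thesis .
qed

lemma (in cmod) finsum_all_zero: "(\<And>i. i \<in> A \<Longrightarrow> f i = \<zero>) \<Longrightarrow> (\<Oplus>i\<in>A. f i) = \<zero>"
  using finsum_cong'[of A A "\<lambda>_. \<zero>" f] by simp

lemma (in cmod) eq_smultI:
  assumes "u \<in> carrier M" "v \<in> carrier M" "u \<oplus> (- c) \<odot> v = \<zero>" shows "u = c \<odot> v"
proof -
  have "u = u \<oplus> ((- c) \<odot> v \<oplus> c \<odot> v)" using assms by (simp flip: smult_add_l)
  also have "\<dots> = (u \<oplus> (- c) \<odot> v) \<oplus> c \<odot> v" using assms(1,2) by (simp add: a_assoc)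
  finally show ?thesis using assms by simp
qed

lemma (in cmod) add_diff_cancel: "u \<in> carrier M \<Longrightarrow> v \<in> carrier M \<Longrightarrow> (u \<oplus> (-1) \<odot> v) \<oplus> v = u"
  by (simp add: a_assoc)

lemma (in cmod) add_diff_cancel_left: "u \<in> carrier M \<Longrightarrow> v \<in> carrier M \<Longrightarrow> (u \<oplus> v) \<oplus> (-1) \<odot> u = v"
  using a_assoc[of v u "(-1) \<odot> u"] by (simp add: a_comm)

lemma (in cmod) finsum_Times:
  assumes "finite A" "finite B" "\<And>a b. a \<in> A \<Longrightarrow> b \<in> B \<Longrightarrow> f (a, b) \<in> carrier M"
  shows "(\<Oplus>p\<in>A \<times> B. f p) = (\<Oplus>a\<in>A. \<Oplus>b\<in>B. f (a, b))"
  using assms(1,3)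
proof (induct A)
  case (insert x A)
  have "insert x A \<times> B = Pair x ` B \<union> A \<times> B" by auto
  moreover have "(\<Oplus>p\<in>Pair x ` B \<union> A \<times> B. f p) = (\<Oplus>p\<in>Pair x ` B. f p) \<oplus> (\<Oplus>p\<in>A \<times> B. f p)"
    using insert assms(2) by (intro finsum_Un_disjoint) auto
  moreover have "(\<Oplus>p\<in>Pair x ` B. f p) = (\<Oplus>b\<in>B. f (x, b))"
    using insert by (intro finsum_reindex) (auto simp: inj_on_def)
  ultimately show ?case
    using insert by (simp add: Pi_def finsum_closed)
qed simp

context hol_vb
begin

text \<open>The Lagrange polynomial \<open>\<Prod>\<^sub>j (T - \<mu>\<^sub>j) / (\<mu>\<^sub>i - \<mu>\<^sub>j)\<close> evaluated at \<open>g\<close>.\<close>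

primrec lagrange :: "('x \<Rightarrow> 'v \<Rightarrow> 'v) \<Rightarrow> (nat \<Rightarrow> complex) \<Rightarrow> nat \<Rightarrow> nat list \<Rightarrow> 'x \<Rightarrow> 'v \<Rightarrow> 'v" where
  "lagrange g \<mu> i [] = (\<lambda>x v. v)"
| "lagrange g \<mu> i (j # js) = (\<lambda>x v. (1 / (\<mu> i - \<mu> j)) \<odot>\<^bsub>fibre V x\<^esub>
     (g x (lagrange g \<mu> i js x v) \<oplus>\<^bsub>fibre V x\<^esub> (- \<mu> j) \<odot>\<^bsub>fibre V x\<^esub> lagrange g \<mu> i js x v))"

lemma hol_endo_lagrange: "hol_endo g \<Longrightarrow> hol_endo (lagrange g \<mu> i js)"
proof (induct js)
  case Nil
  show ?case using hol_endo_id by simp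
next
  case (Cons j js)
  note h = Cons.hyps[OF Cons.prems]
  show ?case
    unfolding lagrange.simps
    by (rule hol_endo_scale[OF hol_endo_plus[OF hol_endo_comp[OF Cons.prems h] hol_endo_scale[OF h]]])
qed

text \<open>A polynomial in \<open>g\<close> acts on an eigenvector as its value at the
  eigenvalue.\<close>

lemma lagrange_eigen:
  assumes g: "hol_endo g" and w: "w \<in> carrier (fibre V x)" "g x w = c \<odot>\<^bsub>fibre V x\<^esub> w"
  shows "lagrange g \<mu> i js x w = (\<Prod>j\<leftarrow>js. (c - \<mu> j) / (\<mu> i - \<mu> j)) \<odot>\<^bsub>fibre V x\<^esub> w"
proof (induct js)
  case (Cons j js)
  let ?p = "\<Prod>j\<leftarrow>js. (c - \<mu> j) / (\<mu> i - \<mu> j)"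
  have "lagrange g \<mu> i (j # js) x w = (1 / (\<mu> i - \<mu> j)) \<odot>\<^bsub>fibre V x\<^esub>
      ((?p * c) \<odot>\<^bsub>fibre V x\<^esub> w \<oplus>\<^bsub>fibre V x\<^esub> (- \<mu> j * ?p) \<odot>\<^bsub>fibre V x\<^esub> w)"
    using w by (simp add: Cons hol_endo_smult[OF g] fib.smult_mult)
  also have "\<dots> = (1 / (\<mu> i - \<mu> j) * (?p * c + - \<mu> j * ?p)) \<odot>\<^bsub>fibre V x\<^esub> w"
    using w(1) by (simp only: fib.smult_add_l[symmetric] fib.smult_mult)
  also have "1 / (\<mu> i - \<mu> j) * (?p * c + - \<mu> j * ?p) = (\<Prod>j\<leftarrow>j # js. (c - \<mu> j) / (\<mu> i - \<mu> j))"
    by (simp add: algebra_simps diff_divide_distrib)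
  finally show ?case .
qed (use w in simp)

text \<open>Induction along the flag. The map \<open>g\<close> minus its top eigenvalue sends
  \<open>F (Suc m)\<close> into \<open>F m\<close>, where the image of \<open>v\<close> is already a
  sum of eigenvectors. Distinctness of the eigenvalues allows this image to be lifted back inside
  \<open>F m\<close>; the difference between \<open>v\<close> and the lift is killed, hence an
  eigenvector for the top eigenvalue.\<close>

lemma eigen_decomposition:
  assumes F: "weak_filtration V k F" and g: "hol_endo g"
    and gr: "\<And>x i v. i \<in> {1..k} \<Longrightarrow> v \<in> F i x \<Longrightarrow> g x v \<oplus>\<^bsub>fibre V x\<^esub> (- \<mu> i) \<odot>\<^bsub>fibre V x\<^esub> v \<in> F (i - 1) x"
    and inj: "inj_on \<mu> {1..k}" and m: "m \<le> k" and v: "v \<in> F m x"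
  shows "\<exists>w. (\<forall>i\<in>{1..m}. w i \<in> F i x \<and> g x (w i) = \<mu> i \<odot>\<^bsub>fibre V x\<^esub> w i) \<and> v = (\<Oplus>\<^bsub>fibre V x\<^esub>i\<in>{1..m}. w i)"
  using m v
proof (induct m arbitrary: v)
  case 0
  then show ?case using F by (simp add: weak_filtration_def zero_sub_def)
next
  case (Suc m)
  have sub: "subbundle V (F j)" if "j \<le> k" for j using F that by (auto simp: weak_filtration_def)
  note car = subbundle_carrier[OF sub, THEN subsetD]
  have vc: "v \<in> carrier (fibre V x)" using car[OF Suc.prems] .
  let ?\<nu> = "\<mu> (Suc m)"
  define N where "N = (\<lambda>u. g x u \<oplus>\<^bsub>fibre V x\<^esub> (- ?\<nu>) \<odot>\<^bsub>fibre V x\<^esub> u)"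
  have N: "lin_on (fibre V x) (fibre V x) N"
    using hol_endo_plus[OF g hol_endo_scale[OF hol_endo_id, of "- ?\<nu>"]] by (simp add: hol_endo_def N_def)
  have "N v \<in> F m x" using gr[of "Suc m" v x] Suc.prems by (simp add: N_def)
  then have "\<exists>w. (\<forall>i\<in>{1..m}. w i \<in> F i x \<and> g x (w i) = \<mu> i \<odot>\<^bsub>fibre V x\<^esub> w i) \<and> N v = (\<Oplus>\<^bsub>fibre V x\<^esub>i\<in>{1..m}. w i)"
    using Suc.hyps[of "N v"] Suc.prems by simp
  then obtain w where w: "\<And>i. i \<in> {1..m} \<Longrightarrow> w i \<in> F i x" "\<And>i. i \<in> {1..m} \<Longrightarrow> g x (w i) = \<mu> i \<odot>\<^bsub>fibre V x\<^esub> w i"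
      "N v = (\<Oplus>\<^bsub>fibre V x\<^esub>i\<in>{1..m}. w i)"
    by blast
  have wc: "w i \<in> carrier (fibre V x)" if "i \<in> {1..m}" for i
    using car[of i "w i" x] w(1)[OF that] that Suc.prems by auto
  \<comment> \<open>On the \<open>i\<close>-th eigenvector \<open>N\<close> is multiplication by
    \<open>\<mu> i - \<mu> (Suc m)\<close>, so division by this nonzero number inverts it.\<close>
  define z where "z = (\<lambda>i. (1 / (\<mu> i - ?\<nu>)) \<odot>\<^bsub>fibre V x\<^esub> w i)"
  have zc: "z i \<in> carrier (fibre V x)" and zF: "z i \<in> F i x" and zg: "g x (z i) = \<mu> i \<odot>\<^bsub>fibre V x\<^esub> z i"
    and zN: "N (z i) = w i" if i: "i \<in> {1..m}" for i
  proof -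
    show zci: "z i \<in> carrier (fibre V x)" using wc[OF i] by (simp add: z_def)
    show "z i \<in> F i x" using subbundle_smult[OF sub w(1)[OF i]] i Suc.prems by (simp add: z_def)
    show zg: "g x (z i) = \<mu> i \<odot>\<^bsub>fibre V x\<^esub> z i"
      using w(2)[OF i] wc[OF i] by (simp add: z_def hol_endo_smult[OF g] fib.smult_mult mult.commute)
    have ne: "\<mu> i \<noteq> ?\<nu>" using inj_on_eq_iff[OF inj, of i "Suc m"] i Suc.prems by auto
    have "N (z i) = (\<mu> i + - ?\<nu>) \<odot>\<^bsub>fibre V x\<^esub> z i"
      unfolding N_def zg by (rule fib.smult_add_l[OF zci, symmetric])
    also have "\<dots> = ((\<mu> i + - ?\<nu>) * (1 / (\<mu> i - ?\<nu>))) \<odot>\<^bsub>fibre V x\<^esub> w i"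
      unfolding z_def by (rule fib.smult_mult[OF wc[OF i]])
    finally have "N (z i) = ((\<mu> i + - ?\<nu>) * (1 / (\<mu> i - ?\<nu>))) \<odot>\<^bsub>fibre V x\<^esub> w i" .
    then show "N (z i) = w i" using ne wc[OF i] by simp
  qed
  define s where "s = (\<Oplus>\<^bsub>fibre V x\<^esub>i\<in>{1..m}. z i)"
  have sF: "s \<in> F (Suc m) x"
    unfolding s_def
  proof (rule fib.finsum_mem_submodule[OF subbundle_submodule[OF sub]])
    show "z i \<in> F (Suc m) x" if "i \<in> {1..m}" for i
      using zF[OF that] weak_filtration_mono[OF F, of i "Suc m" x] that Suc.prems by auto
  qed (use Suc.prems in simp)
  then have sc: "s \<in> carrier (fibre V x)" using car[of "Suc m"] Suc.prems by auto
  have "N s = (\<Oplus>\<^bsub>fibre V x\<^esub>i\<in>{1..m}. N (z i))"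
    unfolding s_def by (rule lin_on_finsum[OF cmod_fibre cmod_fibre N zc])
  also have "\<dots> = N v"
    unfolding w(3) using wc zN by (intro fib.finsum_cong') auto
  finally have Ns: "N s = N v" .
  \<comment> \<open>Since \<open>N s = N v\<close>, this lies in the kernel of
    \<open>N\<close>.\<close>
  define z' where "z' = v \<oplus>\<^bsub>fibre V x\<^esub> (-1) \<odot>\<^bsub>fibre V x\<^esub> s"
  have z'F: "z' \<in> F (Suc m) x"
    unfolding z'_def using Suc.prems sF by (intro subbundle_add subbundle_smult sub) auto
  have z'c: "z' \<in> carrier (fibre V x)" using vc sc by (simp add: z'_def)
  have "N z' = N v \<oplus>\<^bsub>fibre V x\<^esub> (-1) \<odot>\<^bsub>fibre V x\<^esub> N v"
    using N vc sc Ns by (simp add: z'_def lin_on_def)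
  then have "N z' = \<zero>\<^bsub>fibre V x\<^esub>" using N vc by (simp add: lin_on_def)
  then have z'g: "g x z' = ?\<nu> \<odot>\<^bsub>fibre V x\<^esub> z'"
    using hol_endo_closed[OF g z'c] z'c by (intro fib.eq_smultI) (auto simp: N_def)
  have "v = z' \<oplus>\<^bsub>fibre V x\<^esub> s" using vc sc by (simp add: z'_def fib.add_diff_cancel)
  moreover have "{1..Suc m} = insert (Suc m) {1..m}" by auto
  moreover have "(\<Oplus>\<^bsub>fibre V x\<^esub>i\<in>insert (Suc m) {1..m}. if i = Suc m then z' else z i)
      = z' \<oplus>\<^bsub>fibre V x\<^esub> (\<Oplus>\<^bsub>fibre V x\<^esub>i\<in>{1..m}. if i = Suc m then z' else z i)"
    using z'c zc by (subst fib.finsum_insert) auto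
  moreover have "(\<Oplus>\<^bsub>fibre V x\<^esub>i\<in>{1..m}. if i = Suc m then z' else z i) = s"
    unfolding s_def using zc by (intro fib.finsum_cong') auto
  ultimately have "v = (\<Oplus>\<^bsub>fibre V x\<^esub>i\<in>{1..Suc m}. if i = Suc m then z' else z i)" by simp
  moreover have "\<forall>i\<in>{1..Suc m}. (if i = Suc m then z' else z i) \<in> F i x \<and>
      g x (if i = Suc m then z' else z i) = \<mu> i \<odot>\<^bsub>fibre V x\<^esub> (if i = Suc m then z' else z i)"
    using z'F z'g zF zg by (auto simp: le_Suc_eq)
  ultimately show ?case by (intro exI[of _ "\<lambda>i. if i = Suc m then z' else z i"] conjI)
qed

text \<open>The last two clauses link the projections to the flag: \<open>P i\<close> kills
  \<open>F (i - 1)\<close> and induces the identity on the quotient of \<open>F i\<close> by it.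
  Hence the \<open>i\<close>-th eigenspace is a copy of the \<open>i\<close>-th graded
  piece.\<close>

definition eigen_projections ::
  "nat \<Rightarrow> (nat \<Rightarrow> 'x \<Rightarrow> 'v set) \<Rightarrow> ('x \<Rightarrow> 'v \<Rightarrow> 'v) \<Rightarrow> (nat \<Rightarrow> complex) \<Rightarrow> (nat \<Rightarrow> 'x \<Rightarrow> 'v \<Rightarrow> 'v) \<Rightarrow> bool" where
  "eigen_projections k F g \<mu> P \<longleftrightarrow>
     (\<forall>i\<in>{1..k}. hol_endo (P i)) \<and>
     (\<forall>x. \<forall>v\<in>carrier (fibre V x). v = (\<Oplus>\<^bsub>fibre V x\<^esub>i\<in>{1..k}. P i x v) \<and>
        (\<forall>i\<in>{1..k}. P i x v \<in> F i x \<and> g x (P i x v) = \<mu> i \<odot>\<^bsub>fibre V x\<^esub> P i x v \<and>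
           P i x (g x v) = \<mu> i \<odot>\<^bsub>fibre V x\<^esub> P i x v \<and>
           (\<forall>j\<in>{1..k}. P i x (P j x v) = (if i = j then P i x v else \<zero>\<^bsub>fibre V x\<^esub>)) \<and>
           (\<forall>m<i. v \<in> F m x \<longrightarrow> P i x v = \<zero>\<^bsub>fibre V x\<^esub>) \<and>
           (v \<in> F i x \<longrightarrow> v \<oplus>\<^bsub>fibre V x\<^esub> (-1) \<odot>\<^bsub>fibre V x\<^esub> P i x v \<in> F (i - 1) x)))"

text \<open>Lagrange interpolation polynomials in \<open>g\<close> equal 1 at one eigenvalue and 0
  at the others. On each fibre, a sum of eigenspaces, they are therefore the projections, and as
  polynomials in \<open>g\<close> they are holomorphic.\<close>

lemma eigen_projections_exist:
  assumes F: "weak_filtration V k F" and g: "hol_endo g"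
    and gr: "\<And>x i v. i \<in> {1..k} \<Longrightarrow> v \<in> F i x \<Longrightarrow> g x v \<oplus>\<^bsub>fibre V x\<^esub> (- \<mu> i) \<odot>\<^bsub>fibre V x\<^esub> v \<in> F (i - 1) x"
    and inj: "inj_on \<mu> {1..k}"
  obtains P where "eigen_projections k F g \<mu> P"
proof -
  define P where "P = (\<lambda>i. lagrange g \<mu> i (filter (\<lambda>j. j \<noteq> i) [1..<Suc k]))"
  have sub: "subbundle V (F j)" if "j \<le> k" for j using F that by (auto simp: weak_filtration_def)
  have Fk: "F k x = carrier (fibre V x)" for x using F by (auto simp: weak_filtration_def full_sub_def)
  note car = subbundle_carrier[OF sub, THEN subsetD]
  have P: "hol_endo (P i)" for i unfolding P_def by (rule hol_endo_lagrange[OF g])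
  note Pcl = hol_endo_closed[OF P]
  have Peig: "P i x w = (if i = m then w else \<zero>\<^bsub>fibre V x\<^esub>)"
    if im: "i \<in> {1..k}" "m \<in> {1..k}" and w: "w \<in> carrier (fibre V x)" "g x w = \<mu> m \<odot>\<^bsub>fibre V x\<^esub> w" for i m x w
  proof -
    let ?js = "filter (\<lambda>j. j \<noteq> i) [1..<Suc k]"
    have set: "set ?js = {1..k} - {i}" by auto
    have Pw: "P i x w = (\<Prod>j\<leftarrow>?js. (\<mu> m - \<mu> j) / (\<mu> i - \<mu> j)) \<odot>\<^bsub>fibre V x\<^esub> w"
      unfolding P_def by (rule lagrange_eigen[OF g w])
    show ?thesis
    proof (cases "i = m")
      case True
      have "(\<mu> m - \<mu> j) / (\<mu> i - \<mu> j) = 1" if "j \<in> set ?js" for j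
      proof -
        have "j \<in> {1..k} - {i}" using that unfolding set .
        then have "\<mu> i \<noteq> \<mu> j" using inj_on_eq_iff[OF inj im(1), of j] by auto
        then show ?thesis using True by simp
      qed
      then have "map (\<lambda>j. (\<mu> m - \<mu> j) / (\<mu> i - \<mu> j)) ?js = map (\<lambda>j. 1) ?js"
        by (intro map_cong refl)
      then have "(\<Prod>j\<leftarrow>?js. (\<mu> m - \<mu> j) / (\<mu> i - \<mu> j)) = (\<Prod>j\<leftarrow>?js. 1)" by (simp only:)
      moreover have "(\<Prod>j\<leftarrow>as. 1 :: complex) = 1" for as :: "nat list" by (induct as) auto
      ultimately show ?thesis using Pw True w(1) by simp
    next
      case False
      then have "m \<in> set ?js" unfolding set using im by simp
      then have "(\<mu> m - \<mu> m) / (\<mu> i - \<mu> m) \<in> set (map (\<lambda>j. (\<mu> m - \<mu> j) / (\<mu> i - \<mu> j)) ?js)"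
        unfolding set_map by (rule imageI)
      then have "(\<Prod>j\<leftarrow>?js. (\<mu> m - \<mu> j) / (\<mu> i - \<mu> j)) = 0"
        unfolding prod_list_zero_iff by simp
      then show ?thesis using Pw False w(1) by simp
    qed
  qed
  \<comment> \<open>A vector of \<open>F m\<close> has no components beyond \<open>m\<close>. This
    yields both clauses that relate the projections to the flag.\<close>
  have dec: "\<exists>w. (\<forall>i\<in>{1..m}. w i \<in> F i x \<and> g x (w i) = \<mu> i \<odot>\<^bsub>fibre V x\<^esub> w i \<and> w i \<in> carrier (fibre V x)) \<and>
      v = (\<Oplus>\<^bsub>fibre V x\<^esub>i\<in>{1..m}. w i) \<and>
      (\<forall>i\<in>{1..k}. P i x v = (if i \<le> m then w i else \<zero>\<^bsub>fibre V x\<^esub>))"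
    if m: "m \<le> k" and v: "v \<in> F m x" for m x v
  proof -
    obtain w where w: "\<And>i. i \<in> {1..m} \<Longrightarrow> w i \<in> F i x" "\<And>i. i \<in> {1..m} \<Longrightarrow> g x (w i) = \<mu> i \<odot>\<^bsub>fibre V x\<^esub> w i"
      "v = (\<Oplus>\<^bsub>fibre V x\<^esub>i\<in>{1..m}. w i)"
      using eigen_decomposition[OF F g gr inj m v] by blast
    have wc: "w i \<in> carrier (fibre V x)" if "i \<in> {1..m}" for i
      using car[of i "w i" x] w(1)[OF that] that m by auto
    have "P i x v = (if i \<le> m then w i else \<zero>\<^bsub>fibre V x\<^esub>)" if i: "i \<in> {1..k}" for i
    proof -
      have "P i x v = (\<Oplus>\<^bsub>fibre V x\<^esub>j\<in>{1..m}. P i x (w j))"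
        unfolding w(3) using P[of i] wc by (intro lin_on_finsum[OF cmod_fibre cmod_fibre]) (auto simp: hol_endo_def)
      also have "\<dots> = (\<Oplus>\<^bsub>fibre V x\<^esub>j\<in>{1..m}. if j = i then w j else \<zero>\<^bsub>fibre V x\<^esub>)"
      proof (rule fib.finsum_cong')
        show "P i x (w j) = (if j = i then w j else \<zero>\<^bsub>fibre V x\<^esub>)" if "j \<in> {1..m}" for j
          using Peig[OF i _ wc[OF that] w(2)[OF that]] that m by auto
      qed (use wc in auto)
      also have "\<dots> = (if i \<le> m then w i else \<zero>\<^bsub>fibre V x\<^esub>)"
        using i wc fib.finsum_delta[of "{1..m}" i w x] by (auto intro!: fib.finsum_all_zero)
      finally show ?thesis .
    qed
    then show ?thesis using w wc by blast
  qed
  have "eigen_projections k F g \<mu> P"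
    unfolding eigen_projections_def
  proof (intro conjI ballI allI impI)
    show "hol_endo (P i)" for i by (rule P)
    fix x v assume v: "v \<in> carrier (fibre V x)"
    then have "v \<in> F k x" by (simp add: Fk)
    from dec[OF order_refl this] obtain w where
      "\<forall>j\<in>{1..k}. w j \<in> F j x \<and> g x (w j) = \<mu> j \<odot>\<^bsub>fibre V x\<^esub> w j \<and> w j \<in> carrier (fibre V x)"
      and vw: "v = (\<Oplus>\<^bsub>fibre V x\<^esub>j\<in>{1..k}. w j)"
      and "\<forall>j\<in>{1..k}. P j x v = (if j \<le> k then w j else \<zero>\<^bsub>fibre V x\<^esub>)"
      by (elim exE conjE)
    then have w: "\<And>i. i \<in> {1..k} \<Longrightarrow> w i \<in> F i x" "\<And>i. i \<in> {1..k} \<Longrightarrow> g x (w i) = \<mu> i \<odot>\<^bsub>fibre V x\<^esub> w i"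
      "\<And>i. i \<in> {1..k} \<Longrightarrow> w i \<in> carrier (fibre V x)" "v = (\<Oplus>\<^bsub>fibre V x\<^esub>i\<in>{1..k}. w i)" "\<And>i. i \<in> {1..k} \<Longrightarrow> P i x v = w i"
      by (blast, blast, blast, rule_tac vw, simp)
    show "v = (\<Oplus>\<^bsub>fibre V x\<^esub>i\<in>{1..k}. P i x v)"
      using w(4) fib.finsum_cong'[of "{1..k}" "{1..k}" w x "\<lambda>i. P i x v"] w(3,5) by auto
    fix i assume i: "i \<in> {1..k}"
    show "P i x v \<in> F i x" "g x (P i x v) = \<mu> i \<odot>\<^bsub>fibre V x\<^esub> P i x v"
      using w(1,2,5)[OF i] by simp_all
    show "P i x (P j x v) = (if i = j then P i x v else \<zero>\<^bsub>fibre V x\<^esub>)" if j: "j \<in> {1..k}" for j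
      using w(5)[OF j] Peig[OF i j w(3)[OF j] w(2)[OF j]] by auto
    show "P i x (g x v) = \<mu> i \<odot>\<^bsub>fibre V x\<^esub> P i x v"
    proof -
      have "g x v = (\<Oplus>\<^bsub>fibre V x\<^esub>j\<in>{1..k}. g x (w j))"
        unfolding w(4) using g w(3) by (intro lin_on_finsum[OF cmod_fibre cmod_fibre]) (auto simp: hol_endo_def)
      note gv = this
      have "P i x (g x v) = (\<Oplus>\<^bsub>fibre V x\<^esub>j\<in>{1..k}. P i x (g x (w j)))"
        unfolding gv
        by (rule lin_on_finsum[OF cmod_fibre cmod_fibre])
          (use P[of i] w(3) hol_endo_closed[OF g] in \<open>simp_all add: hol_endo_def\<close>)
      also have "\<dots> = (\<Oplus>\<^bsub>fibre V x\<^esub>j\<in>{1..k}. if j = i then \<mu> j \<odot>\<^bsub>fibre V x\<^esub> w j else \<zero>\<^bsub>fibre V x\<^esub>)"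
      proof (rule fib.finsum_cong')
        show "P i x (g x (w j)) = (if j = i then \<mu> j \<odot>\<^bsub>fibre V x\<^esub> w j else \<zero>\<^bsub>fibre V x\<^esub>)" if j: "j \<in> {1..k}" for j
          using Peig[OF i j w(3)[OF j] w(2)[OF j]] w(3)[OF j] by (auto simp: w(2)[OF j] hol_endo_smult[OF P])
      qed (use w in auto)
      also have "\<dots> = \<mu> i \<odot>\<^bsub>fibre V x\<^esub> w i"
        using i w(3)[OF i] by (intro fib.finsum_delta[of "{1..k}" i "\<lambda>j. \<mu> j \<odot>\<^bsub>fibre V x\<^esub> w j"]) auto
      finally show ?thesis using w(5)[OF i] by simp
    qed
    show "P i x v = \<zero>\<^bsub>fibre V x\<^esub>" if "m < i" "v \<in> F m x" for m
      using dec[of m v x] that i by fastforce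
    show "v \<oplus>\<^bsub>fibre V x\<^esub> (-1) \<odot>\<^bsub>fibre V x\<^esub> P i x v \<in> F (i - 1) x" if vi: "v \<in> F i x"
    proof -
      have "i \<le> k" using i by simp
      from dec[OF this vi] obtain w where
        "\<forall>j\<in>{1..i}. w j \<in> F j x \<and> g x (w j) = \<mu> j \<odot>\<^bsub>fibre V x\<^esub> w j \<and> w j \<in> carrier (fibre V x)"
        and v: "v = (\<Oplus>\<^bsub>fibre V x\<^esub>j\<in>{1..i}. w j)"
        and "\<forall>j\<in>{1..k}. P j x v = (if j \<le> i then w j else \<zero>\<^bsub>fibre V x\<^esub>)"
        by (elim exE conjE)
      then have w: "\<And>j. j \<in> {1..i} \<Longrightarrow> w j \<in> F j x" "\<And>j. j \<in> {1..i} \<Longrightarrow> w j \<in> carrier (fibre V x)"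
        "v = (\<Oplus>\<^bsub>fibre V x\<^esub>j\<in>{1..i}. w j)" "P i x v = w i"
        using i by (blast, blast, rule_tac v, simp)
      obtain i' where i': "i = Suc i'" using i by (cases i) auto
      let ?s = "\<Oplus>\<^bsub>fibre V x\<^esub>j\<in>{1..i'}. w j"
      have s: "?s \<in> F i' x"
      proof (rule fib.finsum_mem_submodule[OF subbundle_submodule[OF sub]])
        show "w j \<in> F i' x" if "j \<in> {1..i'}" for j
          using w(1)[of j] weak_filtration_mono[OF F, of j i' x] that i i' by auto
      qed (use i i' in simp)
      then have sc: "?s \<in> carrier (fibre V x)" using car[of i'] i i' by auto
      \<comment> \<open>Taking away the top component leaves components from earlier members of the
        flag.\<close>
      have "{1..i} = insert i {1..i'}" using i' by auto
      then have "v = w i \<oplus>\<^bsub>fibre V x\<^esub> ?s"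
        using w(2,3) i' by (simp add: Pi_def)
      then have "v \<oplus>\<^bsub>fibre V x\<^esub> (-1) \<odot>\<^bsub>fibre V x\<^esub> P i x v = ?s"
        using fib.add_diff_cancel_left[OF w(2)[of i] sc] w(4) i by simp
      then show ?thesis using s i' by simp
    qed
  qed
  then show thesis by (rule that)
qed

end


section \<open>Polystability\<close>

definition (in higgs) splits_two_step ::
  "('x \<Rightarrow> 'v set) \<Rightarrow> ('x \<Rightarrow> 'v set) \<Rightarrow> ('x \<Rightarrow> 'v \<Rightarrow> nat \<Rightarrow> 'v set) \<Rightarrow> bool" where
  "splits_two_step V1 V2 = splits 3 (two_step_filt V V1 V2) (\<lambda>i. real i - 2)"

section \<open>The isomorphism with the graded bundle\<close>

context hol_vb
begin

text \<open>Projecting before passing to the quotient makes sense for every vector of the fibre,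
  since \<open>P i\<close> takes values in \<open>F i\<close>.\<close>

definition gr_split ::
  "nat \<Rightarrow> (nat \<Rightarrow> 'x \<Rightarrow> 'v set) \<Rightarrow> (nat \<Rightarrow> 'x \<Rightarrow> 'v \<Rightarrow> 'v) \<Rightarrow> 'x \<Rightarrow> 'v \<Rightarrow> nat \<Rightarrow> 'v set" where
  "gr_split k F P = (\<lambda>x. \<lambda>v\<in>carrier (fibre V x). \<lambda>i\<in>{1..k}. F (i - 1) x +>\<^bsub>fibre V x\<^esub> P i x v)"

context
  fixes k :: nat and F :: "nat \<Rightarrow> 'x \<Rightarrow> 'v set" and g :: "'x \<Rightarrow> 'v \<Rightarrow> 'v" and \<mu> :: "nat \<Rightarrow> complex"
    and P :: "nat \<Rightarrow> 'x \<Rightarrow> 'v \<Rightarrow> 'v"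
  assumes F: "weak_filtration V k F" and EP: "eigen_projections k F g \<mu> P"
begin

lemma flag_subbundle: "j \<le> k \<Longrightarrow> subbundle V (F j)"
  using F by (auto simp: weak_filtration_def)

lemma flag_subbundles:
  assumes "i \<in> {1..k}" shows "subbundle V (F i)" "subbundle V (F (i - 1))"
  using flag_subbundle assms by auto

lemma flag_step: "i \<in> {1..k} \<Longrightarrow> F (i - 1) x \<subseteq> F i x"
  using weak_filtration_mono[OF F, of "i - 1" i] by auto

lemma flag_carrier: "u \<in> F i x \<Longrightarrow> i \<le> k \<Longrightarrow> u \<in> carrier (fibre V x)"
  using subbundle_carrier[OF flag_subbundle] by blast

lemma proj_hol_endo: "i \<in> {1..k} \<Longrightarrow> hol_endo (P i)"
  using EP by (simp add: eigen_projections_def)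

lemma proj_sum: "v \<in> carrier (fibre V x) \<Longrightarrow> v = (\<Oplus>\<^bsub>fibre V x\<^esub>i\<in>{1..k}. P i x v)"
  using EP by (simp add: eigen_projections_def)

lemma proj_mem: "i \<in> {1..k} \<Longrightarrow> v \<in> carrier (fibre V x) \<Longrightarrow> P i x v \<in> F i x"
  and endo_proj: "i \<in> {1..k} \<Longrightarrow> v \<in> carrier (fibre V x) \<Longrightarrow> g x (P i x v) = \<mu> i \<odot>\<^bsub>fibre V x\<^esub> P i x v"
  and proj_endo: "i \<in> {1..k} \<Longrightarrow> v \<in> carrier (fibre V x) \<Longrightarrow> P i x (g x v) = \<mu> i \<odot>\<^bsub>fibre V x\<^esub> P i x v"
  using EP unfolding eigen_projections_def by blast+

lemma proj_proj: "i \<in> {1..k} \<Longrightarrow> j \<in> {1..k} \<Longrightarrow> v \<in> carrier (fibre V x) \<Longrightarrow>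
    P i x (P j x v) = (if i = j then P i x v else \<zero>\<^bsub>fibre V x\<^esub>)"
  using EP by (simp add: eigen_projections_def)

lemma proj_eq_zero:
  assumes "i \<in> {1..k}" "m < i" "v \<in> F m x" shows "P i x v = \<zero>\<^bsub>fibre V x\<^esub>"
proof -
  have "m \<le> k" using assms by simp
  from flag_carrier[OF assms(3) this] show ?thesis using EP assms unfolding eigen_projections_def by blast
qed

lemma proj_diff:
  assumes "i \<in> {1..k}" "v \<in> F i x" shows "v \<oplus>\<^bsub>fibre V x\<^esub> (-1) \<odot>\<^bsub>fibre V x\<^esub> P i x v \<in> F (i - 1) x"
proof -
  have "i \<le> k" using assms by simp
  from flag_carrier[OF assms(2) this] show ?thesis using EP assms unfolding eigen_projections_def by blast
qed

lemma proj_closed: "i \<in> {1..k} \<Longrightarrow> v \<in> carrier (fibre V x) \<Longrightarrow> P i x v \<in> carrier (fibre V x)"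
  and proj_add: "i \<in> {1..k} \<Longrightarrow> u \<in> carrier (fibre V x) \<Longrightarrow> v \<in> carrier (fibre V x) \<Longrightarrow>
    P i x (u \<oplus>\<^bsub>fibre V x\<^esub> v) = P i x u \<oplus>\<^bsub>fibre V x\<^esub> P i x v"
  and proj_smult: "i \<in> {1..k} \<Longrightarrow> v \<in> carrier (fibre V x) \<Longrightarrow>
    P i x (c \<odot>\<^bsub>fibre V x\<^esub> v) = c \<odot>\<^bsub>fibre V x\<^esub> P i x v"
  by (simp_all add: hol_endo_closed hol_endo_add hol_endo_smult proj_hol_endo)

lemma gr_split_apply:
  "v \<in> carrier (fibre V x) \<Longrightarrow> i \<in> {1..k} \<Longrightarrow> gr_split k F P x v i = F (i - 1) x +>\<^bsub>fibre V x\<^esub> P i x v"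
  by (simp add: gr_split_def)

lemma gr_split_closed:
  assumes v: "v \<in> carrier (fibre V x)"
  shows "gr_split k F P x v \<in> carrier (dsum_space {1..k} (\<lambda>i. fibre (gr_piece V F i) x))"
proof -
  have "gr_split k F P x v i \<in> carrier (fibre (gr_piece V F i) x)" if i: "i \<in> {1..k}" for i
    unfolding gr_split_apply[OF v i] gr_piece_carrier[where F = F, OF flag_subbundles[OF i] flag_step[OF i]]
    using proj_mem[OF i v] by blast
  then show ?thesis using v by (auto simp: gr_split_def)
qed

text \<open>The \<open>i\<close>-th eigenspace meets \<open>F (i - 1)\<close> only in 0:
  \<open>P i\<close> is the identity on the former and zero on the latter.\<close>

lemma gr_split_zero_iff:
  assumes v: "v \<in> carrier (fibre V x)" and i: "i \<in> {1..k}"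
  shows "gr_split k F P x v i = \<zero>\<^bsub>fibre (gr_piece V F i) x\<^esub> \<longleftrightarrow> P i x v = \<zero>\<^bsub>fibre V x\<^esub>"
proof -
  have "gr_split k F P x v i = \<zero>\<^bsub>fibre (gr_piece V F i) x\<^esub> \<longleftrightarrow> P i x v \<in> F (i - 1) x"
    unfolding gr_split_apply[OF v i] gr_piece_zero by (rule gr_coset_eq_zero_iff[where F = F, OF flag_subbundles flag_step proj_mem]) (use v i in auto)
  also have "\<dots> \<longleftrightarrow> P i x v = \<zero>\<^bsub>fibre V x\<^esub>"
  proof
    assume "P i x v \<in> F (i - 1) x"
    then have "P i x (P i x v) = \<zero>\<^bsub>fibre V x\<^esub>" using i by (intro proj_eq_zero[of i "i - 1"]) auto
    then show "P i x v = \<zero>\<^bsub>fibre V x\<^esub>" using proj_proj[OF i i v] by simp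
  next
    assume "P i x v = \<zero>\<^bsub>fibre V x\<^esub>"
    then show "P i x v \<in> F (i - 1) x" using subbundle_zero_mem[OF flag_subbundles(2)[OF i]] by simp
  qed
  finally show ?thesis .
qed

lemma gr_split_add:
  assumes u: "u \<in> carrier (fibre V x)" and v: "v \<in> carrier (fibre V x)" and i: "i \<in> {1..k}"
  shows "gr_split k F P x (u \<oplus>\<^bsub>fibre V x\<^esub> v) i =
    gr_split k F P x u i \<oplus>\<^bsub>fibre (gr_piece V F i) x\<^esub> gr_split k F P x v i"
  unfolding gr_split_apply[OF u i] gr_split_apply[OF v i] gr_split_apply[OF fib.a_closed[OF u v] i] proj_add[OF i u v]
  by (rule gr_piece_add[OF flag_subbundles[OF i] flag_step[OF i] proj_mem[OF i u] proj_mem[OF i v], symmetric])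

lemma gr_split_smult:
  assumes v: "v \<in> carrier (fibre V x)" and i: "i \<in> {1..k}"
  shows "gr_split k F P x (c \<odot>\<^bsub>fibre V x\<^esub> v) i = c \<odot>\<^bsub>fibre (gr_piece V F i) x\<^esub> gr_split k F P x v i"
  unfolding gr_split_apply[OF v i] gr_split_apply[OF fib.smult_closed'[OF v] i] proj_smult[OF i v]
  by (rule gr_piece_smult[OF flag_subbundles[OF i] flag_step[OF i] proj_mem[OF i v], symmetric])

lemma cmod_gr_sum: "cmod (dsum_space {1..k} (\<lambda>i. fibre (gr_piece V F i) x))"
  by (intro cmod_dsum_space cmod_gr_piece flag_subbundles flag_step)

lemma gr_split_lin_on:
  "lin_on (fibre V x) (dsum_space {1..k} (\<lambda>i. fibre (gr_piece V F i) x)) (gr_split k F P x)"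
  unfolding lin_on_def
proof (intro conjI ballI allI)
  fix u v assume u: "u \<in> carrier (fibre V x)" and v: "v \<in> carrier (fibre V x)"
  show "gr_split k F P x (u \<oplus>\<^bsub>fibre V x\<^esub> v) = gr_split k F P x u \<oplus>\<^bsub>dsum_space {1..k} (\<lambda>i. fibre (gr_piece V F i) x)\<^esub> gr_split k F P x v"
    by (rule dsum_space_eqI[OF gr_split_closed[OF fib.a_closed[OF u v]] abelian_monoid.a_closed[OF abelian_group.axioms(1)[OF module.axioms(2)[OF cmod.module[OF cmod_gr_sum]]] gr_split_closed[OF u] gr_split_closed[OF v]]])
      (simp only: gr_split_add[OF u v] dsum_space_simps restrict_apply' if_True)
next
  fix c v assume v: "v \<in> carrier (fibre V x)"
  show "gr_split k F P x (c \<odot>\<^bsub>fibre V x\<^esub> v) = c \<odot>\<^bsub>dsum_space {1..k} (\<lambda>i. fibre (gr_piece V F i) x)\<^esub> gr_split k F P x v"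
    by (rule dsum_space_eqI[OF gr_split_closed[OF fib.smult_closed'[OF v]] cmod.smult_closed'[OF cmod_gr_sum gr_split_closed[OF v]]])
      (simp only: gr_split_smult[OF v] dsum_space_simps restrict_apply')
qed (rule gr_split_closed)

lemma gr_split_inj:
  "inj_on (gr_split k F P x) (carrier (fibre V x))"
proof (rule inj_onI)
  fix u v assume u: "u \<in> carrier (fibre V x)" and v: "v \<in> carrier (fibre V x)" and eq: "gr_split k F P x u = gr_split k F P x v"
  let ?w = "u \<oplus>\<^bsub>fibre V x\<^esub> (-1) \<odot>\<^bsub>fibre V x\<^esub> v"
  have w: "?w \<in> carrier (fibre V x)" using u v by simp
  have "P i x ?w = \<zero>\<^bsub>fibre V x\<^esub>" if i: "i \<in> {1..k}" for i
  proof -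
    have "gr_split k F P x ?w i = gr_split k F P x v i \<oplus>\<^bsub>fibre (gr_piece V F i) x\<^esub> (-1) \<odot>\<^bsub>fibre (gr_piece V F i) x\<^esub> gr_split k F P x v i"
      using gr_split_add[OF u fib.smult_closed'[OF v] i] gr_split_smult[OF v i] eq by simp
    also have "\<dots> = \<zero>\<^bsub>fibre (gr_piece V F i) x\<^esub>"
      using gr_split_closed[OF v] i by (intro cmod.add_neg[OF cmod_gr_piece[where F = F, OF flag_subbundles flag_step]]) auto
    finally show ?thesis using gr_split_zero_iff[OF w i] by simp
  qed
  then have "?w = \<zero>\<^bsub>fibre V x\<^esub>" using proj_sum[OF w] fib.finsum_all_zero[of "{1..k}" "\<lambda>i. P i x ?w" x] by simp
  then show "u = v" using fib.eq_smultI[OF u v, of 1] v by simp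
qed

lemma gr_split_surj:
  "gr_split k F P x ` carrier (fibre V x) = carrier (dsum_space {1..k} (\<lambda>i. fibre (gr_piece V F i) x))"
proof
  show "gr_split k F P x ` carrier (fibre V x) \<subseteq> carrier (dsum_space {1..k} (\<lambda>i. fibre (gr_piece V F i) x))" using gr_split_closed by blast
  show "carrier (dsum_space {1..k} (\<lambda>i. fibre (gr_piece V F i) x)) \<subseteq> gr_split k F P x ` carrier (fibre V x)"
  proof
    fix C assume C: "C \<in> carrier (dsum_space {1..k} (\<lambda>i. fibre (gr_piece V F i) x))"
    have "\<exists>u. u \<in> F i x \<and> C i = F (i - 1) x +>\<^bsub>fibre V x\<^esub> u" if i: "i \<in> {1..k}" for i
    proof -
      have "C i \<in> carrier (fibre (gr_piece V F i) x)" using C i by auto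
      then show ?thesis unfolding gr_piece_carrier[OF flag_subbundles[OF i] flag_step[OF i]] by blast
    qed
    then obtain u where u: "\<And>i. i \<in> {1..k} \<Longrightarrow> u i \<in> F i x" "\<And>i. i \<in> {1..k} \<Longrightarrow> C i = F (i - 1) x +>\<^bsub>fibre V x\<^esub> u i"
      by metis
    have uc: "u i \<in> carrier (fibre V x)" if "i \<in> {1..k}" for i using flag_carrier[OF u(1)[OF that]] that by simp
    \<comment> \<open>Representatives \<open>u i\<close> are first projected to their eigenspaces;
      this changes them only modulo \<open>F (i - 1)\<close> and keeps them from interfering with
      each other.\<close>
    define v where "v = (\<Oplus>\<^bsub>fibre V x\<^esub>i\<in>{1..k}. P i x (u i))"
    have v: "v \<in> carrier (fibre V x)" unfolding v_def by (intro fib.finsum_closed) (use proj_closed uc in auto)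
    have Pv: "P j x v = P j x (u j)" if j: "j \<in> {1..k}" for j
    proof -
      have "P j x v = (\<Oplus>\<^bsub>fibre V x\<^esub>i\<in>{1..k}. P j x (P i x (u i)))"
        unfolding v_def
        by (rule lin_on_finsum[OF cmod_fibre cmod_fibre hol_endo_lin_on[OF proj_hol_endo[OF j]]]) (use proj_closed uc in auto)
      also have "\<dots> = (\<Oplus>\<^bsub>fibre V x\<^esub>i\<in>{1..k}. if i = j then P i x (u i) else \<zero>\<^bsub>fibre V x\<^esub>)"
        by (rule fib.finsum_cong') (use proj_proj[OF j] proj_closed uc in auto)
      also have "\<dots> = P j x (u j)" using j proj_closed[OF j uc[OF j]] by (intro fib.finsum_delta) auto
      finally show ?thesis .
    qed
    have "gr_split k F P x v = C"
    proof (rule dsum_space_eqI[OF gr_split_closed[OF v] C])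
      fix i assume i: "i \<in> {1..k}"
      have "F (i - 1) x +>\<^bsub>fibre V x\<^esub> u i = F (i - 1) x +>\<^bsub>fibre V x\<^esub> P i x (u i)"
        using gr_coset_eq_iff[OF flag_subbundles[OF i] flag_step[OF i] u(1)[OF i] proj_mem[OF i uc[OF i]]] proj_diff[OF i u(1)[OF i]] by blast
      then show "gr_split k F P x v i = C i" using gr_split_apply[OF v i] Pv[OF i] u(2)[OF i] by simp
    qed
    then show "C \<in> gr_split k F P x ` carrier (fibre V x)" using v by blast
  qed
qed

lemma bundle_iso_gr_split:
  "bundle_iso V (gr_bundle V k F) (gr_split k F P)"
  unfolding bundle_iso_def fibre_gr_bundle
proof (intro conjI allI impI)
  show "gr_split k F P x \<in> lin_maps (fibre V x) (dsum_space {1..k} (\<lambda>i. fibre (gr_piece V F i) x))" for x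
    unfolding lin_maps_iff using gr_split_lin_on by (simp add: gr_split_def)
  show "bij_betw (gr_split k F P x) (carrier (fibre V x)) (carrier (dsum_space {1..k} (\<lambda>i. fibre (gr_piece V F i) x)))" for x
    unfolding bij_betw_def using gr_split_inj gr_split_surj by blast
  fix U s assume "\<forall>x\<in>U. s x \<in> carrier (fibre V x)"
  then have s: "s x \<in> carrier (fibre V x)" if "x \<in> U" for x using that by blast
  show "hsec V U s = hsec (gr_bundle V k F) U (\<lambda>x. gr_split k F P x (s x))"
  proof
    assume hs: "hsec V U s"
    have "hsec (gr_piece V F i) U (\<lambda>x. gr_split k F P x (s x) i)" if i: "i \<in> {1..k}" for i
      unfolding hsec_gr_piece
    proof (intro conjI ballI)
      show "open U" using hsec_open[OF hs] .
      fix x assume "x \<in> U"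
      moreover have "hsec V U (\<lambda>x. P i x (s x))" using proj_hol_endo[OF i] hs by (simp add: hol_endo_def)
      ultimately show "\<exists>U' t. x \<in> U' \<and> U' \<subseteq> U \<and> hsec V U' t \<and> (\<forall>y\<in>U'. t y \<in> F i y) \<and>
          (\<forall>y\<in>U'. gr_split k F P y (s y) i = F (i - 1) y +>\<^bsub>fibre V y\<^esub> t y)"
        using proj_mem[OF i s] gr_split_apply[OF s i] by (intro exI[of _ U] exI[of _ "\<lambda>x. P i x (s x)"]) auto
    qed
    then show "hsec (gr_bundle V k F) U (\<lambda>x. gr_split k F P x (s x))"
      unfolding hsec_gr_bundle using hsec_open[OF hs] gr_split_closed[OF s] by auto
  next
    assume h\<sigma>: "hsec (gr_bundle V k F) U (\<lambda>x. gr_split k F P x (s x))"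
    then have U: "open U" by (simp add: hsec_gr_bundle)
    \<comment> \<open>A section of the graded piece lifts only locally and only up to
      \<open>F (i - 1)\<close>. Applying \<open>P i\<close> removes this ambiguity, so the local
      sections \<open>P i t\<close> agree with \<open>P i s\<close> and glue.\<close>
    have Ps: "hsec V U (\<lambda>x. P i x (s x))" if i: "i \<in> {1..k}" for i
    proof (rule hsec_local[OF U])
      fix x assume x: "x \<in> U"
      have "hsec (gr_piece V F i) U (\<lambda>x. gr_split k F P x (s x) i)" using h\<sigma> i by (simp add: hsec_gr_bundle)
      then obtain U' t where t: "x \<in> U'" "U' \<subseteq> U" "hsec V U' t" "\<And>y. y \<in> U' \<Longrightarrow> t y \<in> F i y"
        "\<And>y. y \<in> U' \<Longrightarrow> gr_split k F P y (s y) i = F (i - 1) y +>\<^bsub>fibre V y\<^esub> t y"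
        unfolding hsec_gr_piece using x by meson
      have "P i y (t y) = P i y (s y)" if y: "y \<in> U'" for y
      proof -
        have sy: "s y \<in> carrier (fibre V y)" using s t(2) y by blast
        have ty: "t y \<in> carrier (fibre V y)" using hsec_carrier[OF t(3) y] .
        let ?d = "P i y (s y) \<oplus>\<^bsub>fibre V y\<^esub> (-1) \<odot>\<^bsub>fibre V y\<^esub> t y"
        have "F (i - 1) y +>\<^bsub>fibre V y\<^esub> P i y (s y) = F (i - 1) y +>\<^bsub>fibre V y\<^esub> t y"
          using gr_split_apply[OF sy i] t(5)[OF y] by simp
        then have "?d \<in> F (i - 1) y"
          using gr_coset_eq_iff[OF flag_subbundles[OF i] flag_step[OF i] proj_mem[OF i sy] t(4)[OF y]] by blast
        then have "P i y ?d = \<zero>\<^bsub>fibre V y\<^esub>" using i by (intro proj_eq_zero[of i "i - 1"]) auto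
        then have "P i y (s y) \<oplus>\<^bsub>fibre V y\<^esub> (-1) \<odot>\<^bsub>fibre V y\<^esub> P i y (t y) = \<zero>\<^bsub>fibre V y\<^esub>"
          using proj_add[OF i proj_closed[OF i sy] fib.smult_closed'[OF ty]] proj_smult[OF i ty] proj_proj[OF i i sy] by simp
        then show ?thesis using fib.eq_smultI[OF proj_closed[OF i sy] proj_closed[OF i ty], of 1] proj_closed[OF i ty] by simp
      qed
      moreover have "hsec V U' (\<lambda>y. P i y (t y))" using proj_hol_endo[OF i] t(3) by (simp add: hol_endo_def)
      ultimately have "hsec V U' (\<lambda>y. P i y (s y))" by (subst (asm) hsec_cong)
      then show "\<exists>U'. x \<in> U' \<and> hsec V U' (\<lambda>y. P i y (s y))" using t(1) by blast
    qed
    have "hsec V U (\<lambda>x. \<Oplus>\<^bsub>fibre V x\<^esub>i\<in>A. P i x (s x))" if "finite A" "A \<subseteq> {1..k}" for A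
      using that
    proof (induct A)
      case empty
      then show ?case using hsec_zero[OF U] by simp
    next
      case (insert a A)
      then have "hsec V U (\<lambda>x. P a x (s x) \<oplus>\<^bsub>fibre V x\<^esub> (\<Oplus>\<^bsub>fibre V x\<^esub>i\<in>A. P i x (s x)))"
        by (intro hsec_add Ps) auto
      moreover have "(\<Oplus>\<^bsub>fibre V x\<^esub>i\<in>insert a A. P i x (s x)) =
          P a x (s x) \<oplus>\<^bsub>fibre V x\<^esub> (\<Oplus>\<^bsub>fibre V x\<^esub>i\<in>A. P i x (s x))" if "x \<in> U" for x
        using insert proj_closed s[OF that] by (intro fib.finsum_insert) auto
      ultimately show ?case by (subst hsec_cong)
    qed
    from this[of "{1..k}"] have "hsec V U (\<lambda>x. \<Oplus>\<^bsub>fibre V x\<^esub>i\<in>{1..k}. P i x (s x))" by simp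
    moreover have "(\<Oplus>\<^bsub>fibre V x\<^esub>i\<in>{1..k}. P i x (s x)) = s x" if "x \<in> U" for x
      using proj_sum[OF s[OF that]] by simp
    ultimately show "hsec V U s" by (subst (asm) hsec_cong)
  qed
qed

lemma pre_gr_gr_split:
  assumes j: "j \<in> {1..k}" shows "F j = pre_gr V k F (gr_split k F P) {1..j}"
proof (intro ext equalityI subsetI)
  fix x v assume v: "v \<in> F j x"
  then have vc: "v \<in> carrier (fibre V x)" using flag_carrier j by simp
  have "gr_split k F P x v i = \<zero>\<^bsub>fibre (gr_piece V F i) x\<^esub>" if "i \<in> {1..k} - {1..j}" for i
    using gr_split_zero_iff[OF vc] proj_eq_zero[of i j v x] v that by auto
  then show "v \<in> pre_gr V k F (gr_split k F P) {1..j} x" using vc by (simp add: pre_gr_def)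
next
  fix x v assume v: "v \<in> pre_gr V k F (gr_split k F P) {1..j} x"
  then have vc: "v \<in> carrier (fibre V x)" by (simp add: pre_gr_def)
  have "(\<Oplus>\<^bsub>fibre V x\<^esub>i\<in>{1..k}. P i x v) \<in> F j x"
  proof (rule fib.finsum_mem_submodule[OF subbundle_submodule[OF flag_subbundle]])
    fix i assume i: "i \<in> {1..k}"
    show "P i x v \<in> F j x"
    proof (cases "i \<le> j")
      case True
      then show ?thesis using proj_mem[OF i vc] weak_filtration_mono[OF F, of i j x] j by auto
    next
      case False
      then have "gr_split k F P x v i = \<zero>\<^bsub>fibre (gr_piece V F i) x\<^esub>" using v i by (auto simp: pre_gr_def)
      then show ?thesis using gr_split_zero_iff[OF vc i] subbundle_zero_mem[OF flag_subbundles(1)[OF j]] by simp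
    qed
  qed (use j in simp)
  then show "v \<in> F j x" using proj_sum[OF vc] by simp
qed

lemma proj_mem_pre_gr:
  assumes i: "i \<in> {1..k}" and v: "v \<in> carrier (fibre V x)"
  shows "P i x v \<in> pre_gr V k F (gr_split k F P) {i} x"
  using gr_split_zero_iff[OF proj_closed[OF i v]] proj_proj[OF _ i v] proj_closed[OF i v] by (auto simp: pre_gr_def)

text \<open>A functional composed with \<open>P i\<close> vanishes on \<open>F (i - 1)\<close> and
  so descends to the \<open>i\<close>-th graded piece.\<close>

lemma pull_proj_mem_dual_gr:
  assumes i: "i \<in> {1..k}" and \<xi>: "\<xi> \<in> carrier (dual_space (fibre V x))"
  shows "pull (fibre V x) (P i x) \<xi> \<in> dual_gr V F (gr_split k F P) i x"
proof -
  have lin: "lin_on (fibre V x) complex_line (pull (fibre V x) (P i x) \<xi>)"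
    using pull_carrier[OF cmod_fibre hol_endo_lin_on[OF proj_hol_endo[OF i]] \<xi>] by (simp add: lin_maps_iff)
  have z: "pull (fibre V x) (P i x) \<xi> w = 0" if w: "w \<in> F (i - 1) x" for w
  proof -
    have "w \<in> carrier (fibre V x)" "P i x w = \<zero>\<^bsub>fibre V x\<^esub>"
      using flag_carrier[OF w] proj_eq_zero[OF i _ w] i by auto
    then show ?thesis
      using lin_on_zero[OF cmod_fibre cmod_complex_line, of x \<xi>] \<xi> by (simp add: pull_def lin_maps_iff)
  qed
  obtain \<eta> where \<eta>: "\<eta> \<in> carrier (dual_space (fibre (gr_piece V F i) x))"
    "\<And>u. u \<in> F i x \<Longrightarrow> \<eta> (F (i - 1) x +>\<^bsub>fibre V x\<^esub> u) = pull (fibre V x) (P i x) \<xi> u"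
    by (rule dual_gr_lift[OF flag_subbundles[OF i] flag_step[OF i] lin z], assumption, rule that)
  have "pull (fibre V x) (P i x) \<xi> v = \<eta> (gr_split k F P x v i)" if v: "v \<in> carrier (fibre V x)" for v
    using \<eta>(2)[OF proj_mem[OF i v]] gr_split_apply[OF v i] proj_proj[OF i i v] v proj_closed[OF i v] by (simp add: pull_def)
  then have "pull (fibre V x) (P i x) \<xi> = (\<lambda>v\<in>carrier (fibre V x). \<eta> (gr_split k F P x v i))"
    by (auto simp: pull_def)
  then show ?thesis using \<eta>(1) unfolding dual_gr_def by blast
qed

text \<open>With a basis \<open>e a\<close> and its coordinate functionals, \<open>y (i, a)\<close>
  is the projection of \<open>e a\<close> by \<open>P i\<close>, and \<open>f (i, a)\<close> the
  transposed projection of the coordinate. Summing over \<open>a\<close> gives \<open>P i\<close>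
  applied twice, hence \<open>P i\<close>; summing over \<open>i\<close> gives the identity. All
  vectors and functionals are eigenvectors, with the same eigenvalue for equal index.\<close>

lemma proj_resolution:
  assumes ge: "hol_endo g"
  shows "\<exists>f y. (\<forall>s\<in>{1..k} \<times> {..<n}. f s \<in> carrier (dual_space (fibre V x)) \<and>
        f s \<in> dual_gr V F (gr_split k F P) (fst s) x \<and>
        y s \<in> pre_gr V k F (gr_split k F P) {fst s} x \<and> y s \<in> carrier (fibre V x) \<and>
        g x (y s) = \<mu> (fst s) \<odot>\<^bsub>fibre V x\<^esub> y s \<and>
        pull (fibre V x) (g x) (f s) = \<mu> (fst s) \<odot>\<^bsub>dual_space (fibre V x)\<^esub> f s) \<and>
      (\<forall>v\<in>carrier (fibre V x). (\<Oplus>\<^bsub>fibre V x\<^esub>s\<in>{1..k} \<times> {..<n}. f s v \<odot>\<^bsub>fibre V x\<^esub> y s) = v)"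
proof -
  obtain e where e: "cbasis (fibre V x) n e" by (rule basis_exists)
  then have ec: "e a \<in> carrier (fibre V x)" if "a < n" for a using that by (simp add: cbasis_def)
  define \<epsilon> where "\<epsilon> = (\<lambda>a. \<lambda>v\<in>carrier (fibre V x). coord (fibre V x) n e v a)"
  have \<epsilon>: "\<epsilon> a \<in> carrier (dual_space (fibre V x))" if "a < n" for a
    using that fib.coord_add[OF e] fib.coord_smult[OF e] by (auto simp: \<epsilon>_def lin_maps_dual_iff)
  define f where "f = (\<lambda>(i, a). pull (fibre V x) (P i x) (\<epsilon> a))"
  define y where "y = (\<lambda>(i, a). P i x (e a))"
  have "f (i, a) \<in> carrier (dual_space (fibre V x)) \<and> f (i, a) \<in> dual_gr V F (gr_split k F P) i x \<and>
      y (i, a) \<in> pre_gr V k F (gr_split k F P) {i} x \<and> y (i, a) \<in> carrier (fibre V x) \<and>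
      g x (y (i, a)) = \<mu> i \<odot>\<^bsub>fibre V x\<^esub> y (i, a) \<and>
      pull (fibre V x) (g x) (f (i, a)) = \<mu> i \<odot>\<^bsub>dual_space (fibre V x)\<^esub> f (i, a)"
    if i: "i \<in> {1..k}" and a: "a < n" for i a
  proof (intro conjI)
    show "f (i, a) \<in> carrier (dual_space (fibre V x))"
      unfolding f_def prod.case by (rule pull_carrier[OF cmod_fibre hol_endo_lin_on[OF proj_hol_endo[OF i]] \<epsilon>[OF a]])
    show "f (i, a) \<in> dual_gr V F (gr_split k F P) i x" unfolding f_def prod.case by (rule pull_proj_mem_dual_gr[OF i \<epsilon>[OF a]])
    show "y (i, a) \<in> pre_gr V k F (gr_split k F P) {i} x" unfolding y_def prod.case by (rule proj_mem_pre_gr[OF i ec[OF a]])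
    show "y (i, a) \<in> carrier (fibre V x)" unfolding y_def prod.case by (rule proj_closed[OF i ec[OF a]])
    show "g x (y (i, a)) = \<mu> i \<odot>\<^bsub>fibre V x\<^esub> y (i, a)" unfolding y_def prod.case by (rule endo_proj[OF i ec[OF a]])
    have "\<epsilon> a (P i x (g x v)) = \<mu> i * \<epsilon> a (P i x v)" if v: "v \<in> carrier (fibre V x)" for v
      using \<epsilon>[OF a] proj_closed[OF i v] unfolding proj_endo[OF i v] by (simp add: lin_maps_dual_iff)
    then show "pull (fibre V x) (g x) (f (i, a)) = \<mu> i \<odot>\<^bsub>dual_space (fibre V x)\<^esub> f (i, a)"
      using hol_endo_closed[OF ge] by (auto simp: f_def pull_def)
  qed
  moreover have "(\<Oplus>\<^bsub>fibre V x\<^esub>s\<in>{1..k} \<times> {..<n}. f s v \<odot>\<^bsub>fibre V x\<^esub> y s) = v" if v: "v \<in> carrier (fibre V x)" for v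
  proof -
    have "(\<Oplus>\<^bsub>fibre V x\<^esub>s\<in>{1..k} \<times> {..<n}. f s v \<odot>\<^bsub>fibre V x\<^esub> y s) =
        (\<Oplus>\<^bsub>fibre V x\<^esub>i\<in>{1..k}. \<Oplus>\<^bsub>fibre V x\<^esub>a\<in>{..<n}. f (i, a) v \<odot>\<^bsub>fibre V x\<^esub> y (i, a))"
      by (rule fib.finsum_Times) (auto simp: y_def proj_closed ec)
    also have "\<dots> = (\<Oplus>\<^bsub>fibre V x\<^esub>i\<in>{1..k}. P i x v)"
    proof (rule fib.finsum_cong')
      fix i assume i: "i \<in> {1..k}"
      \<comment> \<open>Idempotence: the coordinates are those of \<open>P i x v\<close>, and the
        expansion is projected once more.\<close>
      have "P i x v = P i x (\<Oplus>\<^bsub>fibre V x\<^esub>a\<in>{..<n}. coord (fibre V x) n e (P i x v) a \<odot>\<^bsub>fibre V x\<^esub> e a)"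
        using proj_proj[OF i i v] fib.coord_expand[OF e proj_closed[OF i v]] by simp
      also have "\<dots> = (\<Oplus>\<^bsub>fibre V x\<^esub>a\<in>{..<n}. P i x (coord (fibre V x) n e (P i x v) a \<odot>\<^bsub>fibre V x\<^esub> e a))"
        by (rule lin_on_finsum[OF cmod_fibre cmod_fibre hol_endo_lin_on[OF proj_hol_endo[OF i]]]) (simp add: ec)
      also have "\<dots> = (\<Oplus>\<^bsub>fibre V x\<^esub>a\<in>{..<n}. f (i, a) v \<odot>\<^bsub>fibre V x\<^esub> y (i, a))"
        by (rule fib.finsum_cong') (use v proj_closed[OF i v] proj_closed[OF i ec] proj_smult[OF i ec] in \<open>auto simp: f_def y_def pull_def \<epsilon>_def\<close>)
      finally show "(\<Oplus>\<^bsub>fibre V x\<^esub>a\<in>{..<n}. f (i, a) v \<odot>\<^bsub>fibre V x\<^esub> y (i, a)) = P i x v" by simp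
    qed (use proj_closed v in auto)
    also have "\<dots> = v" using proj_sum[OF v] by simp
    finally show ?thesis .
  qed
  ultimately show ?thesis by (intro exI[of _ f] exI[of _ y]) auto
qed

end

end

section \<open>Splittings from infinitesimal automorphisms, and polystability\<close>

context higgs
begin

text \<open>Among -1, 0, 1 the pairs with sum 0 have indices (2,2), (1,3) and (3,1), and the last
  two give the same symmetrized product.\<close>

lemma splits_two_step_iff:
  "splits_two_step V1 V2 \<sigma> \<longleftrightarrow> (let F = two_step_filt V V1 V2 in
     bundle_iso V (gr_bundle V 3 F) \<sigma> \<and>
     V1 = pre_gr V 3 F \<sigma> {1} \<and>
     V2 = pre_gr V 3 F \<sigma> {1, 2} \<and>
     \<beta> \<in> H0 (sub_bundle (L_sym2 X L V) (sub_sum (L_sym2 X L V)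
       {L_tensor_S L V (pre_gr V 3 F \<sigma> {2}) (pre_gr V 3 F \<sigma> {2}),
        L_tensor_S L V (pre_gr V 3 F \<sigma> {1}) (pre_gr V 3 F \<sigma> {3})})) \<and>
     \<gamma> \<in> H0 (sub_bundle (L_sym2_dual L V) (sub_sum (L_sym2_dual L V)
       {L_tensor_S_dual L V (dual_gr V F \<sigma> 2) (dual_gr V F \<sigma> 2),
        L_tensor_S_dual L V (dual_gr V F \<sigma> 1) (dual_gr V F \<sigma> 3)})))"
proof -
  define F where "F = two_step_filt V V1 V2"
  have F: "F 1 = V1" "F 2 = V2" "F 3 = full_sub V" by (simp_all add: F_def two_step_filt_simps)
  \<comment> \<open>The condition on the flag at index 3 holds automatically, leaving those on
    \<open>V1\<close> and \<open>V2\<close>.\<close>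
  have "pre_gr V 3 F \<sigma> {1..3} = full_sub V" by (simp add: pre_gr_def full_sub_def)
  moreover have "{1..3} = {1, 2, 3::nat}" "{1..1} = {1::nat}" "{1..2} = {1, 2::nat}" by auto
  ultimately have "(\<forall>j\<in>{1..3}. F j = pre_gr V 3 F \<sigma> {1..j}) \<longleftrightarrow> V1 = pre_gr V 3 F \<sigma> {1} \<and> V2 = pre_gr V 3 F \<sigma> {1, 2}"
    using F by simp
  moreover have pairs: "{G i j |i j. i \<in> {1..3} \<and> j \<in> {1..3} \<and> (real i - 2) + (real j - 2) = 0} = {G 2 2, G 1 3}"
    if "\<And>i j. G i j = G j i" for G :: "nat \<Rightarrow> nat \<Rightarrow> 'c"
  proof -
    have "i \<in> {1..3} \<and> j \<in> {1..3} \<and> (real i - 2) + (real j - 2) = 0 \<longleftrightarrow>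
        (i, j) \<in> {(2, 2), (1, 3), (3, 1)}" for i j :: nat
      by auto
    then have "{G i j |i j. i \<in> {1..3} \<and> j \<in> {1..3} \<and> (real i - 2) + (real j - 2) = 0} = {G 2 2, G 1 3, G 3 1}"
      by auto
    then show ?thesis using that[of 3 1] by simp
  qed
  ultimately show ?thesis
    unfolding splits_two_step_def splits_def F_def[symmetric] Let_def
      pairs[of "\<lambda>i j. L_tensor_S L V (pre_gr V 3 F \<sigma> {i}) (pre_gr V 3 F \<sigma> {j})", OF L_tensor_S_commute]
      pairs[of "\<lambda>i j. L_tensor_S_dual L V (dual_gr V F \<sigma> i) (dual_gr V F \<sigma> j)", OF L_tensor_S_dual_commute]
    by simp
qed

lemma splits_of_infinitesimal:
  fixes l :: "nat \<Rightarrow> real"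
  assumes F: "weak_filtration V k F" and l: "strict_mono_on {1..k} l" and g: "infinitesimal g"
    and gr: "\<And>x i v. i \<in> {1..k} \<Longrightarrow> v \<in> F i x \<Longrightarrow>
      g x v \<oplus>\<^bsub>fibre V x\<^esub> (- complex_of_real (l i)) \<odot>\<^bsub>fibre V x\<^esub> v \<in> F (i - 1) x"
  obtains \<sigma> where "splits k F l \<sigma>"
proof -
  have ge: "hol_endo g"
    and sk\<beta>: "skew (fibre L x) (dual_space (fibre V x)) (pull (fibre V x) (g x)) (\<beta> x)"
    and sk\<gamma>: "skew (fibre L x) (fibre V x) (g x) (\<gamma> x)" for x
    using g by (simp_all add: infinitesimal_def)
  define \<mu> where "\<mu> = (\<lambda>i. complex_of_real (l i))"
  have inj\<mu>: "inj_on \<mu> {1..k}"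
    unfolding \<mu>_def using inj_on_eq_iff[OF strict_mono_on_imp_inj_on[OF l]] by (intro inj_onI) (simp only: of_real_eq_iff)
  obtain P where EP: "eigen_projections k F g \<mu> P"
    by (rule eigen_projections_exist[OF F ge _ inj\<mu>]) (use gr in \<open>simp_all add: \<mu>_def\<close>)
  define \<sigma> where "\<sigma> = gr_split k F P"
  note iso = bundle_iso_gr_split[OF F EP, folded \<sigma>_def] and flag = pre_gr_gr_split[OF F EP, folded \<sigma>_def]
    and expansion = proj_resolution[OF F EP ge, folded \<sigma>_def]
  have pprec: "pre_gr V k F \<sigma> {i} x \<subseteq> carrier (fibre V x)" for i x by (auto simp: pre_gr_def)
  note dgrc = dual_gr_carrier[OF iso]
  have l0: "l i + l j = 0" if "\<mu> i + \<mu> j = 0" for i j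
    using that unfolding \<mu>_def by (metis of_real_add of_real_eq_0_iff)

  let ?\<B> = "{L_tensor_S L V (pre_gr V k F \<sigma> {i}) (pre_gr V k F \<sigma> {j}) |i j.
          i \<in> {1..k} \<and> j \<in> {1..k} \<and> l i + l j = 0}"
  let ?\<G> = "{L_tensor_S_dual L V (dual_gr V F \<sigma> i) (dual_gr V F \<sigma> j) |i j.
          i \<in> {1..k} \<and> j \<in> {1..k} \<and> l i + l j = 0}"
  have "\<beta> x \<in> sub_sum (L_sym2 X L V) ?\<B> x \<and> \<gamma> x \<in> sub_sum (L_sym2_dual L V) ?\<G> x" for x
  proof -
    let ?M = "fibre V x" and ?N = "fibre L x" and ?S = "{1..k} \<times> {..<n}"
    obtain f y where
      "\<forall>s\<in>?S. f s \<in> carrier (dual_space ?M) \<and> f s \<in> dual_gr V F \<sigma> (fst s) x \<and>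
        y s \<in> pre_gr V k F \<sigma> {fst s} x \<and> y s \<in> carrier ?M \<and> g x (y s) = \<mu> (fst s) \<odot>\<^bsub>?M\<^esub> y s \<and>
        pull ?M (g x) (f s) = \<mu> (fst s) \<odot>\<^bsub>dual_space ?M\<^esub> f s"
      and "\<forall>v\<in>carrier ?M. (\<Oplus>\<^bsub>?M\<^esub>s\<in>?S. f s v \<odot>\<^bsub>?M\<^esub> y s) = v"
      using expansion[of x] by (elim exE conjE)
    then have f: "\<And>s. s \<in> ?S \<Longrightarrow> f s \<in> carrier (dual_space ?M)"
      and fd: "\<And>s. s \<in> ?S \<Longrightarrow> f s \<in> dual_gr V F \<sigma> (fst s) x"
      and yp: "\<And>s. s \<in> ?S \<Longrightarrow> y s \<in> pre_gr V k F \<sigma> {fst s} x"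
      and y: "\<And>s. s \<in> ?S \<Longrightarrow> y s \<in> carrier ?M"
      and gy: "\<And>s. s \<in> ?S \<Longrightarrow> g x (y s) = \<mu> (fst s) \<odot>\<^bsub>?M\<^esub> y s"
      and gf: "\<And>s. s \<in> ?S \<Longrightarrow> pull ?M (g x) (f s) = \<mu> (fst s) \<odot>\<^bsub>dual_space ?M\<^esub> f s"
      and res: "\<And>v. v \<in> carrier ?M \<Longrightarrow> (\<Oplus>\<^bsub>?M\<^esub>s\<in>?S. f s v \<odot>\<^bsub>?M\<^esub> y s) = v"
      by (blast, blast, blast, blast, blast, blast, blast)
    have fst: "fst s \<in> {1..k}" if "s \<in> ?S" for s using that by auto
    define ev where "ev = (\<lambda>s. \<lambda>\<xi>\<in>carrier (dual_space ?M). \<xi> (y s))"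
    have evm: "ev s \<in> evals ?M (pre_gr V k F \<sigma> {fst s} x)" if "s \<in> ?S" for s
      unfolding ev_def evals_def using yp[OF that] by (rule imageI)
    have Bc: "(\<Union>W\<in>?\<B>. W x) \<subseteq> carrier (sym2_dual ?N (dual_space ?M))"
    proof (rule UN_least)
      fix W assume "W \<in> ?\<B>"
      then obtain i j where W: "W = L_tensor_S L V (pre_gr V k F \<sigma> {i}) (pre_gr V k F \<sigma> {j})" by blast
      show "W x \<subseteq> carrier (sym2_dual ?N (dual_space ?M))"
        unfolding W L_tensor_S_def
        by (rule tensor_S_carrier[OF cmod_dual cmod_line evals_carrier[OF cmod_fibre pprec] evals_carrier[OF cmod_fibre pprec]])
    qed
    have Gc: "(\<Union>W\<in>?\<G>. W x) \<subseteq> carrier (sym2_dual ?N ?M)"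
    proof (rule UN_least)
      fix W assume "W \<in> ?\<G>"
      then obtain i j where W: "W = L_tensor_S_dual L V (dual_gr V F \<sigma> i) (dual_gr V F \<sigma> j)" "i \<in> {1..k}" "j \<in> {1..k}" by blast
      show "W x \<subseteq> carrier (sym2_dual ?N ?M)"
        unfolding W(1) L_tensor_S_dual_def
        by (rule tensor_S_carrier[OF cmod_fibre cmod_line dgrc[OF W(2)] dgrc[OF W(3)]])
    qed
    have "\<beta> x \<in> cspan (sym2_dual ?N (dual_space ?M)) (\<Union>W\<in>?\<B>. W x)"
    \<comment> \<open>\<beta> is a form on the dual: the functionals \<open>f s\<close> now play the
      vectors, and evaluations at the \<open>y s\<close> play the functionals.\<close>
    proof (rule sym2_dual_resolution[OF cmod_dual cmod_line \<beta>_carrier _ f _ _ Bc, where f = ev and S = ?S])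
      show "ev s \<in> carrier (dual_space (dual_space ?M))" if "s \<in> ?S" for s
        unfolding ev_def by (rule eval_dual[OF y[OF that] cmod_fibre])
      show "(\<Oplus>\<^bsub>dual_space ?M\<^esub>s\<in>?S. ev s \<xi> \<odot>\<^bsub>dual_space ?M\<^esub> f s) = \<xi>" if "\<xi> \<in> carrier (dual_space ?M)" for \<xi>
        unfolding ev_def by (rule dual_resolution[OF cmod_fibre f y res that])
      fix s t assume s: "s \<in> ?S" and t: "t \<in> ?S" and nz: "\<beta> x (f s) (f t) \<noteq> \<zero>\<^bsub>?N\<^esub>"
      have "\<mu> (fst s) + \<mu> (fst t) = 0"
        using nz skew_eigen[OF cmod_dual cmod_line \<beta>_carrier sk\<beta> f[OF s] f[OF t] gf[OF s] gf[OF t]] by blast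
      then have "L_tensor_S L V (pre_gr V k F \<sigma> {fst s}) (pre_gr V k F \<sigma> {fst t}) \<in> ?\<B>"
        using l0 fst[OF s] fst[OF t] by blast
      moreover have "sym_prod ?N (dual_space ?M) (\<beta> x (f s) (f t)) (ev s) (ev t)
          \<in> L_tensor_S L V (pre_gr V k F \<sigma> {fst s}) (pre_gr V k F \<sigma> {fst t}) x"
        unfolding L_tensor_S_def
        by (rule sym_prod_mem_tensor_S[OF sym2_dual_bilinear(1)[OF \<beta>_carrier f[OF s] f[OF t]] evm[OF s] evm[OF t]])
      ultimately show "sym_prod ?N (dual_space ?M) (\<beta> x (f s) (f t)) (ev s) (ev t)
          \<in> cspan (sym2_dual ?N (dual_space ?M)) (\<Union>W\<in>?\<B>. W x)"
        by (intro cspan_base UN_I)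
    qed (assumption | intro finite_cartesian_product finite_atLeastAtMost finite_lessThan)+
    moreover have "\<gamma> x \<in> cspan (sym2_dual ?N ?M) (\<Union>W\<in>?\<G>. W x)"
    proof (rule sym2_dual_resolution[OF cmod_fibre cmod_line \<gamma>_carrier f y res _ Gc])
      fix s t assume s: "s \<in> ?S" and t: "t \<in> ?S" and nz: "\<gamma> x (y s) (y t) \<noteq> \<zero>\<^bsub>?N\<^esub>"
      have "\<mu> (fst s) + \<mu> (fst t) = 0"
        using nz skew_eigen[OF cmod_fibre cmod_line \<gamma>_carrier sk\<gamma> y[OF s] y[OF t] gy[OF s] gy[OF t]] by blast
      then have "L_tensor_S_dual L V (dual_gr V F \<sigma> (fst s)) (dual_gr V F \<sigma> (fst t)) \<in> ?\<G>"
        using l0 fst[OF s] fst[OF t] by blast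
      moreover have "sym_prod ?N ?M (\<gamma> x (y s) (y t)) (f s) (f t)
          \<in> L_tensor_S_dual L V (dual_gr V F \<sigma> (fst s)) (dual_gr V F \<sigma> (fst t)) x"
        unfolding L_tensor_S_dual_def
        by (rule sym_prod_mem_tensor_S[OF sym2_dual_bilinear(1)[OF \<gamma>_carrier y[OF s] y[OF t]] fd[OF s] fd[OF t]])
      ultimately show "sym_prod ?N ?M (\<gamma> x (y s) (y t)) (f s) (f t) \<in> cspan (sym2_dual ?N ?M) (\<Union>W\<in>?\<G>. W x)"
        by (intro cspan_base UN_I)
    qed (assumption | intro finite_cartesian_product finite_atLeastAtMost finite_lessThan)+
    ultimately show ?thesis
      unfolding sub_sum_def fibre_L_sym2 fibre_L_sym2_dual by blast
  qed
  then have "splits k F l \<sigma>"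
    unfolding splits_def in_H0_sub_bundle using iso flag \<beta> \<gamma> by blast
  then show thesis by (rule that)
qed

text \<open>Every level has excess 0, so its two-step flag splits; the endomorphisms of the levels
  are then added with the gaps as coefficients, as the weights are.\<close>

lemma splits_if_two_step_splits:
  assumes wf: "weighted_filtration V k F l" and nt: "\<not> trivial_weighted k l"
    and N: "in_H0_N X L V \<beta> \<gamma> k F l" and d: "d_filt X V k F l \<alpha> = 0"
    and ss: "alpha_semistable X L V \<beta> \<gamma> \<alpha>"
    and split: "\<And>V1 V2. two_step V V1 V2 \<Longrightarrow> dagger X L V \<beta> \<gamma> V1 V2 \<Longrightarrow>
      \<not> (V1 = zero_sub V \<and> V2 = full_sub V) \<Longrightarrow> deg_excess V1 V2 = 0 \<Longrightarrow> \<exists>\<sigma>. splits_two_step V1 V2 \<sigma>"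
  obtains \<sigma> where "splits k F l \<sigma>"
proof -
  have F: "filtration V k F" and l: "strict_mono_on {1..k} l"
    using wf by (auto simp: weighted_filtration_def)
  have sub: "subbundle V (F j)" if "j \<le> k" for j using F that by (auto simp: filtration_def)
  have Fk: "F k x = carrier (fibre V x)" for x using F by (auto simp: filtration_def full_sub_def)
  obtain R t where Rt: "R > 0" "\<And>r. r < R \<Longrightarrow> 0 \<le> t r" "\<And>r. r < R \<Longrightarrow> t r < t (Suc r)"
    "\<And>r. r < R \<Longrightarrow> \<not> (F (cut_low k l (t r)) = zero_sub V \<and> F (cut_up k l (t r)) = full_sub V)"
    "\<And>j. j \<in> {1..k} \<Longrightarrow> l j = (\<Sum>r<R. (t (Suc r) - t r) * sgn_cut (t r) (l j))"
    "d_filt X V k F l \<alpha> = (\<Sum>r<R. (t (Suc r) - t r) * deg_excess (F (cut_low k l (t r))) (F (cut_up k l (t r))))"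
    by (rule d_filt_layers[OF wf nt], rule that)
  \<comment> \<open>\<open>g\<close> acts on the \<open>i\<close>-th quotient of the flag as the
    scalar \<open>c i\<close>. The pairs \<open>(g, c)\<close> of this kind are closed under real
    linear combinations.\<close>
  define graded :: "('x \<Rightarrow> 'v \<Rightarrow> 'v) \<Rightarrow> (nat \<Rightarrow> real) \<Rightarrow> bool" where
    "graded = (\<lambda>g c. \<forall>x. \<forall>i\<in>{1..k}. \<forall>v\<in>F i x. g x v \<oplus>\<^bsub>fibre V x\<^esub> (- complex_of_real (c i)) \<odot>\<^bsub>fibre V x\<^esub> v \<in> F (i - 1) x)"
  have layer: "\<exists>g. infinitesimal g \<and> graded g (\<lambda>i. sgn_cut (t r) (l i))" if r: "r < R" for r
  proof -
    let ?p = "cut_low k l (t r)" and ?q = "cut_up k l (t r)"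
    have pq: "?p \<le> ?q" "?p \<le> k" "?q \<le> k"
      using cut_low_le_up[OF Rt(2)[OF r]] cut_low_le[OF l] cut_up_le[OF l] by auto
    note ts = dagger_cut(1)[OF wf N Rt(2)[OF r]] and dg = dagger_cut(2)[OF wf N Rt(2)[OF r]]
    \<comment> \<open>By semistability all terms of the sum for \<open>d_filt\<close> are
      nonnegative; their total is 0, so each is 0.\<close>
    have "(t (Suc r) - t r) * deg_excess (F ?p) (F ?q) = 0"
    proof -
      have "0 \<le> (t (Suc r) - t r) * deg_excess (F (cut_low k l (t r))) (F (cut_up k l (t r)))" if "r \<in> {..<R}" for r
        using that Rt(2,3)[of r] alpha_semistableD[OF ss dagger_cut[OF wf N]] by (intro mult_nonneg_nonneg) auto
      from sum_nonneg_eq_0_iff[OF finite_lessThan this] show ?thesis using Rt(6) d r by simp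
    qed
    then have "deg_excess (F ?p) (F ?q) = 0" using Rt(3)[OF r] by simp
    then obtain \<sigma> where \<sigma>: "splits 3 (two_step_filt V (F ?p) (F ?q)) (\<lambda>i. real i - 2) \<sigma>"
      using split[OF ts dg Rt(4)[OF r]] by (auto simp: splits_two_step_def)
    obtain g where g: "infinitesimal g"
      and gr: "\<And>x i v. i \<in> {1..3} \<Longrightarrow> v \<in> two_step_filt V (F ?p) (F ?q) i x \<Longrightarrow>
        g x v \<oplus>\<^bsub>fibre V x\<^esub> (- complex_of_real (real i - 2)) \<odot>\<^bsub>fibre V x\<^esub> v \<in> two_step_filt V (F ?p) (F ?q) (i - 1) x"
      by (rule infinitesimal_of_splits[OF two_step_filt_weak[OF ts] \<sigma>], rule that)
    \<comment> \<open>The weights -1, 0, 1 say that \<open>g\<close> is -1 on the lower member, maps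
      the upper member into the lower one, and is the identity modulo the upper member.\<close>
    have gp: "g x v \<oplus>\<^bsub>fibre V x\<^esub> v = \<zero>\<^bsub>fibre V x\<^esub>" if "v \<in> F ?p x" for x v
      using gr[of 1 v x] that subbundle_carrier[OF sub[OF pq(2)], of x] by (auto simp: two_step_filt_def zero_sub_def)
    have gq: "g x v \<in> F ?p x" if "v \<in> F ?q x" for x v
      using gr[of 2 v x] that subbundle_carrier[OF sub[OF pq(3)], of x] hol_endo_closed[of g v x] g
      by (auto simp: two_step_filt_def infinitesimal_def subset_iff)
    have gv: "g x v \<oplus>\<^bsub>fibre V x\<^esub> (-1) \<odot>\<^bsub>fibre V x\<^esub> v \<in> F ?q x" if "v \<in> carrier (fibre V x)" for x v
      using gr[of 3 v x] that by (simp add: two_step_filt_def full_sub_def)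
    have "g x v \<oplus>\<^bsub>fibre V x\<^esub> (- complex_of_real (sgn_cut (t r) (l i))) \<odot>\<^bsub>fibre V x\<^esub> v \<in> F (i - 1) x"
      if i: "i \<in> {1..k}" and v: "v \<in> F i x" for i x v
    proof -
      have vc: "v \<in> carrier (fibre V x)" using v subbundle_carrier[OF sub[of i]] i by auto
      have gc: "g x v \<in> carrier (fibre V x)" using hol_endo_closed[OF _ vc] g by (simp add: infinitesimal_def)
      \<comment> \<open>The result lands in 0, in the lower member or in the upper member
        respectively, and by the choice of the cut indices each of these is contained in
        \<open>F (i - 1)\<close>.\<close>
      consider "l i < - t r" | "- t r \<le> l i" "l i \<le> t r" | "l i > t r" by linarith
      then show ?thesis
      proof cases
        case 1
        then have "i \<le> ?p" using cut_low_iff[OF l i] by simp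
        then have "g x v \<oplus>\<^bsub>fibre V x\<^esub> v = \<zero>\<^bsub>fibre V x\<^esub>" using gp v filtration_mono[OF F _ pq(2)] by blast
        moreover have "sgn_cut (t r) (l i) = -1" using 1 Rt(2)[OF r] by (simp add: sgn_cut_def)
        moreover have "i - 1 \<le> k" using i by auto
        ultimately show ?thesis using vc subbundle_zero_mem[OF sub, of "i - 1"] by simp
      next
        case 2
        then have "i \<le> ?q" "?p \<le> i - 1" using cut_low_iff[OF l i, of "t r"] cut_up_iff[OF l i, of "t r"] by auto
        moreover have "i - 1 \<le> k" using i by auto
        ultimately have "g x v \<in> F (i - 1) x"
          using gq[of v x] v filtration_mono[OF F _ pq(3)] filtration_mono[OF F, of ?p "i - 1" x] by blast
        moreover have "sgn_cut (t r) (l i) = 0" using 2 by (simp add: sgn_cut_def)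
        ultimately show ?thesis using vc gc by simp
      next
        case 3
        then have "?q \<le> i - 1" using cut_up_iff[OF l i, of "t r"] by auto
        then have "g x v \<oplus>\<^bsub>fibre V x\<^esub> (-1) \<odot>\<^bsub>fibre V x\<^esub> v \<in> F (i - 1) x"
          using gv[OF vc] filtration_mono[OF F, of ?q "i - 1" x] i by fastforce
        moreover have "sgn_cut (t r) (l i) = 1" using 3 by (simp add: sgn_cut_def)
        ultimately show ?thesis by simp
      qed
    qed
    then show ?thesis using g unfolding graded_def by blast
  qed
  have combine: "\<exists>g. infinitesimal g \<and> graded g (\<lambda>i. \<Sum>r<m. (t (Suc r) - t r) * sgn_cut (t r) (l i))" if "m \<le> R" for m
    using that
  proof (induct m)
    case 0
    have "graded (\<lambda>x u. \<zero>\<^bsub>fibre V x\<^esub>) (\<lambda>i. 0)"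
      unfolding graded_def using subbundle_carrier[OF sub] subbundle_zero_mem[OF sub] by (auto simp: subset_iff)
    then show ?case using infinitesimal_zero by auto
  next
    case (Suc m)
    let ?c = "complex_of_real (t (Suc m) - t m)"
    obtain g where g: "infinitesimal g" "graded g (\<lambda>i. \<Sum>r<m. (t (Suc r) - t r) * sgn_cut (t r) (l i))"
      using Suc by auto
    obtain h where h: "infinitesimal h" "graded h (\<lambda>i. sgn_cut (t m) (l i))"
      using layer[of m] Suc.prems by auto
    have "infinitesimal (\<lambda>x u. g x u \<oplus>\<^bsub>fibre V x\<^esub> ?c \<odot>\<^bsub>fibre V x\<^esub> h x u)"
      by (rule infinitesimal_add[OF g(1) infinitesimal_smult[OF h(1)]])
    moreover have "graded (\<lambda>x u. g x u \<oplus>\<^bsub>fibre V x\<^esub> ?c \<odot>\<^bsub>fibre V x\<^esub> h x u)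
        (\<lambda>i. \<Sum>r<Suc m. (t (Suc r) - t r) * sgn_cut (t r) (l i))"
      unfolding graded_def
    proof (intro allI ballI)
      fix x i v assume i: "i \<in> {1..k}" and v: "v \<in> F i x"
      have vc: "v \<in> carrier (fibre V x)" using v subbundle_carrier[OF sub[of i]] i by auto
      have gc: "g x v \<in> carrier (fibre V x)" and hc: "h x v \<in> carrier (fibre V x)"
        using hol_endo_closed[OF _ vc] g(1) h(1) by (simp_all add: infinitesimal_def)
      let ?a = "complex_of_real (\<Sum>r<m. (t (Suc r) - t r) * sgn_cut (t r) (l i))"
        and ?b = "complex_of_real (sgn_cut (t m) (l i))"
      have s1: "subbundle V (F (i - 1))" by (rule sub) (use i in auto)
      have "(g x v \<oplus>\<^bsub>fibre V x\<^esub> (- ?a) \<odot>\<^bsub>fibre V x\<^esub> v) \<oplus>\<^bsub>fibre V x\<^esub>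
          ?c \<odot>\<^bsub>fibre V x\<^esub> (h x v \<oplus>\<^bsub>fibre V x\<^esub> (- ?b) \<odot>\<^bsub>fibre V x\<^esub> v) \<in> F (i - 1) x"
        using g(2) h(2) i v unfolding graded_def
        by (rule_tac subbundle_add[OF s1 _ subbundle_smult[OF s1]]) blast+
      also have "(g x v \<oplus>\<^bsub>fibre V x\<^esub> (- ?a) \<odot>\<^bsub>fibre V x\<^esub> v) \<oplus>\<^bsub>fibre V x\<^esub>
          ?c \<odot>\<^bsub>fibre V x\<^esub> (h x v \<oplus>\<^bsub>fibre V x\<^esub> (- ?b) \<odot>\<^bsub>fibre V x\<^esub> v)
        = (g x v \<oplus>\<^bsub>fibre V x\<^esub> ?c \<odot>\<^bsub>fibre V x\<^esub> h x v) \<oplus>\<^bsub>fibre V x\<^esub>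
          ((- ?a) \<odot>\<^bsub>fibre V x\<^esub> v \<oplus>\<^bsub>fibre V x\<^esub> (?c * (- ?b)) \<odot>\<^bsub>fibre V x\<^esub> v)"
        using vc gc hc by (simp add: fib.smult_add_r fib.smult_mult fib.a_ac)
      also have "(- ?a) \<odot>\<^bsub>fibre V x\<^esub> v \<oplus>\<^bsub>fibre V x\<^esub> (?c * (- ?b)) \<odot>\<^bsub>fibre V x\<^esub> v
          = (- complex_of_real (\<Sum>r<Suc m. (t (Suc r) - t r) * sgn_cut (t r) (l i))) \<odot>\<^bsub>fibre V x\<^esub> v"
        unfolding fib.smult_add_l[OF vc, symmetric] by simp
      finally show "(g x v \<oplus>\<^bsub>fibre V x\<^esub> ?c \<odot>\<^bsub>fibre V x\<^esub> h x v) \<oplus>\<^bsub>fibre V x\<^esub>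
          (- complex_of_real (\<Sum>r<Suc m. (t (Suc r) - t r) * sgn_cut (t r) (l i))) \<odot>\<^bsub>fibre V x\<^esub> v \<in> F (i - 1) x" .
    qed
    ultimately show ?case by blast
  qed
  obtain g where g: "infinitesimal g" "graded g (\<lambda>i. \<Sum>r<R. (t (Suc r) - t r) * sgn_cut (t r) (l i))"
    using combine[of R] by auto
  show thesis
  proof (rule splits_of_infinitesimal[OF filtration_weak[OF F] l g(1)])
    show "g x v \<oplus>\<^bsub>fibre V x\<^esub> (- complex_of_real (l i)) \<odot>\<^bsub>fibre V x\<^esub> v \<in> F (i - 1) x"
      if "i \<in> {1..k}" "v \<in> F i x" for x i v
    proof -
      have "g x v \<oplus>\<^bsub>fibre V x\<^esub> (- complex_of_real (\<Sum>r<R. (t (Suc r) - t r) * sgn_cut (t r) (l i))) \<odot>\<^bsub>fibre V x\<^esub> v \<in> F (i - 1) x"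
        using g(2) that unfolding graded_def by blast
      then show ?thesis by (simp only: Rt(5)[OF that(1), symmetric])
    qed
  qed (rule that)
qed

text \<open>Polystability splits the reduced filtration. The endomorphism of that splitting is then
  tested on the original flag with repetitions and produces a splitting of it into three pieces,
  some of which may be zero.\<close>

lemma two_step_splits_if_polystable:
  assumes ps: "alpha_polystable X L V \<beta> \<gamma> \<alpha>"
    and ts: "two_step V V1 V2" and dg: "dagger X L V \<beta> \<gamma> V1 V2"
    and nt: "\<not> (V1 = zero_sub V \<and> V2 = full_sub V)" and ex: "deg_excess V1 V2 = 0"
  obtains \<sigma> where "splits_two_step V1 V2 \<sigma>"
proof -
  define W where "W = two_step_filt V V1 V2"
  obtain k F l j where red: "reduced_two_step V1 V2 k F l j"
    by (rule reduced_two_step_exists[OF ts nt])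
  have wf: "weighted_filtration V k F l" and ntl: "\<not> trivial_weighted k l" and d: "d_filt X V k F l \<alpha> = 0"
    using red ex by (simp_all add: reduced_two_step_def)
  have F: "weak_filtration V k F" using wf by (simp add: weighted_filtration_def filtration_weak)
  have j: "j m \<in> {1..3}" "l m = real (j m) - 2" "F m = W (j m)" "F (m - 1) = W (j m - 1)"
    if "m \<in> {1..k}" for m
    using red that by (simp_all add: reduced_two_step_def W_def)
  have piv: "\<exists>M\<le>k. W i = F M \<and> (\<forall>m\<in>{1..k}. m \<le> M \<longleftrightarrow> j m \<le> i)" if "i \<le> 3" for i
    using red that by (simp add: reduced_two_step_def W_def)
  have subW: "subbundle V (W i)" for i
    using two_step_filt_subbundle[OF ts] by (simp add: W_def)
  have "in_H0_N X L V \<beta> \<gamma> k F l" by (rule reduced_in_H0_N[OF ts dg red])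
  then obtain \<sigma> where \<sigma>: "splits k F l \<sigma>"
    using ps wf ntl d unfolding alpha_polystable_def splits_def by blast
  obtain g where g: "infinitesimal g" and gr: "\<And>x i v. i \<in> {1..k} \<Longrightarrow> v \<in> F i x \<Longrightarrow>
      g x v \<oplus>\<^bsub>fibre V x\<^esub> (- complex_of_real (l i)) \<odot>\<^bsub>fibre V x\<^esub> v \<in> F (i - 1) x"
    by (rule infinitesimal_of_splits[OF F \<sigma>], rule that)
  have "g x v \<oplus>\<^bsub>fibre V x\<^esub> (- complex_of_real (real i - 2)) \<odot>\<^bsub>fibre V x\<^esub> v \<in> W (i - 1) x"
    if i: "i \<in> {1..3}" and v: "v \<in> W i x" for i x v
  proof (cases "i \<in> j ` {1..k}")
    case True
    then obtain m where m: "m \<in> {1..k}" "i = j m" by blast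
    then show ?thesis using gr[OF m(1)] v j[OF m(1)] by simp
  next
    \<comment> \<open>Index \<open>i\<close> was dropped, so \<open>W (i - 1)\<close> equals
      \<open>W i\<close>, and the claim reduces to \<open>g\<close> preserving
      \<open>W i\<close>.\<close>
    case False
    have i3: "i \<le> 3" "i - 1 \<le> 3" using i by auto
    obtain M where M: "M \<le> k" "W i = F M" "\<forall>m\<in>{1..k}. m \<le> M \<longleftrightarrow> j m \<le> i" using piv[OF i3(1)] by blast
    obtain M' where M': "M' \<le> k" "W (i - 1) = F M'" "\<forall>m\<in>{1..k}. m \<le> M' \<longleftrightarrow> j m \<le> i - 1"
      using piv[OF i3(2)] by blast
    have iff: "m \<le> M \<longleftrightarrow> m \<le> M'" if m: "m \<in> {1..k}" for m
    proof -
      have "j m \<noteq> i" using False m by auto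
      then have "j m \<le> i \<longleftrightarrow> j m \<le> i - 1" using i by auto
      then show ?thesis using M(3) M'(3) m by blast
    qed
    \<comment> \<open>The equivalence speaks of positions from 1 to \<open>k\<close> only, so
      position 0 is treated apart.\<close>
    have "M = M'"
    proof (rule antisym)
      show "M \<le> M'" using iff[of M] M(1) by (cases "M = 0") auto
      show "M' \<le> M" using iff[of M'] M'(1) by (cases "M' = 0") auto
    qed
    then have eq: "W (i - 1) = W i" using M M' by simp
    have vc: "v \<in> carrier (fibre V x)" using subbundle_carrier[OF subW] v by blast
    have "g x v \<in> W i x"
    \<comment> \<open>At position 0 the member is the zero bundle. At a later position
      \<open>M\<close>, \<open>g\<close> is a scalar on \<open>F M\<close> modulo
      \<open>F (M - 1)\<close>, hence preserves \<open>F M\<close>.\<close>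
    proof (cases "M = 0")
      case True
      then have "v = \<zero>\<^bsub>fibre V x\<^esub>" using v M(2) F by (simp add: weak_filtration_def zero_sub_def)
      then have "g x v = \<zero>\<^bsub>fibre V x\<^esub>"
        using g lin_on_zero[OF cmod_fibre cmod_fibre hol_endo_lin_on] by (simp add: infinitesimal_def)
      then show ?thesis using subbundle_zero_mem[OF subW] by simp
    next
      case False
      then have Mk: "M \<in> {1..k}" using M(1) by simp
      let ?c = "complex_of_real (l M)"
      have "g x v \<oplus>\<^bsub>fibre V x\<^esub> (- ?c) \<odot>\<^bsub>fibre V x\<^esub> v \<in> W i x"
        using gr[OF Mk, of v x] v M(1,2) weak_filtration_mono[OF F, of "M - 1" M x] by auto
      then have gin: "(g x v \<oplus>\<^bsub>fibre V x\<^esub> (- ?c) \<odot>\<^bsub>fibre V x\<^esub> v) \<oplus>\<^bsub>fibre V x\<^esub> ?c \<odot>\<^bsub>fibre V x\<^esub> v \<in> W i x"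
        by (rule subbundle_add[OF subW _ subbundle_smult[OF subW v]])
      have gc: "g x v \<in> carrier (fibre V x)"
        using hol_endo_closed[OF _ vc] g by (simp add: infinitesimal_def)
      have "(g x v \<oplus>\<^bsub>fibre V x\<^esub> (- ?c) \<odot>\<^bsub>fibre V x\<^esub> v) \<oplus>\<^bsub>fibre V x\<^esub> ?c \<odot>\<^bsub>fibre V x\<^esub> v = g x v"
        unfolding fib.a_assoc[OF gc fib.smult_closed'[OF vc] fib.smult_closed'[OF vc]] fib.smult_add_l[OF vc, symmetric]
        using vc gc by simp
      with gin show ?thesis by simp
    qed
    then show ?thesis
      unfolding eq by (rule subbundle_add[OF subW _ subbundle_smult[OF subW v]])
  qed
  moreover have "strict_mono_on {1..3} (\<lambda>i. real i - 2)" by (simp add: strict_mono_on_def)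
  moreover have "weak_filtration V 3 W" unfolding W_def by (rule two_step_filt_weak[OF ts])
  ultimately obtain \<tau> where "splits 3 W (\<lambda>i. real i - 2) \<tau>"
    using splits_of_infinitesimal[OF _ _ g, of 3 W "\<lambda>i. real i - 2"] by blast
  then show thesis
    using that by (simp add: splits_two_step_def W_def)
qed

lemma polystable_iff_two_step:
  "alpha_polystable X L V \<beta> \<gamma> \<alpha> \<longleftrightarrow> alpha_semistable X L V \<beta> \<gamma> \<alpha> \<and>
     (\<forall>V1 V2. two_step V V1 V2 \<and> dagger X L V \<beta> \<gamma> V1 V2 \<and> \<not> (V1 = zero_sub V \<and> V2 = full_sub V) \<and>
        deg_excess V1 V2 = 0 \<longrightarrow> (\<exists>\<sigma>. splits_two_step V1 V2 \<sigma>))"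
proof (intro iffI conjI allI impI; (elim conjE)?)
  assume ps: "alpha_polystable X L V \<beta> \<gamma> \<alpha>"
  then show "alpha_semistable X L V \<beta> \<gamma> \<alpha>" by (simp add: alpha_polystable_def)
  fix V1 V2 assume a: "two_step V V1 V2" "dagger X L V \<beta> \<gamma> V1 V2"
    "\<not> (V1 = zero_sub V \<and> V2 = full_sub V)" "deg_excess V1 V2 = 0"
  show "\<exists>\<sigma>. splits_two_step V1 V2 \<sigma>"
    by (rule two_step_splits_if_polystable[OF ps a]) blast
next
  assume ss: "alpha_semistable X L V \<beta> \<gamma> \<alpha>"
    and sp: "\<forall>V1 V2. two_step V V1 V2 \<and> dagger X L V \<beta> \<gamma> V1 V2 \<and> \<not> (V1 = zero_sub V \<and> V2 = full_sub V) \<and>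
        deg_excess V1 V2 = 0 \<longrightarrow> (\<exists>\<sigma>. splits_two_step V1 V2 \<sigma>)"
  have "\<exists>\<sigma>. splits k F l \<sigma>"
    if "weighted_filtration V k F l" "\<not> trivial_weighted k l" "in_H0_N X L V \<beta> \<gamma> k F l" "d_filt X V k F l \<alpha> = 0" for k F l
    by (rule splits_if_two_step_splits[OF that ss]) (use sp in blast)+
  then show "alpha_polystable X L V \<beta> \<gamma> \<alpha>"
    unfolding alpha_polystable_def splits_def using ss by blast
qed

end

theorem theorem4p9:
  fixes X :: "'x::t2_space atlas"
    and L :: "('x, 'l) vbundle"
    and V :: "('x, 'v) vbundle"
    and \<beta> :: "'x \<Rightarrow> ('v \<Rightarrow> complex) \<Rightarrow> ('v \<Rightarrow> complex) \<Rightarrow> 'l"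
    and \<gamma> :: "'x \<Rightarrow> 'v \<Rightarrow> 'v \<Rightarrow> 'l"
    and n :: nat and \<alpha> :: real
  assumes "compact_riemann_surface X"
    and "hol_bundle X 1 L"
    and "higgs_pair X L n V \<beta> \<gamma>"
  shows
    "(alpha_semistable X L V \<beta> \<gamma> \<alpha> \<longleftrightarrow>
       (\<forall>V1 V2. two_step V V1 V2 \<and> dagger X L V \<beta> \<gamma> V1 V2 \<longrightarrow>
          real_of_int (bundle_degree X V - bundle_degree X (sub_bundle V V2) - bundle_degree X (sub_bundle V V1))
            \<ge> \<alpha> * (real n - real (bundle_rank (sub_bundle V V2)) - real (bundle_rank (sub_bundle V V1)))))
     \<and>
     (alpha_stable X L V \<beta> \<gamma> \<alpha> \<longleftrightarrow>
       (\<forall>V1 V2. two_step V V1 V2 \<and> dagger X L V \<beta> \<gamma> V1 V2 \<and>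
            \<not> (V1 = zero_sub V \<and> V2 = full_sub V) \<longrightarrow>
          real_of_int (bundle_degree X V - bundle_degree X (sub_bundle V V2) - bundle_degree X (sub_bundle V V1))
            > \<alpha> * (real n - real (bundle_rank (sub_bundle V V2)) - real (bundle_rank (sub_bundle V V1)))))
     \<and>
     (alpha_polystable X L V \<beta> \<gamma> \<alpha> \<longleftrightarrow>
       alpha_semistable X L V \<beta> \<gamma> \<alpha> \<and>
       (\<forall>V1 V2. two_step V V1 V2 \<and> dagger X L V \<beta> \<gamma> V1 V2 \<and>
            \<not> (V1 = zero_sub V \<and> V2 = full_sub V) \<and>
            real_of_int (bundle_degree X V - bundle_degree X (sub_bundle V V2) - bundle_degree X (sub_bundle V V1))
              = \<alpha> * (real n - real (bundle_rank (sub_bundle V V2)) - real (bundle_rank (sub_bundle V V1))) \<longrightarrow>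
          (let F = two_step_filt V V1 V2 in
           \<exists>\<sigma>. bundle_iso V (gr_bundle V 3 F) \<sigma> \<and>
              V1 = pre_gr V 3 F \<sigma> {1} \<and>
              V2 = pre_gr V 3 F \<sigma> {1, 2} \<and>
              \<beta> \<in> H0 (sub_bundle (L_sym2 X L V) (sub_sum (L_sym2 X L V)
                {L_tensor_S L V (pre_gr V 3 F \<sigma> {2}) (pre_gr V 3 F \<sigma> {2}),
                 L_tensor_S L V (pre_gr V 3 F \<sigma> {1}) (pre_gr V 3 F \<sigma> {3})})) \<and>
              \<gamma> \<in> H0 (sub_bundle (L_sym2_dual L V) (sub_sum (L_sym2_dual L V)
                {L_tensor_S_dual L V (dual_gr V F \<sigma> 2) (dual_gr V F \<sigma> 2),
                 L_tensor_S_dual L V (dual_gr V F \<sigma> 1) (dual_gr V F \<sigma> 3)})))))"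
proof -
  interpret higgs X n V L \<beta> \<gamma> \<alpha>
    using assms
    by unfold_locales (simp_all add: compact_riemann_surface_def higgs_pair_def)
  have "alpha_semistable X L V \<beta> \<gamma> \<alpha> \<longleftrightarrow>
      (\<forall>V1 V2. two_step V V1 V2 \<and> dagger X L V \<beta> \<gamma> V1 V2 \<longrightarrow> deg_excess V1 V2 \<ge> 0)"
    using alpha_semistableI alpha_semistableD by blast
  moreover have "alpha_stable X L V \<beta> \<gamma> \<alpha> \<longleftrightarrow>
      (\<forall>V1 V2. two_step V V1 V2 \<and> dagger X L V \<beta> \<gamma> V1 V2 \<and> \<not> (V1 = zero_sub V \<and> V2 = full_sub V) \<longrightarrow>
        deg_excess V1 V2 > 0)"
    using alpha_stableI alpha_stableD by blast
  ultimately show ?thesis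
    using polystable_iff_two_step
    unfolding deg_excess_def splits_two_step_iff diff_ge_0_iff_ge diff_gt_0_iff_gt right_minus_eq Let_def
    by (intro conjI)
qed

end
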